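(* Let $\alpha\in\mathbb R$, $j_0\in\mathbb Z_+$, $\beta=-2^{j_0\alpha}$, and let $g$ be a distribution in $\tilde S'$. Consider the equation $$\mathcal D^\alpha f+\beta f=g\qquad( * )$$ with respect to the unknown $f$. If $\langle g,\psi_{j_0,k}\rangle\neq0$ for at least one $k\in\mathbb Z_+$, then $( * )$ has no solutions in $\tilde S'$. If $\langle g,\psi_{j_0,k}\rangle=0$ for all $k\in\mathbb Z_+$, then: 1. Equation $( * )$ has a family of solutions in $\tilde S'$ $$f_{\{c_k\}}=\sum_{k\in\mathbb Z_+,\,j\in\mathbb Z,\,j\ne j_0}\frac{\langle g,\psi_{j,k}\rangle}{2^{j\alpha}+\beta}\,\psi_{j,k}+\sum_{k=0}^\infty c_k\psi_{j_0,k},$$ where $c_k$, $k\in\mathbb Z_+$, are arbitrary complex numbers. 2. If $g$ is continuous on $G$, then all continuous solutions of $( * )$ are given by $$f_{c,\{c_k\}}=\sum_{k=0}^\infty a_k\varphi_{0,k}+\sum_{k,j\in\mathbb Z_+,\,j\neq j_0}\frac{\langle g,\psi_{j,k}\rangle}{2^{j\alpha}+\beta}\,\psi_{j,k}+\sum_{k=0}^\infty c_k\psi_{j_0,k}+c,$$ where $c$ and $c_k$, $k\in\mathbb Z_+$, are arbitrary complex numbers, and $(a_k)_{k\in\mathbb Z_+}$ is a solution of the system $$\sum_{m=0}^{2^{j-1}-1}a_{2^jk+m}-\sum_{m=2^{j-1}}^{2^j-1}a_{2^jk+m}=2^{j/2}a_{-j,k},\qquad j\in\mathbb N,\ k\in\mathbb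 Z_+,\qquad\text{with } a_{-j,k}=\frac{\langle g,\psi_{-j,k}\rangle}{2^{-j\alpha}+\beta}.$$
   Context: $\mathbb N$ = positive integers, $\mathbb Z_+$ = non-negative integers. The Cantor dyadic group $G$ is the set of sequences $x=(x_k)_{k\in\mathbb Z}$, $x_k\in\{0,1\}$, such that $x_k=0$ for all $k$ below some index depending on $x$, with coordinatewise addition modulo 2, denoted $\oplus$; $\mathbf 0$ is the zero sequence. For $x\ne\mathbf 0$ let $N(x)$ be the least $k$ with $x_k=1$ and put $\|x\|=2^{-N(x)-1}$; $\|\mathbf 0\|=0$. The metric is $d(x,y)=\|x\oplus y\|$; balls are $I_n(x)=\{y: d(x,y)<2^{-n}\}$, $I_n=I_n(\mathbf 0)=\{x: x_k=0\ \forall k<n\}$, $I=I_0$. $dx$ is the Haar measure with $\int_Idx=1$. Let $\lambda(x)=\sum_{j}x_j2^{-j-1}$; restricted to the elements of $G$ that are not eventually equal to 1 (as $k\to+\infty$), $\lambda$ is a bijection onto $[0,\infty)$, and $\lambda^{-1}$ denotes its inverse. The dilation is $(Dx)_k=x_{k+1}$. For $f:G\to\mathbb C$, $j\in\mathbb Z$, $h\ge0$: $f_{j,h}(x)=2^{j/2}f(D^jx\oplus\lambda^{-1}(h))$. The Fourier–Walsh transform is $\widehat f(\xi)=\int_Gf(x)\mathrm w(\xi,x)\,dx$ for $f\in L_1(G)$, where $\mathrm w(t,x)=(-1)^{\sum_{k\in\mathbb Z}t_kx_{-k-1}}$. $\varphi=\mathbf 1_I$ and $\psi=2^{-1/2}(\varphi_{1,0}-\varphi_{1,1})$.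 The functions $\psi_{j,k}$ ($j\in\mathbb Z$, $k\in\mathbb Z_+$) form an orthonormal basis of $L_2(G)$ (Haar basis); so do the functions $\varphi_{0,k}$ ($k\in\mathbb Z_+$) together with $\psi_{j,k}$ ($j,k\in\mathbb Z_+$). $S$ is the space of locally constant compactly supported functions $G\to\mathbb C$; a sequence in $S$ converges to $0$ if all its members are supported in a common compact set, are all constant on every ball of one common fixed radius, and tend to zero uniformly. $S'$ is the space of continuous linear functionals on $S$. $\tilde S\subset S$ is the subspace of Haar polynomials (finite linear combinations of the $\psi_{j,k}$, $j\in\mathbb Z$, $k\in\mathbb Z_+$); $\tilde S'$ is the space of continuous linear functionals $f:\phi\mapsto\langle f,\phi\rangle$ on $\tilde S$. An element $f\in\tilde S'$ is identified with its Haar representation, the formal series $\sum_{j\in\mathbb Z,k\in\mathbb Z_+}\langle f,\psi_{j,k}\rangle\psi_{j,k}$. An element of $S'$ is identified with its quasi-Haar representation, the formal series $\sum_{k\in\mathbb Z_+}\langle f,\varphi_{0,k}\rangle\varphi_{0,k}+\sum_{j,k\in\mathbb Z_+}\langle f,\psi_{j,k}\rangle\psi_{j,k}$. A locally integrable function $f$ is regarded as an element of $S'$ (and, by restriction, of $\tilde S'$) via $\langle f,\phi\rangle=\int_Gf\phi\,dx$; a function is a solution of an equation in $\tilde S'$ if the element of $\tilde S'$ it defines is one (different functions may define the same element of $\tilde S'$). For $\alpha\in\mathbb R$ put $\mathbb D^\alpha(x)=\|x\|^\alpha$ for $x\neq\mathbf 0$, $\mathbb D^\alpha(\mathbf 0)=1$.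 The fractional modified Gibbs derivative $\mathcal D^\alpha:\tilde S\to\tilde S$ is defined by $\widehat{\mathcal D^\alpha\phi}=\mathbb D^\alpha\widehat\phi$ (a bijection of $\tilde S$), and is extended to $\tilde S'$ by $\langle\mathcal D^\alpha f,\phi\rangle=\langle f,\mathcal D^\alpha\phi\rangle$, $\phi\in\tilde S$.
   Formalization: Items 1 and 2 are stated for α ≠ 0: for α = 0 every denominator 2^{jα}+β vanishes, the formulas are undefined, and the equation becomes 0 = g, which has no solution for nonzero g. The no-solution claim is kept for all real α. *)

theory Defs
  imports "HOL-Analysis.Analysis" "HOL-Library.Z2"
begin

subsection \<open>The Cantor dyadic group\<close>

typedef cantor = "{x :: int \<Rightarrow> bit. \<exists>n. \<forall>k<n. x k = 0}"
  morphisms coord Cantor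
  by (rule exI[of _ "\<lambda>_. 0"]) simp

lemma coord_bounded_below: "\<exists>n. \<forall>k<n. coord x k = 0"
  using coord[of x] by simp

lemma coord_Cantor: "\<forall>k<n. x k = 0 \<Longrightarrow> coord (Cantor x) = x"
  by (rule Cantor_inverse) auto

lemma cantor_eqI: "(\<And>k. coord x k = coord y k) \<Longrightarrow> x = y"
  by (simp add: coord_inject[symmetric] fun_eq_iff)

instantiation cantor :: ab_group_add
begin

definition zero_cantor :: cantor where
  "0 = Cantor (\<lambda>_. 0)"

definition plus_cantor :: "cantor \<Rightarrow> cantor \<Rightarrow> cantor" where
  "x + y = Cantor (\<lambda>k. coord x k + coord y k)"

definition uminus_cantor :: "cantor \<Rightarrow> cantor" where
  "- x = (x :: cantor)"

definition minus_cantor :: "cantor \<Rightarrow> cantor \<Rightarrow> cantor" where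
  "x - y = (x + y :: cantor)"

lemma coord_zero [simp]: "coord 0 k = 0"
  unfolding zero_cantor_def by (subst coord_Cantor[of 0]) auto

lemma coord_plus [simp]: "coord (x + y) k = coord x k + coord y k"
proof -
  obtain m n where "\<forall>k<m. coord x k = 0" "\<forall>k<n. coord y k = 0"
    using coord_bounded_below by metis
  then have "\<forall>k<min m n. coord x k + coord y k = 0"
    by auto
  then show ?thesis
    unfolding plus_cantor_def by (rule coord_Cantor[THEN fun_cong])
qed

instance
proof
  fix x y z :: cantor
  show "x + y + z = x + (y + z)"
    by (rule cantor_eqI) (simp only: coord_plus add.assoc)
  show "x + y = y + x"
    by (rule cantor_eqI) (simp only: coord_plus add.commute)
  show "0 + x = x"
    by (rule cantor_eqI) simp
  show "- x + x = 0"
    by (rule cantor_eqI) (simp add: uminus_cantor_def)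
  show "x - y = x + - y"
    by (simp add: minus_cantor_def uminus_cantor_def)
qed

end

definition first_index :: "cantor \<Rightarrow> int" where
  "first_index x = (LEAST k. coord x k = 1)"

definition gnorm :: "cantor \<Rightarrow> real" where
  "gnorm x = (if x = 0 then 0 else 2 powi (- first_index x - 1))"

lemma first_index:
  assumes "x \<noteq> 0"
  shows "coord x (first_index x) = 1" and "\<And>k. k < first_index x \<Longrightarrow> coord x k = 0"
proof -
  obtain n where n: "\<forall>k<n. coord x k = 0"
    using coord_bounded_below by blast
  obtain k where k: "coord x k = 1"
    using assms cantor_eqI[of x 0] by (metis bit_not_zero_iff coord_zero)
  define d where "d = (LEAST d::nat. coord x (n + int d) = 1)"
  have "n \<le> k" using n k by (metis not_less zero_neq_one)
  then have "coord x (n + int (nat (k - n))) = 1" using k by simp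
  then have d: "coord x (n + int d) = 1"
    unfolding d_def by (rule LeastI)
  have below: "coord x i = 0" if "i < n + int d" for i
  proof (cases "i < n")
    case False
    then have "nat (i - n) < d" using that by simp
    then have "coord x (n + int (nat (i - n))) \<noteq> 1"
      unfolding d_def by (rule not_less_Least)
    then show ?thesis using False by simp
  qed (use n in simp)
  have "first_index x = n + int d"
    unfolding first_index_def
    by (rule Least_equality) (use d below in \<open>auto simp: not_less[symmetric]\<close>)
  then show "coord x (first_index x) = 1" and "\<And>k. k < first_index x \<Longrightarrow> coord x k = 0"
    using d below by auto
qed

lemma two_powi_le_iff: "(2::real) powi m \<le> 2 powi n \<longleftrightarrow> m \<le> n"
  using power_int_increasing[of m n "2::real"] power_int_strict_increasing[of n m "2::real"]
  by linarith

lemma gnorm_le_iff: "gnorm x \<le> 2 powi (- n - 1) \<longleftrightarrow> (\<forall>k<n. coord x k = 0)"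
proof (cases "x = 0")
  case False
  have "gnorm x \<le> 2 powi (- n - 1) \<longleftrightarrow> n \<le> first_index x"
    using False by (auto simp: gnorm_def two_powi_le_iff)
  also have "\<dots> \<longleftrightarrow> (\<forall>k<n. coord x k = 0)"
    using first_index[OF False] by (metis less_le_trans not_less zero_neq_one)
  finally show ?thesis .
qed (simp add: gnorm_def)

lemma gnorm_ultrametric: "gnorm (x + y) \<le> max (gnorm x) (gnorm y)"
proof (cases "x = 0 \<or> y = 0")
  case False
  define n where "n = min (first_index x) (first_index y)"
  have "gnorm (x + y) \<le> 2 powi (- n - 1)"
    unfolding gnorm_le_iff using False first_index(2) by (auto simp: n_def)
  also have "\<dots> \<le> max (gnorm x) (gnorm y)"
    using False by (auto simp: gnorm_def n_def min_def two_powi_le_iff)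
  finally show ?thesis .
qed auto

lemma gnorm_nonneg: "0 \<le> gnorm x"
  by (simp add: gnorm_def)

instantiation cantor :: metric_space
begin

definition dist_cantor :: "cantor \<Rightarrow> cantor \<Rightarrow> real" where
  "dist x y = gnorm (x + y)"

definition uniformity_cantor :: "(cantor \<times> cantor) filter" where
  "uniformity = (INF e\<in>{0<..}. principal {(x, y). dist x (y :: cantor) < e})"

definition open_cantor_def:
  "open (U :: cantor set) \<longleftrightarrow> (\<forall>x\<in>U. eventually (\<lambda>(x', y). x' = x \<longrightarrow> y \<in> U) uniformity)"

instance
proof
  fix x y z :: cantor
  have "x + y = 0 \<longleftrightarrow> x = y"
    by (metis minus_cantor_def right_minus_eq)
  then show "dist x y = 0 \<longleftrightarrow> x = y"
    by (simp add: dist_cantor_def gnorm_def)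
  have "x + y = x - y"
    by (simp only: minus_cantor_def)
  also have "\<dots> = (x + z) - (y + z)"
    by simp
  finally have "x + y = (x + z) + (y + z)"
    by (simp only: minus_cantor_def)
  then have "dist x y \<le> max (gnorm (x + z)) (gnorm (y + z))"
    unfolding dist_cantor_def by (metis gnorm_ultrametric)
  also have "\<dots> \<le> dist x z + dist y z"
    unfolding dist_cantor_def using gnorm_nonneg[of "x + z"] gnorm_nonneg[of "y + z"] by simp
  finally show "dist x y \<le> dist x z + dist y z" .
qed (fact uniformity_cantor_def open_cantor_def)+

end

definition I_ball :: "int \<Rightarrow> cantor set" where
  "I_ball n = ball 0 (2 powi (- n))"

lemma I_ball_iff: "x \<in> I_ball n \<longleftrightarrow> (\<forall>k<n. coord x k = 0)"
proof -
  have "gnorm x < 2 powi (- n) \<longleftrightarrow> gnorm x \<le> 2 powi (- n - 1)"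
    using zero_less_power_int[of "2::real" "- n"]
    by (cases "x = 0") (auto simp: gnorm_def two_powi_le_iff simp flip: linorder_not_le)
  then show ?thesis
    by (simp add: I_ball_def dist_cantor_def gnorm_le_iff)
qed

text \<open>Translation invariance and the normalisation determine the measure: they force it to be
  finite on compact sets and fix its value on every ball.\<close>

definition is_haar :: "cantor measure \<Rightarrow> bool" where
  "is_haar M \<longleftrightarrow> sets M = sets borel
     \<and> (\<forall>a. \<forall>A\<in>sets borel. emeasure M ((+) a ` A) = emeasure M A)
     \<and> emeasure M (I_ball 0) = 1"

definition haar :: "cantor measure" where
  "haar = (THE M. is_haar M)"


subsection \<open>Dilations and translations\<close>

definition lam :: "cantor \<Rightarrow> real" where
  "lam x = (\<Sum>\<^sub>\<infinity>k. of_bool (coord x k = 1) * 2 powi (- k - 1))"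

definition lam_inv :: "real \<Rightarrow> cantor" where
  "lam_inv = the_inv_into {x. \<not> (\<exists>n. \<forall>k\<ge>n. coord x k = 1)} lam"

definition dilate :: "int \<Rightarrow> cantor \<Rightarrow> cantor" where
  "dilate j x = Cantor (\<lambda>k. coord x (k + j))"

definition scaled :: "(cantor \<Rightarrow> complex) \<Rightarrow> int \<Rightarrow> real \<Rightarrow> cantor \<Rightarrow> complex" where
  "scaled f j h x = complex_of_real (2 powr (real_of_int j / 2)) * f (dilate j x + lam_inv h)"

text \<open>The exponent is a finite sum of products of bits, so only the number of nonzero
  products matters.\<close>

definition walsh :: "cantor \<Rightarrow> cantor \<Rightarrow> complex" where
  "walsh t x = (-1) ^ card {k. coord t k * coord x (- k - 1) = 1}"

definition fourier_walsh :: "(cantor \<Rightarrow> complex) \<Rightarrow> cantor \<Rightarrow> complex" where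
  "fourier_walsh f \<xi> = (\<integral>x. f x * walsh \<xi> x \<partial>haar)"


subsection \<open>Haar functions\<close>

definition scaling_fun :: "cantor \<Rightarrow> complex" where
  "scaling_fun = indicator (I_ball 0)"

definition haar_fun :: "cantor \<Rightarrow> complex" where
  "haar_fun x = complex_of_real (2 powr (-1/2)) * (scaled scaling_fun 1 0 x - scaled scaling_fun 1 1 x)"

definition phi0 :: "nat \<Rightarrow> cantor \<Rightarrow> complex" where
  "phi0 k = scaled scaling_fun 0 (real k)"

definition psi :: "int \<Rightarrow> nat \<Rightarrow> cantor \<Rightarrow> complex" where
  "psi j k = scaled haar_fun j (real k)"


subsection \<open>Test functions and distributions\<close>

definition test_functions :: "(cantor \<Rightarrow> complex) set" where
  "test_functions = {\<phi>. (\<forall>x. \<exists>U. open U \<and> x \<in> U \<and> \<phi> constant_on U)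
                       \<and> compact (closure {x. \<phi> x \<noteq> 0})}"

definition null_sequence :: "(nat \<Rightarrow> cantor \<Rightarrow> complex) \<Rightarrow> bool" where
  "null_sequence \<phi> \<longleftrightarrow>
     (\<exists>K. compact K \<and> (\<forall>n. closure {x. \<phi> n x \<noteq> 0} \<subseteq> K))
     \<and> (\<exists>r>0. \<forall>n x. \<phi> n constant_on ball x r)
     \<and> uniform_limit UNIV \<phi> (\<lambda>_. 0) sequentially"

definition haar_polynomials :: "(cantor \<Rightarrow> complex) set" where
  "haar_polynomials =
     {\<phi>. \<exists>F c. finite F \<and> \<phi> = (\<lambda>x. \<Sum>(j, k)\<in>F. c j k * psi j k x)}"

text \<open>Continuous linear functionals on a subspace \<open>E\<close> of the test functions. Functionals are
  extensional on \<open>E\<close>, so that HOL equality is equality as elements of the dual.\<close>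

definition dual :: "(cantor \<Rightarrow> complex) set \<Rightarrow> ((cantor \<Rightarrow> complex) \<Rightarrow> complex) set" where
  "dual E = {f \<in> extensional E.
     (\<forall>\<phi>\<in>E. \<forall>\<eta>\<in>E. f (\<lambda>x. \<phi> x + \<eta> x) = f \<phi> + f \<eta>)
     \<and> (\<forall>a. \<forall>\<phi>\<in>E. f (\<lambda>x. a * \<phi> x) = a * f \<phi>)
     \<and> (\<forall>\<phi>. (\<forall>n. \<phi> n \<in> E) \<and> null_sequence \<phi> \<longrightarrow> (\<lambda>n. f (\<phi> n)) \<longlonglongrightarrow> 0)}"

definition pairing :: "(cantor \<Rightarrow> complex) \<Rightarrow> (cantor \<Rightarrow> complex) \<Rightarrow> complex" where
  "pairing u \<phi> = (\<integral>x. u x * \<phi> x \<partial>haar)"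

definition regular :: "(cantor \<Rightarrow> complex) set \<Rightarrow> (cantor \<Rightarrow> complex) \<Rightarrow> (cantor \<Rightarrow> complex) \<Rightarrow> complex" where
  "regular E u = (\<lambda>\<phi>\<in>E. pairing u \<phi>)"

text \<open>The values at \<open>\<phi>\<close> of the functionals represented by formal series of Haar functions and of
  integer translates of the scaling function. For the Haar series over all scales \<open>\<phi>\<close> has to be a
  Haar polynomial; for scales bounded below and for the translates it may be any test function.
  Then only finitely many terms are nonzero.\<close>

definition haar_series :: "int set \<Rightarrow> (int \<Rightarrow> nat \<Rightarrow> complex) \<Rightarrow> (cantor \<Rightarrow> complex) \<Rightarrow> complex" where
  "haar_series J c \<phi> = (\<Sum>\<^sub>\<infinity>(j, k)\<in>J \<times> UNIV. c j k * pairing (psi j k) \<phi>)"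

definition phi_series :: "(nat \<Rightarrow> complex) \<Rightarrow> (cantor \<Rightarrow> complex) \<Rightarrow> complex" where
  "phi_series a \<phi> = (\<Sum>\<^sub>\<infinity>k. a k * pairing (phi0 k) \<phi>)"


subsection \<open>The fractional modified Gibbs derivative\<close>

definition gibbs_symbol :: "real \<Rightarrow> cantor \<Rightarrow> real" where
  "gibbs_symbol \<alpha> x = (if x = 0 then 1 else gnorm x powr \<alpha>)"

definition gibbs :: "real \<Rightarrow> (cantor \<Rightarrow> complex) \<Rightarrow> cantor \<Rightarrow> complex" where
  "gibbs \<alpha> \<phi> = (THE \<eta>. \<eta> \<in> haar_polynomials
     \<and> (\<forall>\<xi>. fourier_walsh \<eta> \<xi> = complex_of_real (gibbs_symbol \<alpha> \<xi>) * fourier_walsh \<phi> \<xi>))"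

definition gibbs_dual :: "real \<Rightarrow> ((cantor \<Rightarrow> complex) \<Rightarrow> complex) \<Rightarrow> (cantor \<Rightarrow> complex) \<Rightarrow> complex" where
  "gibbs_dual \<alpha> f = (\<lambda>\<phi>\<in>haar_polynomials. f (gibbs \<alpha> \<phi>))"

definition solutions ::
  "real \<Rightarrow> complex \<Rightarrow> ((cantor \<Rightarrow> complex) \<Rightarrow> complex) \<Rightarrow> ((cantor \<Rightarrow> complex) \<Rightarrow> complex) set" where
  "solutions \<alpha> \<beta> g = {f \<in> dual haar_polynomials.
     \<forall>\<phi>\<in>haar_polynomials. gibbs_dual \<alpha> f \<phi> + \<beta> * f \<phi> = g \<phi>}"

text \<open>In the linear system below \<open>b j k\<close> plays the role of \<open>a\<^bsub>-j,k\<^esub>\<close>.\<close>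

definition coarse_system :: "(nat \<Rightarrow> nat \<Rightarrow> complex) \<Rightarrow> (nat \<Rightarrow> complex) \<Rightarrow> bool" where
  "coarse_system b a \<longleftrightarrow> (\<forall>j\<ge>1. \<forall>k.
     (\<Sum>m = 0..<2 ^ (j - 1). a (2 ^ j * k + m)) - (\<Sum>m = 2 ^ (j - 1)..<2 ^ j. a (2 ^ j * k + m))
       = complex_of_real (2 powr (real j / 2)) * b j k)"

end

theory Submission
  imports Defs
begin

text \<open>The transform of \<open>\<psi>\<^sub>j\<^sub>,\<^sub>k\<close> lives on the sphere of radius \<open>2\<^sup>j\<close>, so \<open>\<psi>\<^sub>j\<^sub>,\<^sub>k\<close> is an eigenvector of the Gibbs
  derivative with eigenvalue \<open>2\<^sup>j\<^sup>\<alpha>\<close>, and the equation decouples into one scalar equation for each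
  Haar coefficient, degenerate exactly at the scale \<open>j0\<close>. A function determines its coefficients
  against the \<open>\<phi>\<^sub>0\<^sub>,\<^sub>k\<close>, and the scalar equations at negative scales say that these solve the coarse
  system, whose homogeneous solutions are the constants. To obtain a continuous solution from a
  continuous right-hand side \<open>g0\<close>, write the multipliers \<open>1 / (2\<^sup>j\<^sup>\<alpha> + \<beta>)\<close>, \<open>j \<ge> 0\<close>, as a constant \<open>s\<close>
  plus a summable sequence. The constant contributes \<open>s * g0\<close>, and since the scale-\<open>j\<close> part of \<open>g0\<close> is
  bounded on a unit ball by the supremum of \<open>|g0|\<close> there, the rest is a series that converges
  uniformly on each unit ball.\<close>

text \<open>The obstacle to a continuous solution is that the scale parts of a merely continuous
  right-hand side are bounded on a unit ball but in general not summable. For \<alpha> > 0 the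
  multipliers decay geometrically; for \<alpha> < 0 they tend to 1/\<beta>, so applying them term by
  term gives no absolutely convergent series, whereas multiplying the whole function by the limit
  costs nothing. Haar polynomials have mean zero, so the equation sees a function only up to an
  additive constant; the continuous solutions are therefore compared as functionals on all test
  functions, and this is the origin of the free constant. Scale \<open>j0\<close> may carry
  arbitrary coefficients because at each point at most one Haar function of a given scale is
  nonzero. The orthogonality relations and the support of the transform come from one symmetry:
  flipping a single coordinate preserves Haar measure and changes the sign of the integrand. Since
  \<open>haar\<close>, \<open>lam_inv\<close> and \<open>gibbs\<close> are definite descriptions,
  each needs existence and uniqueness before anything can be computed.\<close>

lemma not_bit_nat_self: "m \<le> i \<Longrightarrow> \<not> bit (m::nat) i"
proof -
  assume "m \<le> i"
  then have "m < 2 ^ i" by (meson le_less_trans less_exp)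
  then show ?thesis by (simp add: bit_iff_odd)
qed

subsection \<open>Cells\<close>

text \<open>The balls of radius \<open>2\<^sup>-\<^sup>n\<close> are numbered by the natural numbers: the binary digits of the
  index are the coordinates below \<open>n\<close>.\<close>

definition idx :: "int \<Rightarrow> cantor \<Rightarrow> nat" where
  "idx n x = (THE m. \<forall>i. bit m i \<longleftrightarrow> coord x (n - 1 - int i) = 1)"

text \<open>Coordinates far to the left vanish, so only finitely many digits can be 1 and a natural
  number with these digits exists; the description in \<open>idx\<close> is thereby
  discharged.\<close>

lemma bit_idx: "bit (idx n x) i \<longleftrightarrow> coord x (n - 1 - int i) = 1"
proof -
  obtain b where b: "\<forall>k<b. coord x k = 0"
    using coord_bounded_below by blast
  let ?f = "\<lambda>i::nat. coord x (n - 1 - int i) = 1"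
  define L where "L = nat (n - b)"
  define m :: nat where "m = horner_sum of_bool 2 (map ?f [0..<L])"
  have L: "\<not> ?f i" if "L \<le> i" for i
    using that b by (auto simp: L_def)
  have m: "\<forall>i. bit m i \<longleftrightarrow> ?f i"
  proof
    fix i
    show "bit m i \<longleftrightarrow> ?f i"
      using L[of i] by (cases "i < L") (simp_all add: m_def bit_horner_sum_bit_iff)
  qed
  have "\<forall>i. bit (idx n x) i \<longleftrightarrow> ?f i"
    unfolding idx_def
  proof (rule theI)
    show "m' = m" if "\<forall>i. bit m' i \<longleftrightarrow> ?f i" for m'
      by (rule bit_eqI) (use that m in blast)
  qed (rule m)
  then show ?thesis by blast
qed

lemma idx_eq_iff: "idx n x = idx n y \<longleftrightarrow> (\<forall>k<n. coord x k = coord y k)"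
proof
  assume eq: "idx n x = idx n y"
  show "\<forall>k<n. coord x k = coord y k"
  proof (intro allI impI)
    fix k assume "k < n"
    then have "n - 1 - int (nat (n - 1 - k)) = k" by simp
    then have "coord x k = 1 \<longleftrightarrow> coord y k = 1"
      using eq bit_idx[of n x "nat (n - 1 - k)"] bit_idx[of n y "nat (n - 1 - k)"] by simp
    then show "coord x k = coord y k"
      by (cases "coord x k"; cases "coord y k") auto
  qed
next
  assume "\<forall>k<n. coord x k = coord y k"
  then show "idx n x = idx n y"
    by (intro bit_eqI) (auto simp: bit_idx)
qed

lemma idx_zero [simp]: "idx n 0 = 0"
  by (rule bit_eqI) (simp add: bit_idx)

lemma idx_eq_0_iff: "idx n x = 0 \<longleftrightarrow> x \<in> I_ball n"
  using idx_eq_iff[of n x 0] by (simp add: I_ball_iff)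

lemma coord_eq_1_iff_odd: "coord x k = 1 \<longleftrightarrow> odd (idx (k + 1) x)"
  using bit_idx[of "k + 1" x 0] by (simp add: bit_0)

text \<open>Coarsening by \<open>i\<close> levels drops the \<open>i\<close> last binary digits.
  Inclusion of cells thus becomes integer division of indices.\<close>

lemma idx_div: "idx (n + int i) x div 2 ^ i = idx n x"
proof (rule bit_eqI)
  fix l
  have "bit (idx (n + int i) x div 2 ^ i) l = bit (idx (n + int i) x) (i + l)"
    by (simp add: bit_drop_bit_eq flip: drop_bit_eq_div)
  then show "bit (idx (n + int i) x div 2 ^ i) l = bit (idx n x) l"
    by (simp add: bit_idx algebra_simps)
qed

lemma idx_div2: "idx (n + 1) x div 2 = idx n x"
  using idx_div[of n 1 x] by simp

lemma idx_mono: "n \<le> n' \<Longrightarrow> idx n' x = idx n' y \<Longrightarrow> idx n x = idx n y"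
  by (auto simp: idx_eq_iff)

text \<open>The representative of a cell whose coordinates from \<open>n\<close> on vanish. At
  \<open>n = 0\<close> these points turn out to be the translations
  \<open>lam_inv k\<close>.\<close>

definition pt :: "int \<Rightarrow> nat \<Rightarrow> cantor" where
  "pt n m = Cantor (\<lambda>k. of_bool (k < n \<and> bit m (nat (n - 1 - k))))"

lemma coord_pt: "coord (pt n m) k = of_bool (k < n \<and> bit m (nat (n - 1 - k)))"
  unfolding pt_def
  \<comment> \<open>Below this bound the digit position exceeds \<open>m\<close>, and a number has
    no digit 1 at a position that is at least its own value.\<close>
  by (subst coord_Cantor[of "n - 1 - int m"]) (auto simp: not_bit_nat_self)

lemma idx_pt [simp]: "idx n (pt n m) = m"
  by (rule bit_eqI) (simp add: bit_idx coord_pt)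

text \<open>Translation by this element flips coordinate \<open>j\<close> and nothing else; it is
  the symmetry used in the sign arguments.\<close>

definition unit_pt :: "int \<Rightarrow> cantor" where
  "unit_pt j = pt (j + 1) 1"

lemma coord_unit_pt: "coord (unit_pt j) k = of_bool (k = j)"
  by (cases "k = j") (auto simp: unit_pt_def coord_pt bit_1_iff simp del: One_nat_def)

lemma idx_unit_add: "n \<le> j \<Longrightarrow> idx n (unit_pt j + x) = idx n x"
  by (auto simp: idx_eq_iff coord_unit_pt)

definition cell :: "int \<Rightarrow> nat \<Rightarrow> cantor set" where
  "cell n m = {x. idx n x = m}"

lemma in_cell [simp]: "x \<in> cell n m \<longleftrightarrow> idx n x = m"
  by (simp add: cell_def)

lemma cell_split: "cell n m = cell (n + 1) (2 * m) \<union> cell (n + 1) (2 * m + 1)"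
proof -
  have "idx n x = m \<longleftrightarrow> idx (n + 1) x = 2 * m \<or> idx (n + 1) x = 2 * m + 1" for x
    using idx_div2[of n x] by linarith
  then show ?thesis by auto
qed

lemma cell_split_pow:
  "cell n m = (\<Union>i<2 ^ l. cell (n + int l) (2 ^ l * m + i))"
proof -
  have "idx n x = m \<longleftrightarrow> (\<exists>i<2 ^ l. idx (n + int l) x = 2 ^ l * m + i)" for x
  proof -
    have d: "idx n x = idx (n + int l) x div 2 ^ l" by (simp add: idx_div)
    show ?thesis
    proof
      assume "idx n x = m"
      then have "idx (n + int l) x = 2 ^ l * m + idx (n + int l) x mod 2 ^ l"
        using d by (metis mult_div_mod_eq)
      then show "\<exists>i<2 ^ l. idx (n + int l) x = 2 ^ l * m + i"
        by (meson mod_less_divisor pos2 zero_less_power)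
    qed (use d in auto)
  qed
  then show ?thesis by auto
qed

lemma cell_cases:
  "cell n m \<inter> cell n' m' = {} \<or> cell n m \<subseteq> cell n' m' \<or> cell n' m' \<subseteq> cell n m"
proof (cases "n \<le> n'")
  case True
  show ?thesis
    using idx_mono[OF True] unfolding cell_def by (smt (verit) Collect_mono disjoint_iff mem_Collect_eq)
next
  case False
  then have "n' \<le> n" by simp
  from idx_mono[OF this] show ?thesis
    unfolding cell_def by (smt (verit) Collect_mono disjoint_iff mem_Collect_eq)
qed

lemma dist_lt_iff_idx: "dist x y < 2 powi (- n) \<longleftrightarrow> idx n x = idx n y"
proof -
  have eq: "coord x k + coord y k = 0 \<longleftrightarrow> coord x k = coord y k" for k
    by (cases "coord x k"; cases "coord y k") auto
  have "dist x y < 2 powi (- n) \<longleftrightarrow> x + y \<in> I_ball n"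
    by (simp add: I_ball_def dist_cantor_def)
  also have "\<dots> \<longleftrightarrow> idx n x = idx n y"
    by (simp only: I_ball_iff idx_eq_iff coord_plus eq)
  finally show ?thesis .
qed

lemma cell_eq_ball: "cell n (idx n x) = ball x (2 powi (- n))"
  by (auto simp: dist_lt_iff_idx)

lemma open_cell: "open (cell n m)"
  using cell_eq_ball[of n "pt n m"] by simp

lemma ex_powi_less:
  assumes "0 < (r::real)"
  obtains l :: nat where "\<And>n. int l \<le> n \<Longrightarrow> 2 powi (- n) < r"
proof -
  obtain l where l: "(1/2::real) ^ l < r"
    using real_arch_pow_inv[of r "1/2"] assms by auto
  have "2 powi (- n) < r" if "int l \<le> n" for n
  proof -
    have "(2::real) powi (- n) \<le> 2 powi (- int l)"
      using that by (simp add: two_powi_le_iff)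
    also have "\<dots> = (1/2) ^ l" by (simp add: power_int_minus power_one_over inverse_eq_divide)
    finally show ?thesis using l by simp
  qed
  then show ?thesis using that by blast
qed

lemma cell_nbhd:
  assumes "open U" "x \<in> U"
  obtains l :: nat where "\<And>n. int l \<le> n \<Longrightarrow> cell n (idx n x) \<subseteq> U"
proof -
  obtain r where r: "r > 0" "ball x r \<subseteq> U" using assms by (meson open_contains_ball)
  obtain l :: nat where "\<And>n. int l \<le> n \<Longrightarrow> 2 powi (- n) < r" using ex_powi_less[OF r(1)] by blast
  then have "cell n (idx n x) \<subseteq> U" if "int l \<le> n" for n
    unfolding cell_eq_ball using r(2) that subset_ball[of "2 powi (-n)" r x] by force
  then show ?thesis using that by blast
qed

lemma in_cell_0_low:
  obtains l :: nat where "\<And>n. n \<le> - int l \<Longrightarrow> idx n x = 0"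
proof -
  obtain b where b: "\<forall>k<b. coord x k = 0" using coord_bounded_below by blast
  have "idx n x = 0" if "n \<le> - int (nat (- b))" for n
    using that b by (auto simp: idx_eq_0_iff I_ball_iff split: if_splits)
  then show ?thesis using that by blast
qed

text \<open>The cells of index 0 are open, grow as the level decreases, and exhaust the group,
  because every point vanishes far to the left. Finitely many of them cover \<open>K\<close>, and
  the coarsest of these contains the others.\<close>

lemma compact_subset_cell:
  assumes "compact K"
  obtains l :: nat where "\<And>n. n \<le> - int l \<Longrightarrow> K \<subseteq> cell n 0"
proof -
  have anti: "cell (- int i) 0 \<subseteq> cell n 0" if "n \<le> - int i" for n i
    using idx_mono[OF that, of _ 0] by auto
  have "K \<subseteq> (\<Union>i. cell (- int i) 0)"
  proof
    fix x show "x \<in> (\<Union>i. cell (- int i) 0)"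
      using in_cell_0_low[of x] by auto
  qed
  then obtain D where D: "finite D" "K \<subseteq> (\<Union>i\<in>D. cell (- int i) 0)"
    by (rule compactE_image[OF assms open_cell])
  show ?thesis
  proof
    \<comment> \<open>The sum of \<open>D\<close> serves merely as an upper bound for its
      members.\<close>
    fix n assume n: "n \<le> - int (\<Sum>D)"
    have "cell (- int i) 0 \<subseteq> cell n 0" if "i \<in> D" for i
      using n member_le_sum[of i D int] that D(1) by (intro anti) auto
    then show "K \<subseteq> cell n 0" using D(2) by blast
  qed
qed

text \<open>This plays the role of completeness: \<open>m 0\<close> supplies the coordinates below
  \<open>n\<close>, and the parity of \<open>m (i + 1)\<close> is the coordinate at
  \<open>n + i\<close>.\<close>

lemma nested_cells_point:
  fixes m :: "nat \<Rightarrow> nat"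
  assumes "\<And>i. m (Suc i) div 2 = m i"
  obtains x where "\<And>i. idx (n + int i) x = m i"
proof -
  define f :: "int \<Rightarrow> bit" where
    "f k = (if k < n then coord (pt n (m 0)) k else of_bool (odd (m (nat (k - n) + 1))))" for k
  obtain b where b: "\<forall>k<b. coord (pt n (m 0)) k = 0" using coord_bounded_below by blast
  have f: "coord (Cantor f) = f"
    by (rule coord_Cantor[of "min b n"]) (use b in \<open>auto simp: f_def\<close>)
  have "idx (n + int i) (Cantor f) = m i" for i
  proof (induction i)
    case 0
    have "idx n (Cantor f) = idx n (pt n (m 0))"
      unfolding idx_eq_iff by (simp add: f f_def)
    then show ?case by simp
  next
    case (Suc i)
    let ?y = "idx (n + int i + 1) (Cantor f)"
    have "?y div 2 = m (Suc i) div 2" using Suc assms by (simp add: idx_div2)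
    moreover have "odd ?y \<longleftrightarrow> odd (m (Suc i))"
      unfolding coord_eq_1_iff_odd[symmetric] by (simp add: f f_def nat_add_distrib)
    ultimately have "?y = m (Suc i)"
      by (metis bit_eq_rec)
    then show ?case by (simp add: add.commute add.left_commute)
  qed
  then show ?thesis using that by blast
qed

text \<open>Bisection takes the place of compactness of the cell. If \<open>f\<close> is unbounded
  on a cell, it is unbounded on one of the halves; the nested halves shrink to a point, near which
  continuity bounds \<open>f\<close>.\<close>

lemma continuous_bounded_on_cell:
  fixes f :: "cantor \<Rightarrow> 'a::real_normed_vector"
  assumes "continuous_on UNIV f"
  shows "\<exists>M. \<forall>x\<in>cell n m. norm (f x) \<le> M"
proof (rule ccontr)
  define bd where "bd i k = (\<exists>M. \<forall>x\<in>cell (n + int i) k. norm (f x) \<le> M)" for i :: nat and k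
  assume "\<not> ?thesis"
  then have start: "\<not> bd 0 m" by (simp add: bd_def)
  have step: "\<exists>k'. \<not> bd (Suc i) k' \<and> k' div 2 = k" if "\<not> bd i k" for i k
  proof (rule ccontr)
    assume "\<not> ?thesis"
    then have "bd (Suc i) (2 * k)" "bd (Suc i) (2 * k + 1)" by auto
    then obtain M1 M2 where
      "\<forall>x\<in>cell (n + int i + 1) (2 * k). norm (f x) \<le> M1"
      "\<forall>x\<in>cell (n + int i + 1) (2 * k + 1). norm (f x) \<le> M2"
      by (auto simp: bd_def algebra_simps)
    then have "\<forall>x\<in>cell (n + int i) k. norm (f x) \<le> max M1 M2"
      unfolding cell_split[of "n + int i" k] by (auto simp: le_max_iff_disj)
    then show False using that by (auto simp: bd_def)
  qed
  have "\<exists>w. w 0 = m \<and> (\<forall>i. \<not> bd i (w i) \<and> w (Suc i) div 2 = w i)"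
  proof -
    have "\<exists>w. \<forall>i. (\<not> bd i (w i) \<and> (i = 0 \<longrightarrow> w i = m)) \<and> w (Suc i) div 2 = w i"
      by (rule dependent_nat_choice) (use start step in auto)
    then show ?thesis by blast
  qed
  then obtain w where w: "\<And>i. \<not> bd i (w i)" "\<And>i. w (Suc i) div 2 = w i" by blast
  obtain x where x: "\<And>i. idx (n + int i) x = w i" using nested_cells_point[of w n, OF w(2)] by blast
  have "open (f -` ball (f x) 1)"
    using assms by (simp add: open_vimage)
  then obtain l :: nat where l: "\<And>k. int l \<le> k \<Longrightarrow> cell k (idx k x) \<subseteq> f -` ball (f x) 1"
    using cell_nbhd[of "f -` ball (f x) 1" x] by auto
  define i where "i = nat (int l - n)"
  then have li: "int l \<le> n + int i" by simp
  have "norm (f y) \<le> norm (f x) + 1" if "y \<in> cell (n + int i) (w i)" for y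
  proof -
    have "y \<in> f -` ball (f x) 1" using l[of "n + int i"] that x[of i] li by (simp add: subset_iff)
    then have "norm (f x - f y) < 1" by (simp add: dist_norm)
    then show ?thesis using norm_triangle_ineq2[of "f y" "f x"] by (simp add: norm_minus_commute)
  qed
  then have "bd i (w i)" unfolding bd_def by blast
  then show False using w by blast
qed

subsection \<open>Haar measure\<close>

definition cells :: "cantor set set" where
  "cells = insert {} (range (\<lambda>(n, m). cell n m))"

lemma Int_stable_cells: "Int_stable cells"
proof (rule Int_stableI)
  fix a b assume "a \<in> cells" "b \<in> cells"
  then show "a \<inter> b \<in> cells"
    unfolding cells_def
  proof (elim insertE rangeE, goal_cases)
    case (4 p p')
    obtain n m n' m' where "p = (n, m)" "p' = (n', m')" by fastforce
    with 4 cell_cases[of n m n' m'] show ?case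
      by (auto simp: Int_absorb1 Int_absorb2)
  qed auto
qed

text \<open>There are only countably many cells, so the union of all cells contained in a given open
  set is a countable one.\<close>

lemma sets_borel_cells: "sets (borel :: cantor measure) = sigma_sets UNIV cells"
proof -
  have "sigma_sets UNIV {S :: cantor set. open S} = sigma_sets UNIV cells"
  proof (rule sigma_sets_eqI)
    fix U :: "cantor set" assume "U \<in> {S. open S}"
    then have U: "open U" by simp
    have "U = (\<Union>p\<in>{(n, m). cell n m \<subseteq> U}. case p of (n, m) \<Rightarrow> cell n m)"
    proof (intro equalityI subsetI)
      fix x assume "x \<in> U"
      obtain l :: nat where "\<And>n. int l \<le> n \<Longrightarrow> cell n (idx n x) \<subseteq> U"
        using cell_nbhd[OF U \<open>x \<in> U\<close>] by blast
      then have "cell (int l) (idx (int l) x) \<subseteq> U" by simp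
      then show "x \<in> (\<Union>p\<in>{(n, m). cell n m \<subseteq> U}. case p of (n, m) \<Rightarrow> cell n m)"
        by force
    qed auto
    also have "\<dots> \<in> sigma_sets UNIV cells"
      by (rule sigma_sets_UNION) (auto simp: cells_def intro: sigma_sets.Basic)
    finally show "U \<in> sigma_sets UNIV cells" .
  next
    fix a assume "a \<in> cells"
    then show "a \<in> sigma_sets UNIV {S. open S}"
      by (auto simp: cells_def open_cell intro: sigma_sets.Basic sigma_sets.Empty)
  qed
  then show ?thesis by (simp add: borel_def)
qed

text \<open>The cells generate the Borel sets and are closed under intersection, and countably many
  unit cells of finite measure exhaust the group.\<close>

lemma measure_eqI_cells:
  assumes M: "sets M = sets borel" and N: "sets N = sets borel"
    and "\<And>n m. emeasure M (cell n m) = emeasure N (cell n m)"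
    and "\<And>m. emeasure M (cell 0 m) \<noteq> \<infinity>"
  shows "M = N"
proof (rule measure_eqI_generator_eq[OF Int_stable_cells, where \<Omega> = UNIV and A = "cell 0"])
  show "(\<Union>i. cell 0 i) = UNIV" by auto
qed (use assms in \<open>auto simp: cells_def sets_borel_cells\<close>)

text \<open>The standard binary expansion of \<open>t \<ge> 0\<close>: coordinate \<open>k\<close>
  is the digit of weight 2^(-k-1). It pulls cells back to half-open dyadic intervals of matching
  length, so it carries Lebesgue measure to Haar measure.\<close>

definition bin_digits :: "real \<Rightarrow> cantor" where
  "bin_digits t = Cantor (\<lambda>k. of_bool (odd \<lfloor>t * 2 powi (k + 1)\<rfloor>))"

lemma floor_powi_div:
  assumes "0 \<le> (t::real)"
  shows "\<lfloor>t * 2 powi n\<rfloor> div 2 ^ i = \<lfloor>t * 2 powi (n - int i)\<rfloor>"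
proof -
  have "\<lfloor>t * 2 powi n / real_of_int (2 ^ i)\<rfloor> = \<lfloor>t * 2 powi n\<rfloor> div 2 ^ i"
    by (rule floor_divide_real_eq_div) simp
  then show ?thesis by (simp add: power_int_diff)
qed

lemma idx_bin_digits:
  assumes "0 \<le> t"
  shows "idx n (bin_digits t) = nat \<lfloor>t * 2 powi n\<rfloor>"
proof -
  obtain l :: nat where l: "t < 2 ^ l" using real_arch_pow[of 2 t] by auto
  have c: "coord (bin_digits t) = (\<lambda>k. of_bool (odd \<lfloor>t * 2 powi (k + 1)\<rfloor>))"
    unfolding bin_digits_def
  proof (rule coord_Cantor[of "- int l"], intro allI impI)
    fix k assume k: "k < - int l"
    have "t * 2 powi (k + 1) < 2 ^ l * 2 powi (k + 1)" using l by simp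
    also have "\<dots> = 2 powi (int l + k + 1)" by (simp add: power_int_add)
    also have "\<dots> \<le> 2 powi 0" using k by (subst two_powi_le_iff) simp
    finally have "\<lfloor>t * 2 powi (k + 1)\<rfloor> = 0" using assms by (simp add: floor_eq_iff)
    then show "of_bool (odd \<lfloor>t * 2 powi (k + 1)\<rfloor>) = (0::bit)" by simp
  qed
  show ?thesis
  proof (rule bit_eqI)
    fix i
    have pos: "0 \<le> \<lfloor>t * 2 powi n\<rfloor>" using assms by simp
    have "bit (nat \<lfloor>t * 2 powi n\<rfloor>) i \<longleftrightarrow> bit \<lfloor>t * 2 powi n\<rfloor> i"
      using pos by (simp add: bit_nat_iff)
    also have "\<dots> \<longleftrightarrow> odd \<lfloor>t * 2 powi (n - int i)\<rfloor>"
      by (simp add: bit_iff_odd floor_powi_div[OF assms])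
    finally show "bit (idx n (bin_digits t)) i \<longleftrightarrow> bit (nat \<lfloor>t * 2 powi n\<rfloor>) i"
      by (simp add: bit_idx c algebra_simps)
  qed
qed

lemma vimage_bin_digits_cell:
  "bin_digits -` cell n m \<inter> {0..} = {real m * 2 powi (- n) ..< (real m + 1) * 2 powi (- n)}"
proof -
  have "nat \<lfloor>t * 2 powi n\<rfloor> = m \<longleftrightarrow> real m * 2 powi (- n) \<le> t \<and> t < (real m + 1) * 2 powi (- n)"
    if "0 \<le> t" for t
  proof -
    have "nat \<lfloor>t * 2 powi n\<rfloor> = m \<longleftrightarrow> \<lfloor>t * 2 powi n\<rfloor> = int m" using that by (auto simp: nat_eq_iff)
    also have "\<dots> \<longleftrightarrow> real m \<le> t * 2 powi n \<and> t * 2 powi n < real m + 1"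
      by (simp add: floor_eq_iff)
    finally show ?thesis by (simp add: power_int_minus field_simps)
  qed
  moreover have "0 \<le> t" if "real m * 2 powi (- n) \<le> t" for t :: real
    using that order_trans[of 0 "real m * 2 powi (- n)" t] by simp
  ultimately show ?thesis by (auto simp: idx_bin_digits)
qed

definition digit_measure :: "cantor measure" where
  "digit_measure = distr (restrict_space lborel {0..}) borel bin_digits"

lemma measurable_bin_digits: "bin_digits \<in> measurable (restrict_space lborel {0..}) borel"
proof (rule measurable_sigma_sets[OF sets_borel_cells])
  fix A assume "A \<in> cells"
  then consider "A = {}" | n m where "A = cell n m" by (auto simp: cells_def)
  then show "bin_digits -` A \<inter> space (restrict_space lborel {0..}) \<in> sets (restrict_space lborel {0..})"
  proof cases
    case 2
    then show ?thesis
      by (simp add: space_restrict_space vimage_bin_digits_cell sets_restrict_space_iff)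
        (auto intro: order_trans[of 0 "real m * 2 powi (- n)"])
  qed simp
qed auto

lemma emeasure_digit_measure_cell: "emeasure digit_measure (cell n m) = ennreal (2 powi (- n))"
proof -
  have "emeasure digit_measure (cell n m) = emeasure (restrict_space lborel {0..}) (bin_digits -` cell n m \<inter> {0..})"
    unfolding digit_measure_def
    by (subst emeasure_distr[OF measurable_bin_digits]) (auto simp: open_cell space_restrict_space)
  also have "\<dots> = emeasure lborel {real m * 2 powi (- n) ..< (real m + 1) * 2 powi (- n)}"
    by (subst emeasure_restrict_space) (use vimage_bin_digits_cell[of n m] in auto)
  also have "\<dots> = ennreal (2 powi (- n))"
    by (subst emeasure_lborel_Ico) (auto simp: algebra_simps)
  finally show ?thesis .
qed

lemma add_self_cancel: "a + (a + x) = (x::cantor)"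
  by (rule cantor_eqI) (simp flip: add.assoc)

lemma add_image_eq_vimage: "(+) a ` A = (+) (a::cantor) -` A"
  by (auto simp: image_iff) (metis add_self_cancel)+

text \<open>Every element is its own negative, so \<open>a\<close> can be moved to the other side.
  Hence translations permute the cells of each radius.\<close>

lemma idx_add_eq_iff: "idx n (a + x) = m \<longleftrightarrow> idx n x = idx n (a + pt n m)"
proof -
  have "idx n (a + x) = m \<longleftrightarrow> idx n (a + x) = idx n (pt n m)" by simp
  also have "\<dots> \<longleftrightarrow> idx n x = idx n (a + pt n m)"
  proof -
    have "coord a k + coord x k = coord (pt n m) k \<longleftrightarrow> coord x k = coord a k + coord (pt n m) k" for k
      by (cases "coord a k"; cases "coord x k"; cases "coord (pt n m) k") auto
    then show ?thesis by (simp only: idx_eq_iff coord_plus)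
  qed
  finally show ?thesis .
qed

lemma vimage_add_cell: "(+) a -` cell n m = cell n (idx n (a + pt n m))"
  using idx_add_eq_iff by auto

lemma measurable_add_cantor: "(+) (a::cantor) \<in> measurable borel borel"
proof (rule measurable_sigma_sets[OF sets_borel_cells])
  fix A assume "A \<in> cells"
  then show "(+) a -` A \<inter> space borel \<in> sets borel"
    by (auto simp: cells_def vimage_add_cell open_cell)
qed auto

text \<open>A translation permutes the cells of a given radius, and their measure depends on the
  radius alone; a measure with finite unit cells is determined by its values on cells, which gives
  invariance on all Borel sets.\<close>

lemma is_haar_digit_measure: "is_haar digit_measure"
proof -
  have s: "sets digit_measure = sets borel" by (simp add: digit_measure_def)
  then have sp: "space digit_measure = UNIV" by (metis sets_eq_imp_space_eq space_borel)
  have meas: "(+) a \<in> measurable digit_measure borel" for a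
    using measurable_add_cantor by (simp add: measurable_cong_sets[OF s refl])
  have inv: "distr digit_measure borel ((+) a) = digit_measure" for a
  proof (rule measure_eqI_cells)
    show "emeasure (distr digit_measure borel ((+) a)) (cell n m) = emeasure digit_measure (cell n m)" for n m
      by (subst emeasure_distr[OF meas])
        (auto simp: sp vimage_add_cell emeasure_digit_measure_cell open_cell)
    then show "emeasure (distr digit_measure borel ((+) a)) (cell 0 m) \<noteq> \<infinity>" for m
      by (simp add: emeasure_digit_measure_cell)
  qed (simp_all add: s)
  have "emeasure digit_measure ((+) a ` A) = emeasure digit_measure A" if A: "A \<in> sets borel" for a A
  proof -
    have "emeasure digit_measure A = emeasure (distr digit_measure borel ((+) a)) A"
      by (simp add: inv)
    also have "\<dots> = emeasure digit_measure ((+) a -` A)"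
      by (subst emeasure_distr[OF meas A]) (simp add: sp)
    finally show ?thesis by (simp add: add_image_eq_vimage)
  qed
  moreover have "I_ball 0 = cell 0 0" by (auto simp: idx_eq_0_iff)
  ultimately show ?thesis
    by (simp add: is_haar_def s emeasure_digit_measure_cell)
qed

text \<open>Invariance makes all cells of one radius equally large, and a cell consists of two cells
  of the next level. Starting from the normalisation at level 0, the values follow by induction in
  both directions.\<close>

lemma is_haar_cell:
  assumes "is_haar M"
  shows "emeasure M (cell n m) = ennreal (2 powi (- n))"
proof -
  have s: "sets M = sets borel"
    and inv: "\<And>a A. A \<in> sets borel \<Longrightarrow> emeasure M ((+) a ` A) = emeasure M A"
    and one: "emeasure M (I_ball 0) = 1"
    using assms by (auto simp: is_haar_def)
  have tr: "emeasure M (cell n m) = emeasure M (cell n 0)" for n m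
  proof -
    have "(+) (pt n m) ` cell n 0 = cell n m"
    proof -
      have "pt n m + pt n m = 0" using add_self_cancel[of "pt n m" 0] by simp
      then have "idx n (pt n m + pt n 0) = m"
        unfolding idx_add_eq_iff by simp
      then show ?thesis
        unfolding add_image_eq_vimage vimage_add_cell by simp
    qed
    then show ?thesis using inv[of "cell n 0" "pt n m"] by (simp add: open_cell)
  qed
  have two: "emeasure M (cell n 0) = 2 * emeasure M (cell (n + 1) 0)" for n
  proof -
    have "emeasure M (cell n 0) = emeasure M (cell (n + 1) 0) + emeasure M (cell (n + 1) 1)"
      unfolding cell_split[of n 0]
      by (subst plus_emeasure) (auto simp: s open_cell)
    then show ?thesis using tr[of "n + 1" 1] by (simp add: mult_2)
  qed
  have "emeasure M (cell n 0) = ennreal (2 powi (- n))"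
  proof (induction n rule: int_induct[where k = 0])
    case base
    have "I_ball 0 = cell 0 0" by (auto simp: idx_eq_0_iff)
    then show ?case using one by simp
  next
    case (step1 i)
    have "2 * emeasure M (cell (i + 1) 0) = 2 * ennreal (2 powi (- (i + 1)))"
    proof -
      have "2 * emeasure M (cell (i + 1) 0) = ennreal (2 powi (- i))" using step1 two[of i] by simp
      also have "2 powi (- i) = 2 * (2 powi (- (i + 1)) :: real)"
        using power_int_add[of "2::real" 1 "- (i + 1)"] by simp
      finally show ?thesis by (simp add: ennreal_mult)
    qed
    then show ?case by (simp add: ennreal_mult_cancel_left)
  next
    case (step2 i)
    have "emeasure M (cell (i - 1) 0) = 2 * ennreal (2 powi (- i))" using step2 two[of "i - 1"] by simp
    also have "\<dots> = ennreal (2 powi (1 - i))"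
    proof -
      have "2 powi (1 - i) = 2 * (2 powi (- i) :: real)"
        by (simp add: power_int_diff power_int_minus divide_inverse)
      then show ?thesis by (simp add: ennreal_mult)
    qed
    finally show ?case by simp
  qed
  then show ?thesis by (simp add: tr[of n m])
qed

lemma is_haar_haar: "is_haar haar"
proof -
  have "M = digit_measure" if "is_haar M" for M
    using that is_haar_digit_measure
    by (intro measure_eqI_cells) (auto simp: is_haar_cell is_haar_def)
  then show ?thesis unfolding haar_def
    using is_haar_digit_measure by (metis theI')
qed

section \<open>Rules for integration with respect to Haar measure\<close>

lemma sets_haar [simp, measurable_cong]: "sets haar = sets borel"
  using is_haar_haar by (simp add: is_haar_def)

lemma space_haar [simp]: "space haar = UNIV"
  by (metis sets_eq_imp_space_eq sets_haar space_borel)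

lemma measurable_haar [simp]: "measurable haar M = measurable borel M"
  by (rule measurable_cong_sets) simp_all

lemma emeasure_cell: "emeasure haar (cell n m) = ennreal (2 powi (- n))"
  using is_haar_cell[OF is_haar_haar] .

lemma sets_cell [measurable]: "cell n m \<in> sets borel"
  by (simp add: open_cell)

lemma distr_haar_add: "distr haar borel ((+) a) = haar"
proof (rule measure_eqI_cells)
  show "emeasure (distr haar borel ((+) a)) (cell n m) = emeasure haar (cell n m)" for n m
    by (subst emeasure_distr)
      (auto simp: vimage_add_cell emeasure_cell open_cell measurable_add_cantor)
  then show "emeasure (distr haar borel ((+) a)) (cell 0 m) \<noteq> \<infinity>" for m
    by (simp add: emeasure_cell)
qed simp_all

lemma integral_haar_add:
  fixes f :: "cantor \<Rightarrow> complex"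
  shows "(\<integral>x. f (a + x) \<partial>haar) = (\<integral>x. f x \<partial>haar)"
proof (cases "f \<in> borel_measurable borel")
  case True
  then have "(\<integral>x. f x \<partial>haar) = (\<integral>x. f x \<partial>distr haar borel ((+) a))"
    by (simp add: distr_haar_add)
  also have "\<dots> = (\<integral>x. f (a + x) \<partial>haar)"
    using True by (intro integral_distr) (simp_all add: measurable_add_cantor)
  finally show ?thesis by simp
next
  \<comment> \<open>If \<open>f\<close> is not measurable, neither is its translate, since
    translating back would make \<open>f\<close> measurable. Both integrals then have the default
    value 0.\<close>
  case False
  have "(\<lambda>x. f (a + x)) \<notin> borel_measurable borel"
  proof
    assume "(\<lambda>x. f (a + x)) \<in> borel_measurable borel"
    from measurable_compose[OF measurable_add_cantor[of a] this]
    show False using False by (simp add: add_self_cancel)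
  qed
  then show ?thesis
    using False by (metis borel_measurable_integrable measurable_haar not_integrable_integral_eq)
qed

text \<open>By invariance the integral equals its own negative. It is applied below with
  \<open>a\<close> a unit point.\<close>

lemma integral_haar_antisym:
  fixes f :: "cantor \<Rightarrow> complex"
  assumes "\<And>x. f (a + x) = - f x"
  shows "(\<integral>x. f x \<partial>haar) = 0"
proof -
  have "(\<integral>x. f x \<partial>haar) = - (\<integral>x. f x \<partial>haar)"
    using integral_haar_add[of f a] by (simp add: assms)
  then show ?thesis by simp
qed

subsection \<open>Haar functions\<close>

lemma coord_eq_0_iff_even: "coord x k = 0 \<longleftrightarrow> even (idx (k + 1) x)"
  using coord_eq_1_iff_odd[of x k] by (cases "coord x k") auto

section \<open>The value of \<open>lam_inv\<close> at integers and closed forms of the Haar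
  functions\<close>

lemma sum_of_bool_bit: "m < 2 ^ L \<Longrightarrow> (\<Sum>i<L. of_bool (bit m i) * 2 ^ i) = (m::nat)"
  using horner_sum_bit_eq_take_bit[of m L]
  by (simp add: horner_sum_eq_sum take_bit_nat_eq_self atLeast0LessThan)

text \<open>The negative positions contribute the integer part, a finite sum of digits equal to
  \<open>idx 0 x\<close>; the others contribute a convergent fractional series.\<close>

lemma lam_eq:
  "lam x = real (idx 0 x) + (\<Sum>i. of_bool (coord x (int i) = 1) * (1/2) ^ Suc i)"
proof -
  define f :: "int \<Rightarrow> real" where "f k = of_bool (coord x k = 1) * 2 powi (- k - 1)" for k
  define t where "t = (\<Sum>i. of_bool (coord x (int i) = 1) * (1/2::real) ^ Suc i)"
  have fi: "f (int i) = of_bool (coord x (int i) = 1) * (1/2) ^ Suc i" for i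
    by (simp add: f_def power_int_diff power_int_minus power_one_over field_simps)
  have s: "summable (\<lambda>i. norm (f (int i)))"
  proof (rule summable_comparison_test')
    show "summable (\<lambda>i. (1/2::real) ^ Suc i)"
      using power_half_series by (rule sums_summable)
  qed (simp add: fi)
  then have "((\<lambda>i. f (int i)) has_sum t) UNIV"
    unfolding t_def fi[symmetric]
    by (intro norm_summable_imp_has_sum[OF s] summable_sums summable_norm_cancel[OF s])
  then have "(f has_sum t) (range int)"
    by (subst has_sum_reindex) (simp_all add: comp_def)
  then have pos: "(f has_sum t) {0..}"
  proof -
    have "range int = {0..}" by (auto simp: image_iff) (metis nonneg_int_cases)
    then show ?thesis using \<open>(f has_sum t) (range int)\<close> by simp
  qed
  define L where "L = idx 0 x"
  have "(f has_sum (\<Sum>k\<in>(\<lambda>i. - 1 - int i) ` {..<L}. f k)) ((\<lambda>i. - 1 - int i) ` {..<L})"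
    by (rule has_sum_finite) simp
  also have "(\<Sum>k\<in>(\<lambda>i. - 1 - int i) ` {..<L}. f k) = (\<Sum>i<L. f (- 1 - int i))"
    by (subst sum.reindex) (auto simp: inj_on_def)
  also have "\<dots> = (\<Sum>i<L. real (of_bool (bit (idx 0 x) i) * 2 ^ i))"
    by (rule sum.cong) (auto simp: f_def bit_idx)
  also have "\<dots> = real (idx 0 x)"
    using sum_of_bool_bit[of "idx 0 x" L] less_exp[of L] unfolding L_def of_nat_sum[symmetric] by (simp only:)
  also have "(f has_sum real (idx 0 x)) ((\<lambda>i. - 1 - int i) ` {..<L}) \<longleftrightarrow> (f has_sum real (idx 0 x)) {..<0}"
  proof (rule has_sum_cong_neutral)
    fix k assume k: "k \<in> {..<0} - (\<lambda>i. - 1 - int i) ` {..<L}"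
    then have "k = - 1 - int (nat (- 1 - k))" by simp
    then have "L \<le> nat (- 1 - k)" using k by (metis DiffD2 image_eqI lessThan_iff not_less)
    then have "\<not> bit (idx 0 x) (nat (- 1 - k))" unfolding L_def by (rule not_bit_nat_self)
    then show "f k = 0" using k by (simp add: bit_idx f_def)
  qed auto
  finally have neg: "(f has_sum real (idx 0 x)) {..<0}" .
  have "(f has_sum (real (idx 0 x) + t)) ({..<0} \<union> {0..})"
    by (rule has_sum_Un_disjoint[OF neg pos]) auto
  moreover have "{..<0} \<union> {0..} = (UNIV :: int set)" by auto
  ultimately show ?thesis
    unfolding lam_def t_def f_def by (simp add: infsumI)
qed

lemma lam_pt: "lam (pt 0 k) = real k"
  by (simp add: lam_eq coord_pt)

text \<open>The description in \<open>lam_inv\<close> requires uniqueness: for a sequence that is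
  not eventually 1 the fractional series stays strictly below 1, so an integer value
  \<open>k\<close> forces the integer part \<open>k\<close> and all fractional digits 0.\<close>

lemma lam_inv_nat: "lam_inv (real k) = pt 0 k"
proof -
  have uniq: "x = pt 0 k" if x: "\<not> (\<exists>n. \<forall>i\<ge>n. coord x i = 1)" "lam x = real k" for x
  proof -
    \<comment> \<open>\<open>g\<close> collects the weights of the digits 0. The two series add up
      to 1, so a single digit 0 at a nonnegative position keeps the fractional part below 1.\<close>
    define f g :: "nat \<Rightarrow> real" where "f i = of_bool (coord x (int i) = 1) * (1/2) ^ Suc i"
      and "g i = of_bool (coord x (int i) = 0) * (1/2) ^ Suc i" for i
    have h: "summable (\<lambda>i. (1/2::real) ^ Suc i)" "(\<Sum>i. (1/2::real) ^ Suc i) = 1"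
      using power_half_series by (auto simp: sums_iff)
    have f: "summable f"
      by (rule summable_comparison_test'[OF h(1), of 0]) (simp add: f_def)
    have g: "summable g"
      by (rule summable_comparison_test'[OF h(1), of 0]) (simp add: g_def)
    have "(\<Sum>i. f i + g i) = (\<Sum>i. (1/2::real) ^ Suc i)"
      by (rule suminf_cong) (simp add: f_def g_def)
    then have "(\<Sum>i. f i) + (\<Sum>i. g i) = 1"
      unfolding suminf_add[OF f g] h(2) .
    moreover have "(\<Sum>i. g i) > 0"
    proof -
      obtain i where "i \<ge> 0" "coord x i \<noteq> 1" using x by blast
      then have "g (nat i) > 0" by (simp add: g_def)
      then have "\<exists>i. g i > 0" ..
      moreover have "\<And>i. g i \<ge> 0" by (simp add: g_def)
      ultimately show ?thesis by (simp only: suminf_pos_iff[OF g])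
    qed
    moreover have pos: "(\<Sum>i. f i) \<ge> 0" by (rule suminf_nonneg[OF f]) (simp add: f_def)
    moreover have eq: "real k = real (idx 0 x) + (\<Sum>i. f i)"
      using x(2) by (simp add: lam_eq f_def)
    ultimately have "real (idx 0 x) \<le> real k" "real k < real (idx 0 x) + 1" by linarith+
    then have idx: "idx 0 x = k" by linarith
    then have "(\<Sum>i. f i) = 0" using eq by simp
    then have "\<forall>i. f i = 0" by (subst (asm) suminf_eq_zero_iff[OF f]) (auto simp: f_def)
    then have z: "coord x i = 0" if "i \<ge> 0" for i
      using that by (auto simp: f_def dest!: spec[of _ "nat i"])
    show ?thesis
    proof (rule cantor_eqI)
      fix i
      show "coord x i = coord (pt 0 k) i"
      proof (cases "i < 0")
        case True
        have "idx 0 x = idx 0 (pt 0 k)" using idx by simp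
        then show ?thesis using True unfolding idx_eq_iff by blast
      qed (simp add: z coord_pt)
    qed
  qed
  have "\<not> (\<exists>n. \<forall>i\<ge>n. coord (pt 0 k) i = 1)"
  proof
    assume "\<exists>n. \<forall>i\<ge>n. coord (pt 0 k) i = 1"
    then obtain n where "\<forall>i\<ge>n. coord (pt 0 k) i = 1" ..
    then have "coord (pt 0 k) (max n 0) = 1" by simp
    then show False by (simp add: coord_pt)
  qed
  then have mem: "pt 0 k \<in> {x. \<not> (\<exists>n. \<forall>i\<ge>n. coord x i = 1)}" by blast
  show ?thesis
    unfolding lam_inv_def the_inv_into_def
  proof (rule the_equality)
    show "pt 0 k \<in> {x. \<not> (\<exists>n. \<forall>i\<ge>n. coord x i = 1)} \<and> lam (pt 0 k) = real k"
      using mem lam_pt by (rule conjI)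
  next
    fix x assume "x \<in> {x. \<not> (\<exists>n. \<forall>i\<ge>n. coord x i = 1)} \<and> lam x = real k"
    then show "x = pt 0 k" using uniq by blast
  qed
qed

lemma coord_dilate: "coord (dilate j x) k = coord x (k + j)"
proof -
  obtain n where n: "\<forall>k<n. coord x k = 0" using coord_bounded_below by blast
  show ?thesis unfolding dilate_def
    by (subst coord_Cantor[of "n - j"]) (use n in auto)
qed

lemma idx_dilate: "idx n (dilate j x) = idx (n + j) x"
  by (rule bit_eqI) (simp add: bit_idx coord_dilate algebra_simps)

text \<open>Adding \<open>pt 0 k\<close> brings exactly the unit cell of index \<open>k\<close> to
  the origin, and the dilation shifts the level by \<open>j\<close>. A scaled copy of a function
  living on the unit ball therefore lives on \<open>cell j k\<close>.\<close>

lemma idx_dilate_add_lam_inv: "idx 0 (dilate j x + lam_inv (real k)) = 0 \<longleftrightarrow> idx j x = k"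
proof -
  have "pt 0 0 = 0" by (rule cantor_eqI) (simp add: coord_pt)
  have "idx 0 (dilate j x + lam_inv (real k)) = 0 \<longleftrightarrow> idx 0 (dilate j x) = idx 0 (pt 0 k + pt 0 0)"
    unfolding lam_inv_nat by (subst add.commute) (rule idx_add_eq_iff)
  then show ?thesis by (simp add: \<open>pt 0 0 = 0\<close> idx_dilate)
qed

lemma scaling_fun_eq: "scaling_fun x = of_bool (idx 0 x = 0)"
  by (simp add: scaling_fun_def indicator_def idx_eq_0_iff)

lemma phi0_eq: "phi0 k = indicator (cell 0 k)"
  by (rule ext) (simp add: phi0_def scaled_def scaling_fun_eq idx_dilate_add_lam_inv indicator_def)

text \<open>The Rademacher function of coordinate \<open>j\<close>, which supplies the sign of every
  \<open>psi j k\<close>.\<close>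

definition rho :: "int \<Rightarrow> cantor \<Rightarrow> complex" where
  "rho j x = (if coord x j = 0 then 1 else - 1)"

lemma haar_fun_eq: "haar_fun x = of_bool (idx 0 x = 0) * rho 0 x"
proof -
  have s: "(2::real) powr (- 1 / 2) * 2 powr (1 / 2) = 1"
    by (simp flip: powr_add)
  have "haar_fun x = complex_of_real (2 powr (- 1 / 2) * 2 powr (1 / 2)) *
      (of_bool (idx 1 x = 0) - of_bool (idx 1 x = 1))"
    using idx_dilate_add_lam_inv[of 1 x 0] idx_dilate_add_lam_inv[of 1 x 1]
    by (simp add: haar_fun_def scaled_def scaling_fun_eq algebra_simps)
  also have "\<dots> = of_bool (idx 1 x = 0) - of_bool (idx 1 x = 1)"
    unfolding s by simp
  also have "\<dots> = of_bool (idx 0 x = 0) * rho 0 x"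
  proof -
    have "coord x 0 = 0 \<longleftrightarrow> even (idx 1 x)"
      using coord_eq_0_iff_even[of x 0] by simp
    moreover have "idx 0 x = idx 1 x div 2" using idx_div2[of 0 x] by simp
    moreover have "idx 1 x = 0 \<longleftrightarrow> idx 1 x div 2 = 0 \<and> even (idx 1 x)"
      "idx 1 x = 1 \<longleftrightarrow> idx 1 x div 2 = 0 \<and> odd (idx 1 x)" by presburger+
    ultimately show ?thesis by (auto simp: rho_def)
  qed
  finally show ?thesis .
qed

abbreviation amp :: "int \<Rightarrow> complex" where
  "amp j \<equiv> complex_of_real (2 powr (real_of_int j / 2))"

lemma psi_eq: "psi j k x = amp j * (of_bool (idx j x = k) * rho j x)"
proof -
  have "coord (dilate j x + lam_inv (real k)) 0 = coord x j"
    by (simp only: coord_plus coord_dilate lam_inv_nat coord_pt) simp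
  then show ?thesis
    unfolding psi_def scaled_def haar_fun_eq rho_def idx_dilate_add_lam_inv by simp
qed

lemma rho_indicator:
  "of_bool (idx j x = k) * rho j x = indicator (cell (j + 1) (2 * k)) x - indicator (cell (j + 1) (2 * k + 1)) x"
proof -
  have "coord x j = 0 \<longleftrightarrow> even (idx (j + 1) x)"
    by (rule coord_eq_0_iff_even)
  moreover have "idx j x = idx (j + 1) x div 2" by (simp add: idx_div2)
  moreover have "idx (j + 1) x = 2 * k \<longleftrightarrow> idx (j + 1) x div 2 = k \<and> even (idx (j + 1) x)"
    "idx (j + 1) x = 2 * k + 1 \<longleftrightarrow> idx (j + 1) x div 2 = k \<and> odd (idx (j + 1) x)" by presburger+
  ultimately show ?thesis by (auto simp: rho_def indicator_def)
qed

lemma psi_indicator: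
  "psi j k x = amp j * (indicator (cell (j + 1) (2 * k)) x - indicator (cell (j + 1) (2 * k + 1)) x)"
  unfolding psi_eq rho_indicator ..

lemma indicator_cell_split_pow:
  "indicator (cell n m) x = (\<Sum>i<2 ^ l. indicator (cell (n + int l) (2 ^ l * m + i)) x :: complex)"
  unfolding cell_split_pow[of n m l]
  by (subst indicator_UN_disjoint) (auto simp: disjoint_family_on_def)

lemma rho_square: "rho j x * rho j x = 1"
  by (simp add: rho_def)

lemma rho_unit_add: "rho j (unit_pt i + x) = (if i = j then - rho j x else rho j x)"
  unfolding rho_def coord_plus coord_unit_pt by (cases "coord x j") auto

lemma psi_unit_add: "psi j k (unit_pt j + x) = - psi j k x"
  by (simp add: psi_eq idx_unit_add rho_unit_add)

lemma psi_unit_add_above: "j < i \<Longrightarrow> psi j k (unit_pt i + x) = psi j k x"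
  by (simp add: psi_eq idx_unit_add rho_unit_add)

section \<open>Orthonormality of the Haar functions\<close>

lemma pairing_commute: "pairing u v = pairing v u"
  by (simp add: pairing_def mult.commute)

text \<open>Flipping coordinate \<open>j\<close> changes the sign of \<open>psi j k\<close> and
  leaves \<open>u\<close> alone, so the integrand is antisymmetric.\<close>

lemma pairing_psi_invariant:
  assumes "\<And>x. u (unit_pt j + x) = u x"
  shows "pairing (psi j k) u = 0"
  unfolding pairing_def by (rule integral_haar_antisym[of _ "unit_pt j"]) (simp add: assms psi_unit_add)

lemma indicator_of_real: "indicator A = (\<lambda>x. complex_of_real (indicator A x))"
  by (auto simp: indicator_def)

lemma integrable_cell [simp]: "integrable haar (indicator (cell n m) :: cantor \<Rightarrow> complex)"
  unfolding indicator_of_real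
  by (intro integrable_of_real integrable_real_indicator) (auto simp: emeasure_cell open_cell)

lemma integral_cell: "(\<integral>x. indicator (cell n m) x \<partial>haar) = complex_of_real (2 powi (- n))"
proof -
  have "measure haar (cell n m) = 2 powi (- n)"
    by (simp add: measure_def emeasure_cell)
  then show ?thesis unfolding indicator_of_real by simp
qed

lemma amp_square: "amp j * amp j = complex_of_real (2 powi j)"
  by (simp add: powr_real_of_int' flip: of_real_mult powr_add)

text \<open>At different scales the coarser function is invariant under the flip belonging to the
  finer one. At equal scales the product is 0 or 2^j times the indicator of a cell of measure
  2^(-j).\<close>

lemma pairing_psi_psi:
  "pairing (psi j k) (psi j' k') = of_bool (j = j' \<and> k = k')"
proof -
  have lt: "pairing (psi j k) (psi j' k') = 0" if "j' < j" for j j' k k'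
    by (rule pairing_psi_invariant) (simp add: psi_unit_add_above that)
  consider "j < j'" | "j' < j" | "j = j'" by linarith
  then show ?thesis
  proof cases
    case 1
    then show ?thesis using lt[OF 1] by (simp add: pairing_commute[of "psi j k"])
  next
    case 3
    have "psi j k x * psi j k' x = of_bool (k = k') * (complex_of_real (2 powi j) * indicator (cell j k) x)" for x
    proof -
      have "psi j k x * psi j k' x =
          (amp j * amp j) * (of_bool (idx j x = k) * of_bool (idx j x = k') * (rho j x * rho j x))"
        by (simp only: psi_eq mult_ac)
      then show ?thesis
        unfolding amp_square rho_square by (auto simp: indicator_def)
    qed
    then have "pairing (psi j k) (psi j k') = of_bool (k = k') * (complex_of_real (2 powi j) * complex_of_real (2 powi (- j)))"
      by (simp add: pairing_def integral_cell)
    also have "\<dots> = of_bool (k = k')"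
      by (simp add: power_int_minus)
    finally show ?thesis using 3 by simp
  qed (simp add: lt)
qed

lemma pairing_phi0_phi0: "pairing (phi0 k) (phi0 k') = of_bool (k = k')"
proof -
  have "phi0 k x * phi0 k' x = of_bool (k = k') * indicator (cell 0 k) x" for x
    by (auto simp: phi0_eq indicator_def)
  then show ?thesis by (simp add: pairing_def integral_cell)
qed

lemma pairing_psi_phi0: "0 \<le> j \<Longrightarrow> pairing (psi j k) (phi0 k') = 0"
  by (rule pairing_psi_invariant) (simp add: phi0_eq indicator_def idx_unit_add)

lemma integral_psi: "(\<integral>x. psi j k x \<partial>haar) = 0"
  by (rule integral_haar_antisym[of _ "unit_pt j"]) (rule psi_unit_add)

subsection \<open>Step functions\<close>

text \<open>\<open>N\<close> bounds the support and \<open>n\<close> is the resolution. For fixed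
  \<open>N\<close> and \<open>n\<close> these functions form a finite-dimensional space, which is
  what makes the formal series finite and continuity easy.\<close>

definition adapted :: "int \<Rightarrow> int \<Rightarrow> (cantor \<Rightarrow> complex) \<Rightarrow> bool" where
  "adapted N n \<phi> \<longleftrightarrow> (\<forall>x y. idx n x = idx n y \<longrightarrow> \<phi> x = \<phi> y) \<and> (\<forall>x. idx N x \<noteq> 0 \<longrightarrow> \<phi> x = 0)"

lemma adaptedI:
  "(\<And>x y. idx n x = idx n y \<Longrightarrow> \<phi> x = \<phi> y) \<Longrightarrow> (\<And>x. idx N x \<noteq> 0 \<Longrightarrow> \<phi> x = 0) \<Longrightarrow> adapted N n \<phi>"
  unfolding adapted_def by blast

lemma adapted_const: "adapted N n \<phi> \<Longrightarrow> idx n x = idx n y \<Longrightarrow> \<phi> x = \<phi> y"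
  unfolding adapted_def by blast

lemma adapted_zero: "adapted N n \<phi> \<Longrightarrow> idx N x \<noteq> 0 \<Longrightarrow> \<phi> x = 0"
  unfolding adapted_def by blast

lemma adapted_mono: "adapted N n \<phi> \<Longrightarrow> N' \<le> N \<Longrightarrow> n \<le> n' \<Longrightarrow> adapted N' n' \<phi>"
  unfolding adapted_def by (metis idx_mono idx_zero)

text \<open>At level \<open>n\<close> the cells inside \<open>cell N 0\<close> are those with index
  below \<open>2 ^ nat (n - N)\<close>, so finitely many values describe the function.\<close>

lemma adapted_sum:
  assumes "adapted N n \<phi>" "N \<le> n"
  shows "\<phi> x = (\<Sum>m<2 ^ nat (n - N). \<phi> (pt n m) * indicator (cell n m) x)"
proof -
  have eq: "\<phi> (pt n (idx n x)) = \<phi> x"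
    by (rule adapted_const[OF assms(1)]) simp
  have "(\<Sum>m<2 ^ nat (n - N). \<phi> (pt n m) * indicator (cell n m) x) =
      (\<Sum>m<2 ^ nat (n - N). if m = idx n x then \<phi> x else 0)"
    by (intro sum.cong) (auto simp: indicator_def eq)
  also have "\<dots> = (if idx n x < 2 ^ nat (n - N) then \<phi> x else 0)" by simp
  also have "\<dots> = \<phi> x"
  proof -
    have "idx N x = idx n x div 2 ^ nat (n - N)"
      using idx_div[of N "nat (n - N)" x] assms(2) by simp
    then have "idx n x < 2 ^ nat (n - N) \<longleftrightarrow> idx N x = 0"
      by (simp add: div_eq_0_iff)
    then show ?thesis using adapted_zero[OF assms(1), of x] by auto
  qed
  finally show ?thesis by simp
qed

text \<open>Every compact set lies in a single cell by \<open>compact_subset_cell\<close>, so this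
  is the usual local integrability.\<close>

definition locally_integrable :: "(cantor \<Rightarrow> complex) \<Rightarrow> bool" where
  "locally_integrable f \<longleftrightarrow> (\<forall>n m. integrable haar (\<lambda>x. f x * indicator (cell n m) x))"

lemma locally_integrable_bounded:
  assumes f: "f \<in> borel_measurable borel"
    and bd: "\<And>n m. \<exists>M. \<forall>x\<in>cell n m. norm (f x) \<le> M"
  shows "locally_integrable f"
  unfolding locally_integrable_def
proof (intro allI)
  fix n m
  obtain M where M: "\<forall>x\<in>cell n m. norm (f x) \<le> M" using bd by blast
  show "integrable haar (\<lambda>x. f x * indicator (cell n m) x)"
  proof (rule Bochner_Integration.integrable_bound)
    show "integrable haar (\<lambda>x. complex_of_real M * indicator (cell n m) x)"
      by (intro integrable_mult_right integrable_cell)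
    show "(\<lambda>x. f x * indicator (cell n m) x) \<in> borel_measurable haar"
      using f by simp
    show "AE x in haar. norm (f x * indicator (cell n m) x) \<le> norm (complex_of_real M * indicator (cell n m) x)"
    proof (intro AE_I2)
      fix x
      show "norm (f x * indicator (cell n m) x) \<le> norm (complex_of_real M * indicator (cell n m) x)"
      proof (cases "x \<in> cell n m")
        case True
        then have "norm (f x) \<le> M" using M by blast
        then show ?thesis using True by simp
      qed simp
    qed
  qed
qed

lemma locally_integrable_continuous: "continuous_on UNIV f \<Longrightarrow> locally_integrable f"
  by (intro locally_integrable_bounded borel_measurable_continuous_onI continuous_bounded_on_cell)

lemma continuous_idx_invariant:
  assumes "\<And>x y. idx n x = idx n y \<Longrightarrow> f x = f y"
  shows "continuous_on UNIV (f :: cantor \<Rightarrow> 'a::topological_space)"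
proof -
  have "open (f -` B)" for B
  proof -
    have "y \<in> f -` B" if "x \<in> f -` B" "idx n y = idx n x" for x y
      using assms[OF that(2)] that(1) by simp
    then have "f -` B = (\<Union>x\<in>f -` B. cell n (idx n x))"
      unfolding cell_def by blast
    then show ?thesis by (metis open_UN open_cell)
  qed
  then show ?thesis by (simp add: continuous_on_open_vimage)
qed

lemma locally_integrable_idx_invariant:
  assumes "\<And>x y. idx n x = idx n y \<Longrightarrow> f x = f y"
  shows "locally_integrable f"
  by (intro locally_integrable_continuous continuous_idx_invariant[of n]) (rule assms)

lemma adapted_integrable_mult:
  assumes "locally_integrable f" "adapted N n \<phi>"
  shows "integrable haar (\<lambda>x. f x * \<phi> x)"
proof -
  have \<phi>: "adapted N (max N n) \<phi>" by (rule adapted_mono[OF assms(2)]) auto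
  have eq: "(\<lambda>x. f x * \<phi> x) = (\<lambda>x. \<Sum>m<2 ^ nat (max N n - N). \<phi> (pt (max N n) m) * (f x * indicator (cell (max N n) m) x))"
    by (subst adapted_sum[OF \<phi>]) (simp_all only: sum_distrib_left mult_ac max.cobounded1)
  show ?thesis unfolding eq
    using assms(1) by (intro Bochner_Integration.integrable_sum integrable_mult_right) (simp add: locally_integrable_def)
qed

lemma adapted_integrable: "adapted N n \<phi> \<Longrightarrow> integrable haar \<phi>"
  using adapted_integrable_mult[of "\<lambda>_. 1" N n \<phi>] locally_integrable_continuous[of "\<lambda>_. 1"] by simp

lemma pairing_adapted:
  assumes "locally_integrable f" "adapted N n \<phi>" "N \<le> n"
  shows "pairing f \<phi> = (\<Sum>m<2 ^ nat (n - N). \<phi> (pt n m) * pairing f (indicator (cell n m)))"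
proof -
  have "pairing f \<phi> = (\<integral>x. (\<Sum>m<2 ^ nat (n - N). \<phi> (pt n m) * (f x * indicator (cell n m) x)) \<partial>haar)"
    unfolding pairing_def
    by (subst adapted_sum[OF assms(2,3)]) (simp only: sum_distrib_left mult_ac)
  also have "\<dots> = (\<Sum>m<2 ^ nat (n - N). \<phi> (pt n m) * pairing f (indicator (cell n m)))"
    using assms(1) unfolding pairing_def
    by (subst Bochner_Integration.integral_sum) (auto simp: locally_integrable_def intro!: integrable_mult_right)
  finally show ?thesis .
qed

lemma adapted_add: "adapted N n \<phi> \<Longrightarrow> adapted N n \<eta> \<Longrightarrow> adapted N n (\<lambda>x. \<phi> x + \<eta> x)"
  unfolding adapted_def by (metis add.right_neutral)

lemma adapted_scale: "adapted N n \<phi> \<Longrightarrow> adapted N n (\<lambda>x. a * \<phi> x)"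
  unfolding adapted_def by (metis mult_zero_right)

lemma adapted_pair:
  assumes "adapted N n \<phi>" "adapted N' n' \<eta>"
  obtains N'' n'' where "N'' \<le> n''" "adapted N'' n'' \<phi>" "adapted N'' n'' \<eta>"
proof
  define M where "M = min N N'"
  show "M \<le> max M (max n n')" by simp
  show "adapted M (max M (max n n')) \<phi>" "adapted M (max M (max n n')) \<eta>"
    using assms by (auto intro: adapted_mono simp: M_def)
qed

text \<open>The space of test functions expressed through indices; both
  \<open>test_functions\<close> and \<open>haar_polynomials\<close> are shown to lie in it.\<close>

definition step_functions :: "(cantor \<Rightarrow> complex) set" where
  "step_functions = {\<phi>. \<exists>N n. adapted N n \<phi>}"

lemma step_functionsE:
  assumes "\<phi> \<in> step_functions"
  obtains N n where "N \<le> n" "adapted N n \<phi>"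
  using assms adapted_pair unfolding step_functions_def by blast

lemma step_add: "\<phi> \<in> step_functions \<Longrightarrow> \<eta> \<in> step_functions \<Longrightarrow> (\<lambda>x. \<phi> x + \<eta> x) \<in> step_functions"
proof (elim step_functionsE)
  fix N n N' n' assume "adapted N n \<phi>" "adapted N' n' \<eta>"
  then obtain N'' n'' where "adapted N'' n'' \<phi>" "adapted N'' n'' \<eta>" by (rule adapted_pair)
  then have "adapted N'' n'' (\<lambda>x. \<phi> x + \<eta> x)" by (rule adapted_add)
  then show ?thesis by (auto simp: step_functions_def)
qed

lemma step_scale: "\<phi> \<in> step_functions \<Longrightarrow> (\<lambda>x. a * \<phi> x) \<in> step_functions"
  unfolding step_functions_def using adapted_scale by blast

lemma step_sum:
  "(\<And>i. i \<in> F \<Longrightarrow> \<phi> i \<in> step_functions) \<Longrightarrow> (\<lambda>x. \<Sum>i\<in>F. \<phi> i x) \<in> step_functions"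
proof (induction F rule: infinite_finite_induct)
  case (insert i F)
  then show ?case by (simp add: step_add)
qed (auto simp: step_functions_def adapted_def)

lemma step_cell: "indicator (cell n m) \<in> step_functions"
proof -
  obtain l :: nat where l: "\<And>k. k \<le> - int l \<Longrightarrow> idx k (pt n m) = 0" using in_cell_0_low by blast
  define N where "N = min n (- int l)"
  have "idx N x = 0" if "idx n x = m" for x
    using idx_mono[of N n x "pt n m"] that l[of N] by (simp add: N_def)
  then have "adapted N n (indicator (cell n m))"
    by (auto intro!: adaptedI simp: indicator_def)
  then show ?thesis by (auto simp: step_functions_def)
qed

lemma step_phi0: "phi0 k \<in> step_functions"
  by (simp add: phi0_eq step_cell)

lemma step_psi: "psi j k \<in> step_functions"
proof -
  have "psi j k = (\<lambda>x. amp j * (indicator (cell (j + 1) (2 * k)) x + - 1 * indicator (cell (j + 1) (2 * k + 1)) x))"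
    by (auto simp: psi_indicator)
  then show ?thesis by (simp only: step_add step_scale step_cell)
qed

lemma integrable_step:
  "locally_integrable f \<Longrightarrow> \<phi> \<in> step_functions \<Longrightarrow> integrable haar (\<lambda>x. f x * \<phi> x)"
  unfolding step_functions_def using adapted_integrable_mult by blast

lemma step_locally_integrable: "\<phi> \<in> step_functions \<Longrightarrow> locally_integrable \<phi>"
  unfolding step_functions_def mem_Collect_eq
  by (meson adapted_const locally_integrable_idx_invariant)

lemma pairing_add:
  "locally_integrable f \<Longrightarrow> \<phi> \<in> step_functions \<Longrightarrow> \<eta> \<in> step_functions \<Longrightarrow>
    pairing f (\<lambda>x. \<phi> x + \<eta> x) = pairing f \<phi> + pairing f \<eta>"
  unfolding pairing_def by (simp add: distrib_left integrable_step)

lemma pairing_scale: "pairing f (\<lambda>x. a * \<phi> x) = a * pairing f \<phi>"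
  unfolding pairing_def by (simp add: mult.left_commute flip: integral_mult_right_zero)

lemma pairing_sum:
  assumes "locally_integrable f" "\<And>i. i \<in> F \<Longrightarrow> \<phi> i \<in> step_functions"
  shows "pairing f (\<lambda>x. \<Sum>i\<in>F. \<phi> i x) = (\<Sum>i\<in>F. pairing f (\<phi> i))"
  unfolding pairing_def using assms
  by (simp add: sum_distrib_left Bochner_Integration.integral_sum integrable_step)

section \<open>Which Haar coefficients of an adapted function can be nonzero\<close>

lemma pairing_psi_adapted_fine:
  assumes "adapted N n \<phi>" "n \<le> j"
  shows "pairing (psi j k) \<phi> = 0"
  by (rule pairing_psi_invariant) (rule adapted_const[OF assms(1)], rule idx_unit_add[OF assms(2)])

text \<open>A Haar function of scale \<open>j < N\<close> is constant on \<open>cell N 0\<close>, so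
  the pairing is a multiple of the mean. A test function with nonzero mean does have coefficients at
  arbitrarily coarse scales.\<close>

lemma pairing_psi_adapted_coarse:
  assumes "adapted N n \<phi>" "j < N" "(\<integral>x. \<phi> x \<partial>haar) = 0"
  shows "pairing (psi j k) \<phi> = 0"
proof -
  have eq: "psi j k x * \<phi> x = psi j k 0 * \<phi> x" for x
  proof (cases "idx N x = 0")
    case True
    then have "idx (j + 1) x = idx (j + 1) 0" using idx_mono[of "j + 1" N x 0] assms(2) by simp
    then show ?thesis by (simp add: psi_indicator indicator_def)
  qed (simp add: adapted_zero[OF assms(1)])
  show ?thesis using assms(3) by (simp only: pairing_def eq) simp
qed

lemma pairing_psi_adapted_far:
  assumes "adapted N n \<phi>" "N \<le> j" "2 ^ nat (j - N) \<le> k"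
  shows "pairing (psi j k) \<phi> = 0"
proof -
  have eq: "psi j k x * \<phi> x = 0" for x
  proof (cases "idx N x = 0")
    case True
    have "idx N x = idx j x div 2 ^ nat (j - N)"
      using idx_div[of N "nat (j - N)" x] assms(2) by simp
    then have "idx j x < 2 ^ nat (j - N)" using True by (simp add: div_eq_0_iff)
    then show ?thesis using assms(3) by (simp add: psi_eq)
  qed (simp add: adapted_zero[OF assms(1)])
  show ?thesis by (simp only: pairing_def eq) simp
qed

text \<open>The preceding results leave a finite index set depending on \<open>N\<close> and
  \<open>n\<close> alone. This uniformity later yields the continuity of every formal Haar
  series.\<close>

lemma pairing_psi_support:
  assumes "adapted N n \<phi>" "(\<integral>x. \<phi> x \<partial>haar) = 0" "pairing (psi j k) \<phi> \<noteq> 0"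
  shows "(j, k) \<in> (SIGMA j:{N..<n}. {..<2 ^ nat (j - N)})"
proof -
  have "j < n" using pairing_psi_adapted_fine[OF assms(1), of j k] assms(3) by (meson not_less)
  moreover have "N \<le> j" using pairing_psi_adapted_coarse[OF assms(1) _ assms(2), of j k] assms(3) by (meson not_less)
  moreover have "k < 2 ^ nat (j - N)"
    using pairing_psi_adapted_far[OF assms(1) \<open>N \<le> j\<close>, of k] assms(3) by (meson not_less)
  ultimately show ?thesis by simp
qed

text \<open>Each point has a cell on which the function is constant. Finitely many of these cover
  the compact support, so one resolution works everywhere.\<close>

lemma test_functions_step:
  assumes "\<phi> \<in> test_functions"
  shows "\<phi> \<in> step_functions"
proof -
  define K where "K = closure {x. \<phi> x \<noteq> 0}"
  have K: "compact K" and lc: "\<And>x. \<exists>U. open U \<and> x \<in> U \<and> \<phi> constant_on U"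
    using assms by (auto simp: test_functions_def K_def)
  have off: "\<phi> x = 0" if "x \<notin> K" for x
    using that closure_subset[of "{x. \<phi> x \<noteq> 0}"] unfolding K_def by auto
  have "\<exists>l::nat. \<forall>y. idx (int l) y = idx (int l) x \<longrightarrow> \<phi> y = \<phi> x" for x
  proof -
    obtain U where U: "open U" "x \<in> U" "\<phi> constant_on U" using lc by blast
    obtain l :: nat where "\<And>n. int l \<le> n \<Longrightarrow> cell n (idx n x) \<subseteq> U"
      using cell_nbhd[OF U(1,2)] by blast
    then have "cell (int l) (idx (int l) x) \<subseteq> U" by simp
    then show ?thesis using U(2,3) unfolding constant_on_def
      by (intro exI[of _ l]) (auto simp: subset_iff)
  qed
  then obtain l :: "cantor \<Rightarrow> nat" where l: "\<And>x y. idx (int (l x)) y = idx (int (l x)) x \<Longrightarrow> \<phi> y = \<phi> x"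
    by metis
  have "K \<subseteq> (\<Union>x\<in>UNIV. cell (int (l x)) (idx (int (l x)) x))" by auto
  then obtain D where D: "finite D" "K \<subseteq> (\<Union>x\<in>D. cell (int (l x)) (idx (int (l x)) x))"
    by (rule compactE_image[OF K open_cell])
  define n where "n = (\<Sum>x\<in>D. int (l x))"
  have n: "int (l x) \<le> n" if "x \<in> D" for x
    unfolding n_def using D(1) that by (intro member_le_sum) auto
  \<comment> \<open>Only \<open>x\<close> has to lie in \<open>K\<close>: the chosen cell around
    \<open>x\<close> contains \<open>y\<close>, whether or not \<open>y\<close> belongs to
    \<open>K\<close>.\<close>
  have onK: "\<phi> x = \<phi> y" if xK: "x \<in> K" and eq: "idx n x = idx n y" for x y
  proof -
    obtain z where z: "z \<in> D" "idx (int (l z)) x = idx (int (l z)) z" using subsetD[OF D(2) xK] unfolding UN_iff in_cell by blast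
    then have "idx (int (l z)) y = idx (int (l z)) z" using idx_mono[OF n[OF z(1)] eq] by simp
    then show ?thesis using l[of z x] l[of z y] z(2) by simp
  qed
  obtain L :: nat where "\<And>n. n \<le> - int L \<Longrightarrow> K \<subseteq> cell n 0"
    using compact_subset_cell[OF K] by blast
  then have L: "K \<subseteq> cell (- int L) 0" by simp
  have "adapted (- int L) n \<phi>"
  proof (rule adaptedI)
    fix x y assume eq: "idx n x = idx n y"
    show "\<phi> x = \<phi> y"
    proof (cases "x \<in> K \<or> y \<in> K")
      case True
      then show ?thesis using onK[OF _ eq] onK[OF _ eq[symmetric], symmetric] by blast
    qed (simp add: off)
  next
    fix x assume "idx (- int L) x \<noteq> 0"
    then have "x \<notin> K" using subsetD[OF L, of x] by auto
    then show "\<phi> x = 0" by (rule off)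
  qed
  then show ?thesis by (auto simp: step_functions_def)
qed

text \<open>The common compact set yields \<open>N\<close> and the common radius yields
  \<open>n\<close>, so the whole sequence stays in one finite-dimensional space.\<close>

lemma null_sequence_adapted:
  assumes "null_sequence \<phi>"
  obtains N n where "N \<le> n" "\<And>i. adapted N n (\<phi> i)"
proof -
  obtain K r where K: "compact K" "\<And>i. closure {x. \<phi> i x \<noteq> 0} \<subseteq> K"
    and r: "r > 0" "\<And>i x. \<phi> i constant_on ball x r"
    using assms unfolding null_sequence_def by blast
  obtain l :: nat where l: "\<And>n. int l \<le> n \<Longrightarrow> 2 powi (- n) < r" using ex_powi_less[OF r(1)] by blast
  obtain L :: nat where "\<And>n. n \<le> - int L \<Longrightarrow> K \<subseteq> cell n 0"
    using compact_subset_cell[OF K(1)] by blast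
  then have L: "K \<subseteq> cell (- int L) 0" by simp
  show ?thesis
  proof
    show "- int L \<le> int l" by simp
    fix i
    have "\<phi> i x = \<phi> i y" if "idx (int l) x = idx (int l) y" for x y
    proof -
      have "dist x y < 2 powi (- int l)" using that unfolding dist_lt_iff_idx .
      then have "y \<in> ball x r" unfolding mem_ball using l[OF order_refl] by (rule less_trans)
      moreover have "x \<in> ball x r" using r by simp
      ultimately show ?thesis using r(2)[of i x] unfolding constant_on_def by fastforce
    qed
    moreover have "\<phi> i x = 0" if "idx (- int L) x \<noteq> 0" for x
    proof (rule ccontr)
      assume "\<phi> i x \<noteq> 0"
      then have "x \<in> closure {x. \<phi> i x \<noteq> 0}" by (intro subsetD[OF closure_subset]) simp
      then have "x \<in> cell (- int L) 0" using K(2)[of i] L by blast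
      then show False using that by simp
    qed
    ultimately show "adapted (- int L) (int l) (\<phi> i)" by (rule adaptedI)
  qed
qed

text \<open>All members are combinations of the same finitely many indicators, with coefficients
  that are point values and hence tend to 0.\<close>

lemma pairing_null_sequence:
  assumes "locally_integrable f" "null_sequence \<phi>"
  shows "(\<lambda>i. pairing f (\<phi> i)) \<longlonglongrightarrow> 0"
proof -
  obtain N n where A: "N \<le> n" "\<And>i. adapted N n (\<phi> i)" using null_sequence_adapted[OF assms(2)] by blast
  have "(\<lambda>i. \<phi> i x) \<longlonglongrightarrow> 0" for x
    using assms(2) unfolding null_sequence_def
    by (elim conjE) (rule tendsto_uniform_limitI, assumption, rule UNIV_I)
  then have "(\<lambda>i. \<Sum>m<2 ^ nat (n - N). \<phi> i (pt n m) * pairing f (indicator (cell n m)))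
      \<longlonglongrightarrow> (\<Sum>m<2 ^ nat (n - N). 0 * pairing f (indicator (cell n m)))"
    by (intro tendsto_sum tendsto_mult tendsto_const)
  then show ?thesis by (simp add: pairing_adapted[OF assms(1) A(2) A(1)])
qed

subsection \<open>The Gibbs derivative of a Haar polynomial\<close>

text \<open>\<open>t\<close> bounds the indices from below and \<open>x\<close> from above.
  Finiteness matters because \<open>card\<close> of an infinite set is 0, which would falsify the
  sign rule.\<close>

lemma finite_walsh: "finite {k. coord t k * coord x (- k - 1) = 1}"
proof -
  obtain m n where "\<forall>k<m. coord t k = 0" "\<forall>k<n. coord x k = 0"
    using coord_bounded_below by metis
  then have "{k. coord t k * coord x (- k - 1) = 1} \<subseteq> {m..- n - 1}"
    by (force simp flip: not_less)
  then show ?thesis by (rule finite_subset) simp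
qed

lemma walsh_commute: "walsh t x = walsh x t"
proof -
  have "{k. coord x k * coord t (- k - 1) = 1} = (\<lambda>k. - k - 1) ` {k. coord t k * coord x (- k - 1) = 1}"
  proof (intro equalityI subsetI)
    fix k assume "k \<in> {k. coord x k * coord t (- k - 1) = 1}"
    then show "k \<in> (\<lambda>k. - k - 1) ` {k. coord t k * coord x (- k - 1) = 1}"
      by (intro image_eqI[of _ _ "- k - 1"]) (simp_all add: conj_commute)
  next
    fix k assume "k \<in> (\<lambda>k. - k - 1) ` {k. coord t k * coord x (- k - 1) = 1}"
    then show "k \<in> {k. coord x k * coord t (- k - 1) = 1}" by auto
  qed
  moreover have "inj_on (\<lambda>k::int. - k - 1) A" for A
    by (rule inj_onI) simp
  ultimately show ?thesis unfolding walsh_def by (simp only: card_image)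
qed

text \<open>Coordinate \<open>j\<close> of \<open>x\<close> is multiplied with coordinate
  \<open>- j - 1\<close> of \<open>t\<close>, so the flip can toggle only this one element of the
  counted set, and does so exactly if \<open>t\<close> has a 1 there.\<close>

lemma walsh_unit_add: "walsh t (unit_pt j + x) = (if coord t (- j - 1) = 0 then walsh t x else - walsh t x)"
proof -
  define A where "A y = {k. coord t k * coord y (- k - 1) = 1}" for y
  have other: "k \<in> A (unit_pt j + x) \<longleftrightarrow> k \<in> A x" if "k \<noteq> - j - 1" for k
    using that unfolding A_def mem_Collect_eq coord_plus coord_unit_pt by auto
  have self: "- j - 1 \<in> A (unit_pt j + x) \<longleftrightarrow> coord t (- j - 1) \<noteq> 0 \<and> - j - 1 \<notin> A x"
    unfolding A_def mem_Collect_eq coord_plus coord_unit_pt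
    by (cases "coord t (- j - 1)"; cases "coord x j") auto
  have self': "- j - 1 \<in> A x \<Longrightarrow> coord t (- j - 1) \<noteq> 0"
    by (auto simp: A_def)
  have W: "walsh t y = (- 1) ^ card (A y)" for y unfolding A_def walsh_def ..
  have fin: "finite (A y)" for y unfolding A_def by (rule finite_walsh)
  show ?thesis
  proof (cases "coord t (- j - 1) = 0")
    case True
    then have "A (unit_pt j + x) = A x" using other self self' by (metis set_eqI)
    then show ?thesis using True by (simp add: W)
  next
    case False
    show ?thesis
    proof (cases "- j - 1 \<in> A x")
      case True
      have nin: "- j - 1 \<notin> A (unit_pt j + x)" using self True by simp
      have "k \<in> A x \<longleftrightarrow> k \<in> insert (- j - 1) (A (unit_pt j + x))" for k
        using other[of k] True by (cases "k = - j - 1") auto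
      then have "A x = insert (- j - 1) (A (unit_pt j + x))" by blast
      with nin have "card (A x) = Suc (card (A (unit_pt j + x)))" using fin by simp
      then show ?thesis using False by (simp add: W)
    next
      case nin: False
      have "k \<in> A (unit_pt j + x) \<longleftrightarrow> k \<in> insert (- j - 1) (A x)" for k
        using other[of k] self False nin by (cases "k = - j - 1") auto
      then have "A (unit_pt j + x) = insert (- j - 1) (A x)" by blast
      then have "card (A (unit_pt j + x)) = Suc (card (A x))" using fin nin by simp
      then show ?thesis using False by (simp add: W)
    qed
  qed
qed

lemma walsh_idx_invariant: "\<exists>i. \<forall>x y. idx i x = idx i y \<longrightarrow> walsh t x = walsh t y"
proof -
  obtain m where m: "\<forall>k<m. coord t k = 0" using coord_bounded_below by metis
  have "walsh t x = walsh t y" if "idx (- m) x = idx (- m) y" for x y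
  proof -
    have "coord t k * coord x (- k - 1) = coord t k * coord y (- k - 1)" for k
      using m that by (cases "k < m") (auto simp: idx_eq_iff)
    then show ?thesis by (simp add: walsh_def)
  qed
  then show ?thesis by blast
qed

text \<open>If \<xi> has a 1 at some \<open>i < - j - 1\<close>, flipping coordinate
  \<open>- i - 1 > j\<close> fixes \<open>psi j k\<close> and negates the Walsh function. If it has
  none there and a 0 at \<open>- j - 1\<close>, flipping \<open>j\<close> negates
  \<open>psi j k\<close> only. Otherwise \<xi> has norm 2^j. Phrasing the hypothesis through the
  symbol covers \<xi> = 0 as well.\<close>

lemma fourier_psi_eq_0:
  assumes "gibbs_symbol \<alpha> \<xi> \<noteq> 2 powr (real_of_int j * \<alpha>)"
  shows "fourier_walsh (psi j k) \<xi> = 0"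
proof (cases "\<exists>i < - j - 1. coord \<xi> i = 1")
  case True
  then obtain i where i: "i < - j - 1" "coord \<xi> i = 1" by blast
  show ?thesis unfolding fourier_walsh_def
    by (rule integral_haar_antisym[of _ "unit_pt (- i - 1)"])
      (use i in \<open>simp add: psi_unit_add_above walsh_unit_add\<close>)
next
  case False
  have "coord \<xi> (- j - 1) = 0"
  proof (rule ccontr)
    assume "coord \<xi> (- j - 1) \<noteq> 0"
    then have 1: "coord \<xi> (- j - 1) = 1" by simp
    then have nz: "\<xi> \<noteq> 0" by auto
    have "first_index \<xi> = - j - 1"
      using first_index[OF nz] False 1 by (metis linorder_neqE zero_neq_one)
    then have "gnorm \<xi> = 2 powi j" using nz by (simp add: gnorm_def)
    then have "gibbs_symbol \<alpha> \<xi> = 2 powr (real_of_int j * \<alpha>)"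
      using nz by (simp add: gibbs_symbol_def powr_powr flip: powr_real_of_int')
    then show False using assms by simp
  qed
  then show ?thesis unfolding fourier_walsh_def
    by (intro integral_haar_antisym[of _ "unit_pt j"]) (simp add: psi_unit_add walsh_unit_add)
qed

lemma fourier_step_integrable: "\<phi> \<in> step_functions \<Longrightarrow> integrable haar (\<lambda>x. \<phi> x * walsh \<xi> x)"
proof -
  assume \<phi>: "\<phi> \<in> step_functions"
  obtain i where "\<forall>x y. idx i x = idx i y \<longrightarrow> walsh \<xi> x = walsh \<xi> y"
    using walsh_idx_invariant by blast
  then have "locally_integrable (walsh \<xi>)"
    by (intro locally_integrable_idx_invariant[of i]) blast
  from integrable_step[OF this \<phi>] show ?thesis by (simp add: mult.commute)
qed

text \<open>The factor (1 + \<open>rho\<close>)/2 or (1 - \<open>rho\<close>)/2 selects one half of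
  the parent cell. The inductions over levels for the transform and for quasi-Haar expansions both
  rest on this identity.\<close>

lemma indicator_cell_child:
  "indicator (cell (n + 1) m) x =
    (indicator (cell n (m div 2)) x * ((1 + (if even m then 1 else - 1) * rho n x) / 2) :: complex)"
proof -
  have "coord x n = 0 \<longleftrightarrow> even (idx (n + 1) x)"
    by (rule coord_eq_0_iff_even)
  moreover have "idx n x = idx (n + 1) x div 2" by (simp add: idx_div2)
  moreover have "idx (n + 1) x = m \<longleftrightarrow> idx (n + 1) x div 2 = m div 2 \<and> (even (idx (n + 1) x) \<longleftrightarrow> even m)"
    by presburger
  ultimately show ?thesis by (auto simp: rho_def indicator_def)
qed

text \<open>The indicator of a cell inside the support is a product of factors \<open>(1 \<plusminus> w)/2\<close> with Walsh
  functions \<open>w\<close>, so the Fourier--Walsh transform determines the mean over every cell.\<close>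

lemma fourier_walsh_injective:
  assumes \<phi>: "\<phi> \<in> step_functions" and zero: "\<And>\<xi>. fourier_walsh \<phi> \<xi> = 0"
  shows "\<phi> x = 0"
proof -
  obtain N n where Nn: "N \<le> n" "adapted N n \<phi>" using step_functionsE[OF \<phi>] .
  have int: "integrable haar (\<lambda>x. \<phi> x * walsh \<xi> x * indicator (cell i m) x)" for \<xi> i m
  proof (rule Bochner_Integration.integrable_bound)
    show "integrable haar (\<lambda>x. \<phi> x * walsh \<xi> x)" by (rule fourier_step_integrable[OF \<phi>])
    then show "(\<lambda>x. \<phi> x * walsh \<xi> x * indicator (cell i m) x) \<in> borel_measurable haar"
      by (intro borel_measurable_times borel_measurable_integrable integrable_cell)
  qed (auto simp: indicator_def)
  have "(\<integral>x. \<phi> x * walsh \<xi> x * indicator (cell (N + int i) m) x \<partial>haar) = 0" for \<xi> i m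
  proof (induction i arbitrary: \<xi> m)
    case 0
    have "\<phi> x * walsh \<xi> x * indicator (cell N m) x = of_bool (m = 0) * (\<phi> x * walsh \<xi> x)" for x
      using adapted_zero[OF Nn(2), of x] by (cases "idx N x = 0") (auto simp: indicator_def)
    then have "(\<integral>x. \<phi> x * walsh \<xi> x * indicator (cell N m) x \<partial>haar) = of_bool (m = 0) * fourier_walsh \<phi> \<xi>"
      unfolding fourier_walsh_def by (simp only: integral_mult_right_zero)
    then show ?case by (simp add: zero)
  next
    case (Suc i)
    define n where "n = N + int i"
    \<comment> \<open>Flipping coordinate \<open>- n - 1\<close> of the frequency multiplies its
      Walsh function by \<open>rho n\<close>; hence the induction hypothesis must range over all
      frequencies.\<close>
    define \<xi>' where "\<xi>' = unit_pt (- n - 1) + \<xi>"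
    define s :: complex where "s = (if even m then 1 else - 1)"
    have w: "walsh \<xi>' x = rho n x * walsh \<xi> x" for x
      unfolding \<xi>'_def walsh_commute[of _ x] walsh_unit_add by (simp add: rho_def)
    have "\<phi> x * walsh \<xi> x * indicator (cell (n + 1) m) x =
        \<phi> x * walsh \<xi> x * indicator (cell n (m div 2)) x / 2 +
        s * (\<phi> x * walsh \<xi>' x * indicator (cell n (m div 2)) x) / 2" for x
      unfolding indicator_cell_child s_def[symmetric] w by (simp add: field_simps)
    then have "(\<integral>x. \<phi> x * walsh \<xi> x * indicator (cell (n + 1) m) x \<partial>haar) = 0"
      using int Suc.IH[of \<xi> "m div 2"] Suc.IH[of \<xi>' "m div 2"]
      by (simp add: n_def)
    then show ?case by (simp add: n_def add.commute add.left_commute)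
  qed
  from this[of 0 "nat (n - N)" "idx n x"]
  have "(\<integral>y. \<phi> y * walsh 0 y * indicator (cell n (idx n x)) y \<partial>haar) = 0" using Nn(1) by simp
  also have "(\<lambda>y. \<phi> y * walsh 0 y * indicator (cell n (idx n x)) y) = (\<lambda>y. \<phi> x * indicator (cell n (idx n x)) y)"
  proof
    fix y
    show "\<phi> y * walsh 0 y * indicator (cell n (idx n x)) y = \<phi> x * indicator (cell n (idx n x)) y"
      using adapted_const[OF Nn(2), of y x] by (cases "idx n y = idx n x") (simp_all add: walsh_def)
  qed
  finally show ?thesis by (simp add: integral_cell)
qed

section \<open>Haar polynomials and the multiplier acting on them\<close>

lemma haar_polynomialsI: "finite F \<Longrightarrow> (\<lambda>x. \<Sum>(j, k)\<in>F. c j k * psi j k x) \<in> haar_polynomials"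
  unfolding haar_polynomials_def by blast

lemma haar_polynomials_add:
  assumes "\<phi> \<in> haar_polynomials" "\<eta> \<in> haar_polynomials"
  shows "(\<lambda>x. \<phi> x + \<eta> x) \<in> haar_polynomials"
proof -
  obtain F c F' c' where F: "finite F" "\<phi> = (\<lambda>x. \<Sum>(j, k)\<in>F. c j k * psi j k x)"
    and F': "finite F'" "\<eta> = (\<lambda>x. \<Sum>(j, k)\<in>F'. c' j k * psi j k x)"
    using assms unfolding haar_polynomials_def by blast
  have ext: "(\<Sum>(j, k)\<in>A. d j k * psi j k x) = (\<Sum>(j, k)\<in>F \<union> F'. (if (j, k) \<in> A then d j k else 0) * psi j k x)"
    if "A \<subseteq> F \<union> F'" for A d x
    using that F F' by (intro sum.mono_neutral_cong_left) auto
  have "(\<lambda>x. \<phi> x + \<eta> x) = (\<lambda>x. \<Sum>(j, k)\<in>F \<union> F'.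
      ((if (j, k) \<in> F then c j k else 0) + (if (j, k) \<in> F' then c' j k else 0)) * psi j k x)"
    unfolding F(2) F'(2) ext[OF Un_upper1] ext[OF Un_upper2]
    by (simp only: split_def distrib_right sum.distrib)
  also have "\<dots> \<in> haar_polynomials" using F F' by (intro haar_polynomialsI) simp
  finally show ?thesis .
qed

lemma haar_polynomials_scale:
  assumes "\<phi> \<in> haar_polynomials"
  shows "(\<lambda>x. a * \<phi> x) \<in> haar_polynomials"
proof -
  obtain F c where F: "finite F" "\<phi> = (\<lambda>x. \<Sum>(j, k)\<in>F. c j k * psi j k x)"
    using assms unfolding haar_polynomials_def by blast
  have "(\<lambda>x. a * \<phi> x) = (\<lambda>x. \<Sum>(j, k)\<in>F. (a * c j k) * psi j k x)"
    unfolding F(2) by (simp only: sum_distrib_left split_def mult.assoc)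
  also have "\<dots> \<in> haar_polynomials" using F(1) by (rule haar_polynomialsI)
  finally show ?thesis .
qed

lemma haar_polynomials_psi: "psi j k \<in> haar_polynomials"
  using haar_polynomialsI[of "{(j, k)}" "\<lambda>_ _. 1"] by simp

lemma haar_polynomials_step:
  assumes "\<phi> \<in> haar_polynomials"
  shows "\<phi> \<in> step_functions"
proof -
  obtain F c where F: "finite F" "\<phi> = (\<lambda>x. \<Sum>(j, k)\<in>F. c j k * psi j k x)"
    using assms unfolding haar_polynomials_def by blast
  show ?thesis unfolding F(2) by (rule step_sum) (auto intro: step_scale step_psi)
qed

lemma haar_polynomials_induct [consumes 1, case_names zero add]:
  assumes "\<phi> \<in> haar_polynomials"
    and "P (\<lambda>_. 0)"
    and "\<And>a j k \<eta>. \<eta> \<in> haar_polynomials \<Longrightarrow> P \<eta> \<Longrightarrow> P (\<lambda>x. a * psi j k x + \<eta> x)"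
  shows "P \<phi>"
proof -
  obtain F c where F: "finite F" "\<phi> = (\<lambda>x. \<Sum>(j, k)\<in>F. c j k * psi j k x)"
    using assms(1) unfolding haar_polynomials_def by blast
  from F(1) have "P (\<lambda>x. \<Sum>(j, k)\<in>F. c j k * psi j k x)"
  proof (induction F rule: finite_induct)
    case (insert p F)
    obtain j k where p: "p = (j, k)" by fastforce
    show ?case using insert assms(3)[OF haar_polynomialsI[OF insert.hyps(1)] insert.IH, of "c j k" j k]
      by (simp add: p)
  qed (simp add: assms(2))
  then show ?thesis by (simp add: F(2))
qed

lemma integrable_step_functions: "\<phi> \<in> step_functions \<Longrightarrow> integrable haar \<phi>"
  unfolding step_functions_def using adapted_integrable by blast

lemma integral_haar_polynomial: "\<phi> \<in> haar_polynomials \<Longrightarrow> (\<integral>x. \<phi> x \<partial>haar) = 0"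
proof (induction rule: haar_polynomials_induct)
  case (add a j k \<eta>)
  then show ?case
    by (simp add: integral_psi integrable_step_functions step_psi haar_polynomials_step)
qed simp

lemma fourier_add:
  "\<phi> \<in> step_functions \<Longrightarrow> \<eta> \<in> step_functions \<Longrightarrow>
    fourier_walsh (\<lambda>x. \<phi> x + \<eta> x) \<xi> = fourier_walsh \<phi> \<xi> + fourier_walsh \<eta> \<xi>"
  unfolding fourier_walsh_def by (simp add: distrib_right fourier_step_integrable)

lemma fourier_scale: "fourier_walsh (\<lambda>x. a * \<phi> x) \<xi> = a * fourier_walsh \<phi> \<xi>"
  unfolding fourier_walsh_def by (simp add: mult.assoc)

definition eigval :: "real \<Rightarrow> int \<Rightarrow> complex" where
  "eigval \<alpha> j = complex_of_real (2 powr (real_of_int j * \<alpha>))"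

lemma gibbs_symbol_fourier_psi:
  "complex_of_real (gibbs_symbol \<alpha> \<xi>) * fourier_walsh (psi j k) \<xi> = eigval \<alpha> j * fourier_walsh (psi j k) \<xi>"
  using fourier_psi_eq_0[of \<alpha> \<xi> j k] by (auto simp: eigval_def)

text \<open>Two Haar polynomials with the prescribed transform differ by a step function with zero
  transform, so the description in \<open>gibbs\<close> is unique.\<close>

lemma gibbs_eqI:
  assumes "\<phi> \<in> haar_polynomials" "\<eta> \<in> haar_polynomials"
    and "\<And>\<xi>. fourier_walsh \<eta> \<xi> = complex_of_real (gibbs_symbol \<alpha> \<xi>) * fourier_walsh \<phi> \<xi>"
  shows "gibbs \<alpha> \<phi> = \<eta>"
  unfolding gibbs_def
proof (rule the_equality)
  fix \<eta>' assume \<eta>': "\<eta>' \<in> haar_polynomials \<and>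
     (\<forall>\<xi>. fourier_walsh \<eta>' \<xi> = complex_of_real (gibbs_symbol \<alpha> \<xi>) * fourier_walsh \<phi> \<xi>)"
  have s: "\<eta> \<in> step_functions" "\<eta>' \<in> step_functions" "(\<lambda>x. - 1 * \<eta> x) \<in> step_functions"
    using \<eta>' assms haar_polynomials_step step_scale by blast+
  have "\<eta>' x + - 1 * \<eta> x = 0" for x
  proof (rule fourier_walsh_injective)
    show "(\<lambda>x. \<eta>' x + - 1 * \<eta> x) \<in> step_functions" using s by (intro step_add)
    show "fourier_walsh (\<lambda>x. \<eta>' x + - 1 * \<eta> x) \<xi> = 0" for \<xi>
      unfolding fourier_add[OF s(2,3)] fourier_scale using \<eta>' assms(3) by simp
  qed
  then show "\<eta>' = \<eta>" by auto
qed (use assms in blast)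

text \<open>Existence: multiplying each Haar coefficient by its eigenvalue gives the required
  polynomial.\<close>

lemma gibbs_haar_polynomial:
  assumes "\<phi> \<in> haar_polynomials"
  shows "gibbs \<alpha> \<phi> \<in> haar_polynomials \<and>
    (\<forall>\<xi>. fourier_walsh (gibbs \<alpha> \<phi>) \<xi> = complex_of_real (gibbs_symbol \<alpha> \<xi>) * fourier_walsh \<phi> \<xi>)"
proof -
  have "\<exists>\<eta>\<in>haar_polynomials. \<forall>\<xi>. fourier_walsh \<eta> \<xi> = complex_of_real (gibbs_symbol \<alpha> \<xi>) * fourier_walsh \<phi> \<xi>"
    using assms
  proof (induction rule: haar_polynomials_induct)
    case zero
    then show ?case
      by (intro bexI[of _ "\<lambda>_. 0"]) (use haar_polynomialsI[of "{}"] in \<open>auto simp: fourier_walsh_def\<close>)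
  next
    case (add a j k \<eta>)
    then obtain \<eta>' where \<eta>': "\<eta>' \<in> haar_polynomials"
      "\<And>\<xi>. fourier_walsh \<eta>' \<xi> = complex_of_real (gibbs_symbol \<alpha> \<xi>) * fourier_walsh \<eta> \<xi>" by blast
    have s: "\<eta> \<in> step_functions" "\<eta>' \<in> step_functions" "(\<lambda>x. b * psi j k x) \<in> step_functions" for b
      using \<eta>' add haar_polynomials_step step_scale[OF step_psi] by blast+
    show ?case
    proof (intro bexI allI)
      show "(\<lambda>x. (a * eigval \<alpha> j) * psi j k x + \<eta>' x) \<in> haar_polynomials"
        using \<eta>' by (intro haar_polynomials_add haar_polynomials_scale haar_polynomials_psi)
      fix \<xi>
      show "fourier_walsh (\<lambda>x. (a * eigval \<alpha> j) * psi j k x + \<eta>' x) \<xi> =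
         complex_of_real (gibbs_symbol \<alpha> \<xi>) * fourier_walsh (\<lambda>x. a * psi j k x + \<eta> x) \<xi>"
        unfolding fourier_add[OF s(3) s(1)] fourier_add[OF s(3) s(2)] fourier_scale \<eta>'(2)
        using gibbs_symbol_fourier_psi[of \<alpha> \<xi> j k]
        by (auto simp: algebra_simps)
    qed
  qed
  then show ?thesis using gibbs_eqI[OF assms, of _ \<alpha>] by metis
qed

lemma gibbs_psi: "gibbs \<alpha> (psi j k) = (\<lambda>x. eigval \<alpha> j * psi j k x)"
  by (intro gibbs_eqI haar_polynomials_scale haar_polynomials_psi)
    (simp add: fourier_scale gibbs_symbol_fourier_psi)

lemma gibbs_add:
  assumes "\<phi> \<in> haar_polynomials" "\<eta> \<in> haar_polynomials"
  shows "gibbs \<alpha> (\<lambda>x. \<phi> x + \<eta> x) = (\<lambda>x. gibbs \<alpha> \<phi> x + gibbs \<alpha> \<eta> x)"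
  using gibbs_haar_polynomial[OF assms(1), of \<alpha>] gibbs_haar_polynomial[OF assms(2), of \<alpha>] assms
  by (intro gibbs_eqI haar_polynomials_add)
    (auto simp: fourier_add haar_polynomials_step distrib_left)

lemma gibbs_scale:
  assumes "\<phi> \<in> haar_polynomials"
  shows "gibbs \<alpha> (\<lambda>x. a * \<phi> x) = (\<lambda>x. a * gibbs \<alpha> \<phi> x)"
  using gibbs_haar_polynomial[OF assms, of \<alpha>] assms
  by (intro gibbs_eqI haar_polynomials_scale) (auto simp: fourier_scale)

subsection \<open>Haar representation of distributions\<close>

lemma dual_add: "f \<in> dual E \<Longrightarrow> \<phi> \<in> E \<Longrightarrow> \<eta> \<in> E \<Longrightarrow> f (\<lambda>x. \<phi> x + \<eta> x) = f \<phi> + f \<eta>"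
  by (simp add: dual_def)

lemma dual_scale: "f \<in> dual E \<Longrightarrow> \<phi> \<in> E \<Longrightarrow> f (\<lambda>x. a * \<phi> x) = a * f \<phi>"
  by (simp add: dual_def)

lemma linear_haar_polynomial_eqI:
  fixes f h :: "(cantor \<Rightarrow> complex) \<Rightarrow> complex"
  assumes "\<phi> \<in> haar_polynomials"
    and f: "\<And>\<phi> \<eta>. \<phi> \<in> haar_polynomials \<Longrightarrow> \<eta> \<in> haar_polynomials \<Longrightarrow> f (\<lambda>x. \<phi> x + \<eta> x) = f \<phi> + f \<eta>"
      "\<And>a \<phi>. \<phi> \<in> haar_polynomials \<Longrightarrow> f (\<lambda>x. a * \<phi> x) = a * f \<phi>"
    and h: "\<And>\<phi> \<eta>. \<phi> \<in> haar_polynomials \<Longrightarrow> \<eta> \<in> haar_polynomials \<Longrightarrow> h (\<lambda>x. \<phi> x + \<eta> x) = h \<phi> + h \<eta>"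
      "\<And>a \<phi>. \<phi> \<in> haar_polynomials \<Longrightarrow> h (\<lambda>x. a * \<phi> x) = a * h \<phi>"
    and eq: "\<And>j k. f (psi j k) = h (psi j k)"
  shows "f \<phi> = h \<phi>"
  using assms(1)
proof (induction rule: haar_polynomials_induct)
  case zero
  show ?case
    using f(2)[OF haar_polynomials_psi, of 0 0 0] h(2)[OF haar_polynomials_psi, of 0 0 0] by simp
next
  case (add a j k \<eta>)
  then show ?case
    by (simp add: f h eq haar_polynomials_psi haar_polynomials_scale)
qed

lemma dual_eqI:
  assumes "f \<in> dual haar_polynomials" "h \<in> dual haar_polynomials" "\<And>j k. f (psi j k) = h (psi j k)"
  shows "f = h"
proof (rule extensionalityI)
  show "f \<in> extensional haar_polynomials" "h \<in> extensional haar_polynomials" using assms by (auto simp: dual_def)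
  fix \<phi> assume \<phi>: "\<phi> \<in> haar_polynomials"
  show "f \<phi> = h \<phi>"
    by (rule linear_haar_polynomial_eqI[OF \<phi>])
      (use assms in \<open>simp_all add: dual_add dual_scale\<close>)
qed

text \<open>The condition under which \<open>haar_series\<close> is a finite sum. A non-summable
  \<open>infsum\<close> is 0 by convention, so additivity could not be expected without such
  control.\<close>

definition finite_spectrum :: "int set \<Rightarrow> (cantor \<Rightarrow> complex) \<Rightarrow> bool" where
  "finite_spectrum J \<phi> \<longleftrightarrow> finite {(j, k). j \<in> J \<and> pairing (psi j k) \<phi> \<noteq> 0}"

lemma finite_spectrum_mono: "finite_spectrum J \<phi> \<Longrightarrow> J' \<subseteq> J \<Longrightarrow> finite_spectrum J' \<phi>"
  unfolding finite_spectrum_def by (erule rev_finite_subset) auto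

lemma haar_series_finite:
  assumes "finite F" "{(j, k). j \<in> J \<and> pairing (psi j k) \<phi> \<noteq> 0} \<subseteq> F" "F \<subseteq> J \<times> UNIV"
  shows "haar_series J c \<phi> = (\<Sum>(j, k)\<in>F. c j k * pairing (psi j k) \<phi>)"
proof -
  have "haar_series J c \<phi> = (\<Sum>\<^sub>\<infinity>(j, k)\<in>F. c j k * pairing (psi j k) \<phi>)"
    unfolding haar_series_def using assms(2,3) by (intro infsum_cong_neutral) auto
  then show ?thesis using assms(1) by simp
qed

lemma haar_series_add:
  assumes "finite_spectrum J \<phi>" "finite_spectrum J \<eta>" "\<phi> \<in> step_functions" "\<eta> \<in> step_functions"
  shows "haar_series J c (\<lambda>x. \<phi> x + \<eta> x) = haar_series J c \<phi> + haar_series J c \<eta>"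
    and "finite_spectrum J (\<lambda>x. \<phi> x + \<eta> x)"
proof -
  define F where "F = {(j, k). j \<in> J \<and> pairing (psi j k) \<phi> \<noteq> 0} \<union> {(j, k). j \<in> J \<and> pairing (psi j k) \<eta> \<noteq> 0}"
  have F: "finite F" "F \<subseteq> J \<times> UNIV" using assms by (auto simp: F_def finite_spectrum_def)
  have p: "pairing (psi j k) (\<lambda>x. \<phi> x + \<eta> x) = pairing (psi j k) \<phi> + pairing (psi j k) \<eta>" for j k
    using assms by (intro pairing_add step_locally_integrable step_psi)
  have sub: "{(j, k). j \<in> J \<and> pairing (psi j k) (\<lambda>x. \<phi> x + \<eta> x) \<noteq> 0} \<subseteq> F"
    unfolding p by (auto simp: F_def)
  then show "finite_spectrum J (\<lambda>x. \<phi> x + \<eta> x)"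
    unfolding finite_spectrum_def using F(1) by (rule finite_subset)
  have "haar_series J c (\<lambda>x. \<phi> x + \<eta> x) = (\<Sum>(j, k)\<in>F. c j k * pairing (psi j k) (\<lambda>x. \<phi> x + \<eta> x))"
    by (rule haar_series_finite[OF F(1) sub F(2)])
  also have "\<dots> = (\<Sum>(j, k)\<in>F. c j k * pairing (psi j k) \<phi>) + (\<Sum>(j, k)\<in>F. c j k * pairing (psi j k) \<eta>)"
    unfolding p by (simp only: split_def distrib_left sum.distrib)
  also have "\<dots> = haar_series J c \<phi> + haar_series J c \<eta>"
    using haar_series_finite[OF F(1) _ F(2), of \<phi> c] haar_series_finite[OF F(1) _ F(2), of \<eta> c]
    by (auto simp: F_def)
  finally show "haar_series J c (\<lambda>x. \<phi> x + \<eta> x) = haar_series J c \<phi> + haar_series J c \<eta>" .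
qed

lemma haar_series_scale:
  shows "haar_series J c (\<lambda>x. a * \<phi> x) = a * haar_series J c \<phi>"
    and "finite_spectrum J \<phi> \<Longrightarrow> finite_spectrum J (\<lambda>x. a * \<phi> x)"
proof -
  have "haar_series J c (\<lambda>x. a * \<phi> x) = (\<Sum>\<^sub>\<infinity>p\<in>J \<times> UNIV. a * (case p of (j, k) \<Rightarrow> c j k * pairing (psi j k) \<phi>))"
    unfolding haar_series_def by (rule infsum_cong) (auto simp: pairing_scale)
  also have "\<dots> = a * haar_series J c \<phi>"
    unfolding haar_series_def by (rule infsum_cmult_right')
  finally show "haar_series J c (\<lambda>x. a * \<phi> x) = a * haar_series J c \<phi>" .
  assume "finite_spectrum J \<phi>"
  then show "finite_spectrum J (\<lambda>x. a * \<phi> x)"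
    unfolding finite_spectrum_def by (rule rev_finite_subset) (auto simp: pairing_scale)
qed

lemma haar_series_psi:
  shows "haar_series J c (psi j k) = (if j \<in> J then c j k else 0)"
    and "finite_spectrum J (psi j k)"
proof -
  have sub: "{(j', k'). j' \<in> J \<and> pairing (psi j' k') (psi j k) \<noteq> 0} \<subseteq> {(j, k)} \<inter> J \<times> UNIV"
    by (auto simp: pairing_psi_psi)
  then show "finite_spectrum J (psi j k)"
    unfolding finite_spectrum_def by (rule finite_subset) simp
  have "haar_series J c (psi j k) = (\<Sum>(j', k')\<in>{(j, k)} \<inter> J \<times> UNIV. c j' k' * pairing (psi j' k') (psi j k))"
    by (rule haar_series_finite[OF _ sub]) auto
  also have "\<dots> = (if j \<in> J then c j k else 0)"
    by (auto simp: pairing_psi_psi)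
  finally show "haar_series J c (psi j k) = (if j \<in> J then c j k else 0)" .
qed

lemma haar_series_split:
  assumes "finite_spectrum (J \<union> J') \<phi>" "J \<inter> J' = {}"
  shows "haar_series (J \<union> J') c \<phi> = haar_series J c \<phi> + haar_series J' c \<phi>"
proof -
  define F where "F I = {(j, k). j \<in> I \<and> pairing (psi j k) \<phi> \<noteq> 0}" for I :: "int set"
  have fin: "finite (F I)" if "I \<subseteq> J \<union> J'" for I
    using finite_spectrum_mono[OF assms(1) that] unfolding finite_spectrum_def F_def .
  have s: "haar_series I c \<phi> = (\<Sum>(j, k)\<in>F I. c j k * pairing (psi j k) \<phi>)" if "I \<subseteq> J \<union> J'" for I
    by (rule haar_series_finite[OF fin[OF that]]) (auto simp: F_def)
  have "F (J \<union> J') = F J \<union> F J'" "F J \<inter> F J' = {}" using assms(2) by (auto simp: F_def)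
  then show ?thesis using fin by (simp add: s sum.union_disjoint)
qed

lemma haar_series_cong: "(\<And>j k. j \<in> J \<Longrightarrow> c j k = c' j k) \<Longrightarrow> haar_series J c \<phi> = haar_series J c' \<phi>"
  unfolding haar_series_def by (rule infsum_cong) auto

lemma haar_polynomials_support:
  assumes "\<phi> \<in> haar_polynomials" "adapted N n \<phi>"
  shows "{(j, k). j \<in> J \<and> pairing (psi j k) \<phi> \<noteq> 0} \<subseteq> (SIGMA j:{N..<n}. {..<2 ^ nat (j - N)}) \<inter> J \<times> UNIV"
  using pairing_psi_support[OF assms(2) integral_haar_polynomial[OF assms(1)]] by auto

lemma finite_spectrum_haar_polynomial:
  assumes "\<phi> \<in> haar_polynomials"
  shows "finite_spectrum J \<phi>"
proof -
  obtain N n where "adapted N n \<phi>" using step_functionsE[OF haar_polynomials_step[OF assms]] by blast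
  then show ?thesis
    unfolding finite_spectrum_def
    by (rule finite_subset[OF haar_polynomials_support[OF assms]]) auto
qed

text \<open>No growth of \<open>c\<close> can do harm: along a null sequence only the terms of one
  fixed finite index set survive, and each of them tends to 0.\<close>

lemma haar_series_dual: "(\<lambda>\<phi>\<in>haar_polynomials. haar_series J c \<phi>) \<in> dual haar_polynomials"
  unfolding dual_def
proof (intro CollectI conjI ballI allI impI)
  fix \<phi> \<eta> assume "\<phi> \<in> haar_polynomials" "\<eta> \<in> haar_polynomials"
  then show "(\<lambda>\<phi>\<in>haar_polynomials. haar_series J c \<phi>) (\<lambda>x. \<phi> x + \<eta> x) =
      (\<lambda>\<phi>\<in>haar_polynomials. haar_series J c \<phi>) \<phi> + (\<lambda>\<phi>\<in>haar_polynomials. haar_series J c \<phi>) \<eta>"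
    by (simp add: haar_polynomials_add haar_series_add finite_spectrum_haar_polynomial haar_polynomials_step)
next
  fix a \<phi> assume "\<phi> \<in> haar_polynomials"
  then show "(\<lambda>\<phi>\<in>haar_polynomials. haar_series J c \<phi>) (\<lambda>x. a * \<phi> x) = a * (\<lambda>\<phi>\<in>haar_polynomials. haar_series J c \<phi>) \<phi>"
    by (simp add: haar_polynomials_scale haar_series_scale)
next
  fix \<phi> assume "(\<forall>i. \<phi> i \<in> haar_polynomials) \<and> null_sequence \<phi>"
  then have haar_polynomials: "\<And>i. \<phi> i \<in> haar_polynomials" and null: "null_sequence \<phi>" by auto
  obtain N n where A: "\<And>i. adapted N n (\<phi> i)" using null_sequence_adapted[OF null] by blast
  define F where "F = (SIGMA j:{N..<n}. {..<(2::nat) ^ nat (j - N)}) \<inter> J \<times> UNIV"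
  have "finite F" "F \<subseteq> J \<times> UNIV" by (auto simp: F_def)
  then have "haar_series J c (\<phi> i) = (\<Sum>(j, k)\<in>F. c j k * pairing (psi j k) (\<phi> i))" for i
    using haar_polynomials_support[OF haar_polynomials A, of J i] by (intro haar_series_finite) (auto simp: F_def)
  moreover have "(\<lambda>i. \<Sum>(j, k)\<in>F. c j k * pairing (psi j k) (\<phi> i)) \<longlonglongrightarrow> (\<Sum>(j, k)\<in>F. c j k * 0)"
    unfolding split_def
    by (intro tendsto_sum tendsto_mult tendsto_const pairing_null_sequence[OF _ null] step_locally_integrable step_psi)
  ultimately show "(\<lambda>i. (\<lambda>\<phi>\<in>haar_polynomials. haar_series J c \<phi>) (\<phi> i)) \<longlonglongrightarrow> 0"
    by (simp add: haar_polynomials)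
qed simp

lemma regular_dual:
  assumes "locally_integrable u"
  shows "regular haar_polynomials u \<in> dual haar_polynomials"
  unfolding dual_def regular_def
  using assms
  by (auto simp: haar_polynomials_add haar_polynomials_scale haar_polynomials_step pairing_add
      pairing_scale intro: pairing_null_sequence)

lemma solutions_iff:
  assumes g: "g \<in> dual haar_polynomials"
  shows "f \<in> solutions \<alpha> \<beta> g \<longleftrightarrow> f \<in> dual haar_polynomials \<and> (\<forall>j k. (eigval \<alpha> j + \<beta>) * f (psi j k) = g (psi j k))"
proof -
  have "(\<forall>\<phi>\<in>haar_polynomials. gibbs_dual \<alpha> f \<phi> + \<beta> * f \<phi> = g \<phi>) \<longleftrightarrow> (\<forall>j k. (eigval \<alpha> j + \<beta>) * f (psi j k) = g (psi j k))"
    if f: "f \<in> dual haar_polynomials"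
  proof
    assume L: "\<forall>\<phi>\<in>haar_polynomials. gibbs_dual \<alpha> f \<phi> + \<beta> * f \<phi> = g \<phi>"
    show "\<forall>j k. (eigval \<alpha> j + \<beta>) * f (psi j k) = g (psi j k)"
      using bspec[OF L haar_polynomials_psi]
      by (simp add: gibbs_dual_def gibbs_psi dual_scale[OF f] haar_polynomials_psi distrib_right)
  next
    assume R: "\<forall>j k. (eigval \<alpha> j + \<beta>) * f (psi j k) = g (psi j k)"
    show "\<forall>\<phi>\<in>haar_polynomials. gibbs_dual \<alpha> f \<phi> + \<beta> * f \<phi> = g \<phi>"
    proof
      fix \<phi> assume \<phi>: "\<phi> \<in> haar_polynomials"
      show "gibbs_dual \<alpha> f \<phi> + \<beta> * f \<phi> = g \<phi>"
      proof (rule linear_haar_polynomial_eqI[OF \<phi>])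
        fix \<phi> \<eta> assume "\<phi> \<in> haar_polynomials" "\<eta> \<in> haar_polynomials"
        then show "gibbs_dual \<alpha> f (\<lambda>x. \<phi> x + \<eta> x) + \<beta> * f (\<lambda>x. \<phi> x + \<eta> x) =
            (gibbs_dual \<alpha> f \<phi> + \<beta> * f \<phi>) + (gibbs_dual \<alpha> f \<eta> + \<beta> * f \<eta>)"
          "g (\<lambda>x. \<phi> x + \<eta> x) = g \<phi> + g \<eta>"
          by (simp_all add: gibbs_dual_def gibbs_add gibbs_haar_polynomial dual_add[OF f] dual_add[OF g]
              haar_polynomials_add algebra_simps)
      next
        fix a \<phi> assume "\<phi> \<in> haar_polynomials"
        then show "gibbs_dual \<alpha> f (\<lambda>x. a * \<phi> x) + \<beta> * f (\<lambda>x. a * \<phi> x) = a * (gibbs_dual \<alpha> f \<phi> + \<beta> * f \<phi>)"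
          "g (\<lambda>x. a * \<phi> x) = a * g \<phi>"
          by (simp_all add: gibbs_dual_def gibbs_scale gibbs_haar_polynomial dual_scale[OF f] dual_scale[OF g]
              haar_polynomials_scale algebra_simps)
      next
        fix j k show "gibbs_dual \<alpha> f (psi j k) + \<beta> * f (psi j k) = g (psi j k)"
          using R by (simp add: gibbs_dual_def gibbs_psi dual_scale[OF f] haar_polynomials_psi distrib_right)
      qed
    qed
  qed
  then show ?thesis unfolding solutions_def by blast
qed

text \<open>This makes \<open>j0\<close> the only scale at which a denominator vanishes.\<close>

lemma eigval_inj: "\<alpha> \<noteq> 0 \<Longrightarrow> eigval \<alpha> j = eigval \<alpha> j' \<longleftrightarrow> j = j'"
  by (simp add: eigval_def powr_inj)

subsection \<open>Quasi-Haar representation of functions\<close>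

text \<open>The expansion is required for all \<open>f\<close> at once and bundled with finiteness
  of both sums. In this form it passes to linear combinations and can be checked on
  generators.\<close>

definition quasi_haar :: "(cantor \<Rightarrow> complex) \<Rightarrow> bool" where
  "quasi_haar \<phi> \<longleftrightarrow> \<phi> \<in> step_functions \<and> finite_spectrum {0..} \<phi> \<and> finite {k. pairing (phi0 k) \<phi> \<noteq> 0} \<and>
    (\<forall>f. locally_integrable f \<longrightarrow> pairing f \<phi> =
      phi_series (\<lambda>k. pairing f (phi0 k)) \<phi> + haar_series {0..} (\<lambda>j k. pairing f (psi j k)) \<phi>)"

lemma phi_series_finite:
  assumes "finite A" "{k. pairing (phi0 k) \<phi> \<noteq> 0} \<subseteq> A"
  shows "phi_series a \<phi> = (\<Sum>k\<in>A. a k * pairing (phi0 k) \<phi>)"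
proof -
  have "phi_series a \<phi> = (\<Sum>\<^sub>\<infinity>k\<in>A. a k * pairing (phi0 k) \<phi>)"
    unfolding phi_series_def using assms(2) by (intro infsum_cong_neutral) auto
  then show ?thesis using assms(1) by simp
qed

lemma phi_series_add:
  assumes "finite {k. pairing (phi0 k) \<phi> \<noteq> 0}" "finite {k. pairing (phi0 k) \<eta> \<noteq> 0}"
    and "\<phi> \<in> step_functions" "\<eta> \<in> step_functions"
  shows "phi_series a (\<lambda>x. \<phi> x + \<eta> x) = phi_series a \<phi> + phi_series a \<eta>"
    and "finite {k. pairing (phi0 k) (\<lambda>x. \<phi> x + \<eta> x) \<noteq> 0}"
proof -
  define A where "A = {k. pairing (phi0 k) \<phi> \<noteq> 0} \<union> {k. pairing (phi0 k) \<eta> \<noteq> 0}"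
  have A: "finite A" using assms by (simp add: A_def)
  have p: "pairing (phi0 k) (\<lambda>x. \<phi> x + \<eta> x) = pairing (phi0 k) \<phi> + pairing (phi0 k) \<eta>" for k
    using assms by (intro pairing_add step_locally_integrable step_phi0)
  have sub: "{k. pairing (phi0 k) (\<lambda>x. \<phi> x + \<eta> x) \<noteq> 0} \<subseteq> A"
    unfolding p by (auto simp: A_def)
  then show "finite {k. pairing (phi0 k) (\<lambda>x. \<phi> x + \<eta> x) \<noteq> 0}"
    using A by (rule finite_subset)
  have "phi_series a (\<lambda>x. \<phi> x + \<eta> x) = (\<Sum>k\<in>A. a k * pairing (phi0 k) (\<lambda>x. \<phi> x + \<eta> x))"
    by (rule phi_series_finite[OF A sub])
  also have "\<dots> = (\<Sum>k\<in>A. a k * pairing (phi0 k) \<phi>) + (\<Sum>k\<in>A. a k * pairing (phi0 k) \<eta>)"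
    unfolding p by (simp only: distrib_left sum.distrib)
  also have "\<dots> = phi_series a \<phi> + phi_series a \<eta>"
    using phi_series_finite[OF A, of \<phi> a] phi_series_finite[OF A, of \<eta> a] by (auto simp: A_def)
  finally show "phi_series a (\<lambda>x. \<phi> x + \<eta> x) = phi_series a \<phi> + phi_series a \<eta>" .
qed

lemma phi_series_scale:
  "phi_series a (\<lambda>x. b * \<phi> x) = b * phi_series a \<phi>"
proof -
  have "phi_series a (\<lambda>x. b * \<phi> x) = (\<Sum>\<^sub>\<infinity>k. b * (a k * pairing (phi0 k) \<phi>))"
    unfolding phi_series_def by (rule infsum_cong) (auto simp: pairing_scale)
  then show ?thesis unfolding phi_series_def by (simp only: infsum_cmult_right')
qed

lemma quasi_haar_add:
  assumes "quasi_haar \<phi>" "quasi_haar \<eta>"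
  shows "quasi_haar (\<lambda>x. \<phi> x + \<eta> x)"
  using assms unfolding quasi_haar_def
  by (auto simp: step_add haar_series_add phi_series_add pairing_add)

lemma quasi_haar_scale:
  assumes "quasi_haar \<phi>"
  shows "quasi_haar (\<lambda>x. a * \<phi> x)"
proof -
  have "finite {k. pairing (phi0 k) (\<lambda>x. a * \<phi> x) \<noteq> 0}"
    by (rule finite_subset[of _ "{k. pairing (phi0 k) \<phi> \<noteq> 0}"])
      (use assms in \<open>auto simp: pairing_scale quasi_haar_def\<close>)
  then show ?thesis using assms unfolding quasi_haar_def
    by (auto simp: step_scale haar_series_scale phi_series_scale pairing_scale distrib_left)
qed

lemma quasi_haar_zero: "quasi_haar (\<lambda>_. 0)"
proof -
  have "pairing f (\<lambda>_. 0) = 0" for f by (simp add: pairing_def)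
  then show ?thesis
    by (simp add: quasi_haar_def finite_spectrum_def phi_series_def haar_series_def step_functions_def
        adapted_def split_def)
qed

lemma quasi_haar_sum:
  "(\<And>i. i \<in> F \<Longrightarrow> quasi_haar (\<phi> i)) \<Longrightarrow> quasi_haar (\<lambda>x. \<Sum>i\<in>F. \<phi> i x)"
proof (induction F rule: infinite_finite_induct)
  case (insert i F)
  then show ?case by (simp add: quasi_haar_add)
qed (auto simp: quasi_haar_zero)

lemma quasi_haar_psi:
  assumes "0 \<le> j"
  shows "quasi_haar (psi j k)"
proof -
  have 0: "pairing (phi0 k') (psi j k) = 0" for k'
    using pairing_psi_phi0[OF assms] by (simp add: pairing_commute[of "phi0 k'"])
  then have "phi_series a (psi j k) = 0" for a by (simp add: phi_series_def)
  then show ?thesis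
    using assms by (simp add: quasi_haar_def 0 step_psi haar_series_psi)
qed

lemma quasi_haar_phi0: "quasi_haar (phi0 k)"
proof -
  have "finite_spectrum {0..} (phi0 k)"
    unfolding finite_spectrum_def by (rule finite_subset[of _ "{}"]) (auto simp: pairing_psi_phi0)
  moreover have "haar_series {0..} c (phi0 k) = 0" for c
    unfolding haar_series_def by (rule infsum_0) (auto simp: pairing_psi_phi0)
  moreover have "phi_series a (phi0 k) = a k" for a
    using phi_series_finite[of "{k}" "phi0 k" a] by (auto simp: pairing_phi0_phi0)
  ultimately show ?thesis
    by (simp add: quasi_haar_def step_phi0 pairing_phi0_phi0)
qed

text \<open>The indicator of a half cell is half the indicator of its parent plus or minus a
  multiple of the Haar function on the parent.\<close>

lemma quasi_haar_cell_nat: "quasi_haar (indicator (cell (int i) m))"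
proof (induction i arbitrary: m)
  case 0
  then show ?case using quasi_haar_phi0[of m] by (simp add: phi0_eq)
next
  case (Suc i)
  define k s where "k = m div 2" and "s = (if even m then 1 else - 1 :: complex)"
  have "indicator (cell (int i + 1) m) x = 1 / 2 * indicator (cell (int i) k) x + (s / (2 * amp (int i))) * psi (int i) k x" for x
    unfolding indicator_cell_child psi_eq k_def[symmetric] s_def[symmetric]
    by (auto simp: indicator_def field_simps)
  then have "indicator (cell (int i + 1) m) = (\<lambda>x. 1 / 2 * indicator (cell (int i) k) x + (s / (2 * amp (int i))) * psi (int i) k x)"
    by blast
  then have "quasi_haar (indicator (cell (int i + 1) m))"
    by (simp only: quasi_haar_add quasi_haar_scale quasi_haar_psi Suc.IH of_nat_0_le_iff)
  then show ?case by (simp add: add.commute)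
qed

lemma quasi_haar_step:
  assumes "\<phi> \<in> step_functions"
  shows "quasi_haar \<phi>"
proof -
  obtain N n where Nn: "N \<le> n" "adapted N n \<phi>" using step_functionsE[OF assms] .
  \<comment> \<open>The generators are cells of nonnegative level, so a coarse resolution is first
    refined to level 0.\<close>
  define n' where "n' = max 0 n"
  have A: "adapted N n' \<phi>" "N \<le> n'" using Nn adapted_mono[OF Nn(2)] by (auto simp: n'_def)
  have "\<phi> = (\<lambda>x. \<Sum>m<2 ^ nat (n' - N). \<phi> (pt n' m) * indicator (cell n' m) x)"
    using adapted_sum[OF A] by blast
  moreover have "quasi_haar (indicator (cell n' m))" for m
    using quasi_haar_cell_nat[of "nat n'" m] by (simp add: n'_def)
  ultimately show ?thesis by (subst \<open>\<phi> = _\<close>) (intro quasi_haar_sum quasi_haar_scale)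
qed

lemma pairing_quasi_haar:
  assumes "locally_integrable f" "\<phi> \<in> step_functions"
  shows "pairing f \<phi> = phi_series (\<lambda>k. pairing f (phi0 k)) \<phi> + haar_series {0..} (\<lambda>j k. pairing f (psi j k)) \<phi>"
  using quasi_haar_step[OF assms(2)] assms(1) by (simp add: quasi_haar_def)

text \<open>The Haar functions have mean zero and unit cells have measure 1, so the quasi-Haar
  representation of the constant \<open>C\<close> consists of the coefficients \<open>C\<close>
  against all \<open>phi0 k\<close>.\<close>

lemma phi_series_shift:
  assumes "\<phi> \<in> step_functions"
  shows "phi_series (\<lambda>k. a k + C) \<phi> = phi_series a \<phi> + pairing (\<lambda>_. C) \<phi>"
proof -
  have li: "locally_integrable (\<lambda>_. C)" by (rule locally_integrable_continuous) simp
  have "pairing (\<lambda>_. C) (psi j k) = 0" for j k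
    by (simp add: pairing_def integral_psi)
  moreover have "pairing (\<lambda>_. C) (phi0 k) = C" for k
    by (simp add: pairing_def phi0_eq integral_cell)
  ultimately have "pairing (\<lambda>_. C) \<phi> = phi_series (\<lambda>_. C) \<phi>"
    using pairing_quasi_haar[OF li assms] by (simp add: haar_series_def split_def)
  moreover have "phi_series (\<lambda>k. a k + C) \<phi> = phi_series a \<phi> + phi_series (\<lambda>_. C) \<phi>"
    using quasi_haar_step[OF assms] unfolding quasi_haar_def
    by (simp add: phi_series_finite[of "{k. pairing (phi0 k) \<phi> \<noteq> 0}" \<phi>] distrib_right sum.distrib)
  ultimately show ?thesis by simp
qed

subsection \<open>The coarse system\<close>

text \<open>If \<open>a\<close> lists the integrals of a function over the unit cells, this is its
  integral over \<open>cell (- int l) p\<close>.\<close>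

definition block_sum :: "(nat \<Rightarrow> complex) \<Rightarrow> nat \<Rightarrow> nat \<Rightarrow> complex" where
  "block_sum a l p = (\<Sum>i<2 ^ l. a (2 ^ l * p + i))"

definition block_diff :: "(nat \<Rightarrow> complex) \<Rightarrow> nat \<Rightarrow> nat \<Rightarrow> complex" where
  "block_diff a l k = block_sum a l (2 * k) - block_sum a l (2 * k + 1)"

lemma coarse_system_iff:
  "coarse_system b a \<longleftrightarrow> (\<forall>l k. block_diff a l k = amp (int l + 1) * b (Suc l) k)"
proof -
  have "(\<Sum>m = 0..<2 ^ l. a (2 ^ Suc l * k + m)) = block_sum a l (2 * k)" for l k
    by (simp add: block_sum_def atLeast0LessThan mult_ac)
  moreover have "(\<Sum>m = 2 ^ l..<2 ^ Suc l. a (2 ^ Suc l * k + m)) = block_sum a l (2 * k + 1)" for l k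
  proof -
    have "(\<Sum>m = 2 ^ l..<2 ^ Suc l. a (2 ^ Suc l * k + m)) = (\<Sum>m = 0 + 2 ^ l..<2 ^ l + 2 ^ l. a (2 ^ Suc l * k + m))"
      by (simp add: mult_2)
    also have "\<dots> = (\<Sum>m = 0..<2 ^ l. a (2 ^ Suc l * k + (m + 2 ^ l)))"
      by (rule sum.shift_bounds_nat_ivl)
    also have "\<dots> = block_sum a l (2 * k + 1)"
      unfolding block_sum_def atLeast0LessThan by (intro sum.cong) (auto simp: algebra_simps)
    finally show ?thesis .
  qed
  ultimately have "(\<Sum>m = 0..<2 ^ (Suc l - 1). a (2 ^ Suc l * k + m)) - (\<Sum>m = 2 ^ (Suc l - 1)..<2 ^ Suc l. a (2 ^ Suc l * k + m))
      = block_diff a l k" for l k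
    unfolding block_diff_def diff_Suc_1 by presburger
  then have "coarse_system b a \<longleftrightarrow> (\<forall>j\<ge>1. \<forall>k. block_diff a (j - 1) k = complex_of_real (2 powr (real j / 2)) * b j k)"
    unfolding coarse_system_def by (metis One_nat_def Suc_le_D diff_Suc_1)
  also have "\<dots> \<longleftrightarrow> (\<forall>l k. block_diff a l k = amp (int l + 1) * b (Suc l) k)"
  proof (intro iffI allI impI)
    fix l k assume "\<forall>j\<ge>1. \<forall>k. block_diff a (j - 1) k = complex_of_real (2 powr (real j / 2)) * b j k"
    from this[rule_format, of "Suc l" k]
    show "block_diff a l k = amp (int l + 1) * b (Suc l) k" by (simp add: add.commute)
  next
    fix j k assume *: "\<forall>l k. block_diff a l k = amp (int l + 1) * b (Suc l) k" and j: "1 \<le> (j::nat)"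
    then obtain l where "j = Suc l" by (metis One_nat_def Suc_le_D)
    then show "block_diff a (j - 1) k = complex_of_real (2 powr (real j / 2)) * b j k"
      using * by (simp add: add.commute)
  qed
  finally show ?thesis .
qed

text \<open>Integrals over unit cells add up to integrals over larger cells, and a Haar coefficient
  at a negative scale is a normalised difference of the integrals over two halves of such a cell.
  Each row of the system is one of these coefficients.\<close>

lemma pairing_phi0_coarse_system:
  assumes f: "locally_integrable f"
  shows "coarse_system b (\<lambda>k. pairing f (phi0 k)) \<longleftrightarrow> (\<forall>j\<ge>1. \<forall>k. pairing f (psi (- int j) k) = b j k)"
proof -
  have "block_sum (\<lambda>k. pairing f (phi0 k)) l p = pairing f (indicator (cell (- int l) p))" for l p
  proof -
    have "indicator (cell (- int l) p) = (\<lambda>x. \<Sum>i<2 ^ l. phi0 (2 ^ l * p + i) x)"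
      using indicator_cell_split_pow[of "- int l" p _ l] by (simp add: phi0_eq fun_eq_iff)
    then show ?thesis
      by (simp add: block_sum_def pairing_sum[OF f] step_phi0)
  qed
  moreover have "pairing f (psi (- int (Suc l)) k) = amp (- int (Suc l)) *
      (pairing f (indicator (cell (- int l) (2 * k))) - pairing f (indicator (cell (- int l) (2 * k + 1))))" for l k
  proof -
    have "psi (- int (Suc l)) k = (\<lambda>x. amp (- int (Suc l)) *
        (indicator (cell (- int l) (2 * k)) x + - 1 * indicator (cell (- int l) (2 * k + 1)) x))"
      by (rule ext) (simp add: psi_indicator)
    then show ?thesis
      by (simp only: pairing_scale pairing_add[OF f step_cell step_scale[OF step_cell]]) simp
  qed
  ultimately have eq: "pairing f (psi (- int (Suc l)) k) = amp (- int (Suc l)) * block_diff (\<lambda>k. pairing f (phi0 k)) l k" for l k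
    by (simp add: block_diff_def)
  have amp: "amp (int l + 1) * amp (- int (Suc l)) = 1" for l
    by (simp flip: of_real_mult powr_add add: add_divide_distrib[symmetric])
  have "block_diff (\<lambda>k. pairing f (phi0 k)) l k = amp (int l + 1) * b (Suc l) k \<longleftrightarrow>
      pairing f (psi (- int (Suc l)) k) = b (Suc l) k" for l k
  proof -
    have "block_diff (\<lambda>k. pairing f (phi0 k)) l k = amp (int l + 1) * pairing f (psi (- int (Suc l)) k)"
      unfolding eq mult.assoc[symmetric] amp by simp
    then show ?thesis by simp
  qed
  then show ?thesis
    unfolding coarse_system_iff by (metis One_nat_def Suc_le_D Suc_le_mono le0)
qed

lemma block_sum_diff: "block_sum (\<lambda>n. a n - a' n) l p = block_sum a l p - block_sum a' l p"
  by (simp add: block_sum_def sum_subtractf)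

text \<open>The difference of two solutions has equal sums over the two halves of every block. Once
  it is constant on blocks of length 2^l, this makes adjacent halves agree, so it is constant on
  blocks of length 2^(l+1).\<close>

lemma coarse_system_unique:
  assumes "coarse_system b a" "coarse_system b a'"
  shows "a' n - a n = a' 0 - a 0"
proof -
  define d where "d n = a' n - a n" for n
  have bal: "block_sum d l (2 * k) = block_sum d l (2 * k + 1)" for l k
    using assms unfolding coarse_system_iff block_diff_def d_def block_sum_diff
    by (simp add: algebra_simps)
  have const: "\<forall>p. \<forall>i<2 ^ l. d (2 ^ l * p + i) = d (2 ^ l * p)" for l
  proof (induction l)
    case (Suc l)
    have B: "block_sum d l p = 2 ^ l * d (2 ^ l * p)" for p
      using Suc by (simp add: block_sum_def)
    have halves: "d (2 ^ l * (2 * p + 1)) = d (2 ^ l * (2 * p))" for p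
      using bal[of l p] unfolding B by simp
    show ?case
    proof (intro allI impI)
      fix p i :: nat assume i: "i < 2 ^ Suc l"
      show "d (2 ^ Suc l * p + i) = d (2 ^ Suc l * p)"
      proof (cases "i < 2 ^ l")
        case True
        then show ?thesis using Suc[rule_format, of i "2 * p"] by (simp add: mult_ac)
      next
        case False
        then have "i - 2 ^ l < 2 ^ l" "2 ^ Suc l * p + i = 2 ^ l * (2 * p + 1) + (i - 2 ^ l)"
          using i by (auto simp: algebra_simps)
        then show ?thesis using Suc[rule_format, of "i - 2 ^ l" "2 * p + 1"] halves[of p] by (simp add: mult_ac)
      qed
    qed
  qed simp
  \<comment> \<open>\<open>n < 2 ^ n\<close> puts \<open>n\<close> into the initial block of length
    2^n.\<close>
  have "d n = d 0" using const[of n, rule_format, of n 0] less_exp[of n] by simp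
  then show ?thesis by (simp add: d_def)
qed

text \<open>Stage \<open>l\<close> solves the equations of the scales below \<open>l\<close>. The next stage only adds a constant
  to every second block of length \<open>2\<^sup>l\<close>, so the earlier equations persist and the initial block is
  final.\<close>

primrec coarse_stage :: "(nat \<Rightarrow> nat \<Rightarrow> complex) \<Rightarrow> nat \<Rightarrow> nat \<Rightarrow> complex" where
  "coarse_stage r 0 = (\<lambda>_. 0)"
| "coarse_stage r (Suc l) = (\<lambda>n. coarse_stage r l n +
     (if odd (n div 2 ^ l) then (block_diff (coarse_stage r l) l (n div 2 ^ Suc l) - r l (n div 2 ^ Suc l)) / 2 ^ l else 0))"

lemma block_sum_add_const:
  assumes "\<And>i. i < 2 ^ l \<Longrightarrow> a' (2 ^ l * p + i) = a (2 ^ l * p + i) + c"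
  shows "block_sum a' l p = block_sum a l p + 2 ^ l * c"
  using assms by (simp add: block_sum_def sum.distrib)

text \<open>At the new scale the odd block receives in total the excess of the old difference over
  \<open>r\<close>, which leaves exactly \<open>r\<close>. At an earlier scale the blocks
  \<open>2 * k\<close> and \<open>2 * k + 1\<close> lie in one block of length 2^L, receive the same
  constant, and their difference is unchanged.\<close>

lemma coarse_stage_diff:
  "l < L \<Longrightarrow> block_diff (coarse_stage r L) l k = r l k"
proof (induction L)
  case (Suc L)
  define c where "c p = (if odd p then (block_diff (coarse_stage r L) L (p div 2) - r L (p div 2)) / 2 ^ L else 0)" for p :: nat
  have step: "coarse_stage r (Suc L) n = coarse_stage r L n + c (n div 2 ^ L)" for n
    by (simp add: c_def div_mult2_eq[symmetric] mult.commute)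
  show ?case
  proof (cases "l = L")
    case True
    have "block_sum (coarse_stage r (Suc L)) L p = block_sum (coarse_stage r L) L p + 2 ^ L * c p" for p
      by (rule block_sum_add_const) (simp only: step, simp)
    then show ?thesis using True by (simp add: block_diff_def c_def)
  next
    case False
    then have l: "l < L" using Suc.prems by simp
    have "block_sum (coarse_stage r (Suc L)) l p = block_sum (coarse_stage r L) l p + 2 ^ l * c (p div 2 ^ (L - l))" for p
    proof (rule block_sum_add_const)
      fix i :: nat assume "i < 2 ^ l"
      moreover have "(2::nat) ^ L = 2 ^ l * 2 ^ (L - l)" using l by (simp flip: power_add)
      ultimately have "(2 ^ l * p + i) div 2 ^ L = p div 2 ^ (L - l)"
        by (simp add: div_mult2_eq)
      then show "coarse_stage r (Suc L) (2 ^ l * p + i) = coarse_stage r L (2 ^ l * p + i) + c (p div 2 ^ (L - l))"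
        by (simp only: step)
    qed
    moreover have "2 * k div 2 ^ (L - l) = (2 * k + 1) div 2 ^ (L - l)"
    proof -
      have "(2::nat) ^ (L - l) = 2 * 2 ^ (L - l - 1)" using l by (simp flip: power_Suc)
      then show ?thesis by (simp only: div_mult2_eq) simp
    qed
    ultimately show ?thesis using Suc.IH[OF l] by (simp add: block_diff_def)
  qed
qed simp

text \<open>For \<open>L \<ge> n\<close> the index \<open>n\<close> lies in block 0 of length 2^L;
  its number is even, so the correction is 0.\<close>

lemma coarse_stage_stable: "n \<le> L \<Longrightarrow> coarse_stage r L n = coarse_stage r n n"
proof (induction L rule: dec_induct)
  case (step L)
  then have "n < 2 ^ L" using less_exp[of L] by linarith
  then show ?case using step by simp
qed simp

lemma coarse_system_solvable: "\<exists>a. coarse_system b a"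
proof -
  define r where "r l k = amp (int l + 1) * b (Suc l) k" for l k
  define a where "a n = coarse_stage r n n" for n
  have "block_diff a l k = r l k" for l k
  proof -
    \<comment> \<open>Large enough to exceed \<open>l\<close> and every index occurring in the two
      blocks, so a single stage computes the whole difference.\<close>
    define L where "L = 2 ^ l * (2 * k + 2) + l + 1"
    have a: "a n = coarse_stage r L n" if "n \<le> L" for n
      unfolding a_def by (rule coarse_stage_stable[OF that, symmetric])
    have le: "2 ^ l * (2 * k) + i \<le> L" "2 ^ l * (2 * k + 1) + i \<le> L" if "i < 2 ^ l" for i
      using that by (auto simp: L_def algebra_simps)
    have "block_diff a l k = block_diff (coarse_stage r L) l k"
      unfolding block_diff_def block_sum_def
      by (intro arg_cong2[of _ _ _ _ minus] sum.cong refl a le) auto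
    also have "\<dots> = r l k" by (rule coarse_stage_diff) (simp add: L_def)
    finally show ?thesis .
  qed
  then show ?thesis unfolding coarse_system_iff r_def by blast
qed

subsection \<open>Continuous functions with prescribed coefficients\<close>

lemma pairing_add_left:
  assumes "locally_integrable f" "locally_integrable h" "\<phi> \<in> step_functions"
  shows "pairing (\<lambda>x. f x + h x) \<phi> = pairing f \<phi> + pairing h \<phi>"
  unfolding pairing_def using assms by (simp add: distrib_right integrable_step)

lemma pairing_scale_left: "pairing (\<lambda>x. a * f x) \<phi> = a * pairing f \<phi>"
  unfolding pairing_def by (simp add: mult.assoc)

text \<open>The sum of \<open>c k * psi j k\<close> over all \<open>k\<close>, written through its
  only possibly nonzero term at \<open>x\<close>. No condition on \<open>c\<close> is required, and
  the function is locally constant.\<close>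

definition level :: "int \<Rightarrow> (nat \<Rightarrow> complex) \<Rightarrow> cantor \<Rightarrow> complex" where
  "level j c x = c (idx j x) * psi j (idx j x) x"

lemma level_eq: "level j c x = c (idx j x) * (amp j * rho j x)"
  by (simp add: level_def psi_eq)

lemma rho_cong: "j < n \<Longrightarrow> idx n x = idx n y \<Longrightarrow> rho j x = rho j y"
  by (simp add: rho_def idx_eq_iff)

lemma continuous_level: "continuous_on UNIV (level j c)"
proof (rule continuous_idx_invariant)
  fix x y assume eq: "idx (j + 1) x = idx (j + 1) y"
  show "level j c x = level j c y"
    using idx_mono[OF _ eq, of j] rho_cong[OF _ eq, of j] by (simp add: level_eq)
qed

lemma pairing_level_invariant:
  assumes "\<And>x. u (unit_pt j + x) = u x"
  shows "pairing (level j c) u = 0"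
  unfolding pairing_def
  by (rule integral_haar_antisym[of _ "unit_pt j"]) (simp add: assms level_eq idx_unit_add rho_unit_add)

lemma pairing_level_phi0: "0 \<le> j \<Longrightarrow> pairing (level j c) (phi0 k) = 0"
  by (rule pairing_level_invariant) (simp add: phi0_eq indicator_def idx_unit_add)

lemma pairing_level_psi: "pairing (level j c) (psi i k) = of_bool (i = j) * c k"
proof -
  consider "i < j" | "j < i" | "i = j" by linarith
  then show ?thesis
  proof cases
    case 1
    then show ?thesis by (simp add: pairing_level_invariant psi_unit_add_above)
  next
    case 2
    have "pairing (psi i k) (level j c) = 0"
      by (rule pairing_psi_invariant) (use 2 in \<open>simp add: level_eq idx_unit_add rho_unit_add\<close>)
    then show ?thesis using 2 by (simp add: pairing_commute[of "level j c"])
  next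
    case 3
    have eq: "level j c x * psi j k x = c k * psi j k x * psi j k x" for x
      by (cases "idx j x = k") (simp_all add: level_def psi_eq)
    have "pairing (level j c) (psi j k) = pairing (\<lambda>x. c k * psi j k x) (psi j k)"
      by (simp only: pairing_def eq)
    then show ?thesis using 3 by (simp add: pairing_scale_left pairing_psi_psi)
  qed
qed

text \<open>\<open>M\<close> may grow from one unit cell to the next. Local uniformity suffices,
  since unit cells are open and each \<open>phi0 k\<close>, and each \<open>psi (int i) k\<close>,
  is supported in a single one.\<close>

lemma sum_levels:
  fixes v :: "nat \<Rightarrow> nat \<Rightarrow> complex" and M :: "nat \<Rightarrow> real"
  assumes w: "summable w" and bd: "\<And>j x. norm (level (int j) (v j) x) \<le> M (idx 0 x) * w j"
  defines "h \<equiv> \<lambda>x. \<Sum>j. level (int j) (v j) x"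
  shows "continuous_on UNIV h"
    and "pairing h (phi0 k) = 0"
    and "pairing h (psi (int i) k) = v i k"
proof -
  have "continuous_on (cell 0 m) h" for m
  proof (rule uniform_limit_theorem)
    show "uniform_limit (cell 0 m) (\<lambda>n x. \<Sum>j<n. level (int j) (v j) x) h sequentially"
      unfolding h_def
    proof (rule Weierstrass_m_test)
      show "norm (level (int j) (v j) x) \<le> M m * w j" if "x \<in> cell 0 m" for j x
        using bd[of j x] that by simp
      show "summable (\<lambda>j. M m * w j)" using w by (rule summable_mult)
    qed
    show "\<forall>\<^sub>F n in sequentially. continuous_on (cell 0 m) (\<lambda>x. \<Sum>j<n. level (int j) (v j) x)"
      by (intro always_eventually allI continuous_on_sum continuous_on_subset[OF continuous_level] subset_UNIV)
  qed simp
  then have "continuous_on (\<Union>m. cell 0 m) h"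
    by (intro continuous_on_open_UN open_cell) auto
  moreover have "(\<Union>m. cell 0 m) = UNIV" by auto
  ultimately show "continuous_on UNIV h" by simp
  \<comment> \<open>Termwise integration against a step function inside one unit cell, where
    \<open>M p * w j\<close> times the norm of the step function dominates the terms.\<close>
  have exch: "pairing h \<phi> = (\<Sum>j. pairing (level (int j) (v j)) \<phi>)"
    if \<phi>: "\<phi> \<in> step_functions" and supp: "\<And>x. idx 0 x \<noteq> p \<Longrightarrow> \<phi> x = 0" for \<phi> p
  proof -
    have li: "locally_integrable (level (int j) (v j))" for j
      by (intro locally_integrable_continuous continuous_level)
    have int: "integrable haar (\<lambda>x. level (int j) (v j) x * \<phi> x)" for j
      by (rule integrable_step[OF li \<phi>])
    have bd': "norm (level (int j) (v j) x * \<phi> x) \<le> (M p * norm (\<phi> x)) * w j" for j x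
    proof (cases "idx 0 x = p")
      case True
      then show ?thesis
        using mult_right_mono[OF bd[of j x], of "norm (\<phi> x)"] by (simp add: norm_mult mult_ac)
    qed (simp add: supp)
    have int\<phi>: "integrable haar (\<lambda>x. norm (\<phi> x))"
      using integrable_step_functions[OF \<phi>] by (rule integrable_norm)
    have s: "summable (\<lambda>j. norm (level (int j) (v j) x * \<phi> x))" for x
      by (rule summable_comparison_test'[OF summable_mult[OF w, of "M p * norm (\<phi> x)"], of 0])
        (use bd' in simp)
    have "pairing h \<phi> = (\<integral>x. (\<Sum>j. level (int j) (v j) x * \<phi> x) \<partial>haar)"
      unfolding pairing_def
    proof (rule Bochner_Integration.integral_cong[OF refl])
      fix x
      show "h x * \<phi> x = (\<Sum>j. level (int j) (v j) x * \<phi> x)"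
      proof -
        have "summable (\<lambda>j. level (int j) (v j) x)"
          by (rule summable_comparison_test'[OF summable_mult[OF w, of "M (idx 0 x)"], of 0]) (use bd in simp)
        then show ?thesis unfolding h_def by (rule suminf_mult2)
      qed
    qed
    also have "\<dots> = (\<Sum>j. \<integral>x. level (int j) (v j) x * \<phi> x \<partial>haar)"
    proof (rule integral_suminf[OF int])
      show "AE x in haar. summable (\<lambda>j. norm (level (int j) (v j) x * \<phi> x))" using s by simp
      show "summable (\<lambda>j. \<integral>x. norm (level (int j) (v j) x * \<phi> x) \<partial>haar)"
      proof (rule summable_comparison_test'[OF summable_mult[OF w, of "\<integral>x. M p * norm (\<phi> x) \<partial>haar"], of 0])
        fix j
        have "(\<integral>x. norm (level (int j) (v j) x * \<phi> x) \<partial>haar) \<le> (\<integral>x. (M p * norm (\<phi> x)) * w j \<partial>haar)"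
          using int\<phi> integrable_step_functions[OF \<phi>]
          by (intro integral_mono integrable_norm int integrable_mult_left integrable_mult_right bd')
        then show "norm (\<integral>x. norm (level (int j) (v j) x * \<phi> x) \<partial>haar) \<le> (\<integral>x. M p * norm (\<phi> x) \<partial>haar) * w j"
          by simp
      qed
    qed
    finally show ?thesis by (simp add: pairing_def)
  qed
  show "pairing h (phi0 k) = 0"
  proof -
    have "pairing h (phi0 k) = (\<Sum>j. pairing (level (int j) (v j)) (phi0 k))"
      by (rule exch[OF step_phi0, of k]) (simp add: phi0_eq)
    then show ?thesis by (simp add: pairing_level_phi0)
  qed
  have "pairing h (psi (int i) k) = (\<Sum>j. pairing (level (int j) (v j)) (psi (int i) k))"
  \<comment> \<open>Dropping \<open>i\<close> digits of \<open>k\<close> gives the unit cell that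
    contains \<open>cell (int i) k\<close>.\<close>
  proof (rule exch[OF step_psi, of "k div 2 ^ i"])
    fix x assume "idx 0 x \<noteq> k div 2 ^ i"
    then have "idx (int i) x \<noteq> k" using idx_div[of 0 i x] by auto
    then show "psi (int i) k x = 0" by (simp add: psi_eq)
  qed
  also have "\<dots> = (\<Sum>j\<in>{i}. pairing (level (int j) (v j)) (psi (int i) k))"
    by (rule suminf_finite) (auto simp: pairing_level_psi)
  finally show "pairing h (psi (int i) k) = v i k" by (simp add: pairing_level_psi)
qed

text \<open>The coefficient is at most G 2^(j/2) times the cell measure 2^(-j), and the amplitude
  2^(j/2) of the Haar function restores \<open>G\<close>, independently of \<open>j\<close>.\<close>

lemma norm_level_coefficient:
  assumes g0: "continuous_on UNIV g0" and G: "\<And>y. y \<in> cell 0 (idx 0 x) \<Longrightarrow> norm (g0 y) \<le> G"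
  shows "norm (level (int j) (\<lambda>k. pairing g0 (psi (int j) k)) x) \<le> G"
proof -
  define k where "k = idx (int j) x"
  have sub: "cell (int j) k \<subseteq> cell 0 (idx 0 x)"
  proof
    fix y assume "y \<in> cell (int j) k"
    then have eq: "idx (int j) y = idx (int j) x" by (simp add: k_def)
    show "y \<in> cell 0 (idx 0 x)" using idx_mono[OF _ eq, of 0] by simp
  qed
  have "norm (pairing g0 (psi (int j) k)) \<le> (\<integral>y. norm (g0 y * psi (int j) k y) \<partial>haar)"
    unfolding pairing_def by (rule integral_norm_bound)
  also have "\<dots> \<le> (\<integral>y. G * 2 powr (j / 2) * indicat_real (cell (int j) k) y \<partial>haar)"
  proof (rule integral_mono)
    show "integrable haar (\<lambda>y. norm (g0 y * psi (int j) k y))"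
      by (intro integrable_norm integrable_step locally_integrable_continuous g0 step_psi)
    show "integrable haar (\<lambda>y. G * 2 powr (j / 2) * indicat_real (cell (int j) k) y)"
      by (intro integrable_mult_right integrable_real_indicator) (auto simp: emeasure_cell open_cell)
    fix y
    show "norm (g0 y * psi (int j) k y) \<le> G * 2 powr (j / 2) * indicat_real (cell (int j) k) y"
    proof (cases "y \<in> cell (int j) k")
      case True
      then have "norm (g0 y) \<le> G" using G sub by blast
      then show ?thesis using True by (simp add: psi_eq norm_mult rho_def mult_right_mono)
    qed (simp add: psi_eq)
  qed
  also have "\<dots> = G * 2 powr (j / 2) * 2 powi (- int j)"
    by (simp add: measure_def emeasure_cell)
  finally have "norm (pairing g0 (psi (int j) k)) \<le> G * 2 powr (j / 2) * 2 powi (- int j)" .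
  then have "norm (pairing g0 (psi (int j) k)) * 2 powr (j / 2) \<le> G * 2 powr (j / 2) * 2 powi (- int j) * 2 powr (j / 2)"
    by (rule mult_right_mono) simp
  also have "\<dots> = G * (2 powr (j / 2) * 2 powr (j / 2) * 2 powi (- int j))" by simp
  also have "2 powr (j / 2) * 2 powr (j / 2) * 2 powi (- int j) = (1::real)"
    by (simp add: powr_realpow power_int_minus flip: powr_add)
  finally show ?thesis by (simp add: level_eq norm_mult rho_def k_def)
qed

lemma continuous_with_coefficients:
  fixes g0 :: "cantor \<Rightarrow> complex" and \<mu> :: "nat \<Rightarrow> complex"
  assumes g0: "continuous_on UNIV g0" and \<mu>: "summable (\<lambda>j. norm (\<mu> j))"
  obtains f where "continuous_on UNIV f" "\<And>k. pairing f (phi0 k) = a k"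
    "\<And>j k. pairing f (psi (int j) k) = (s + \<mu> j) * pairing g0 (psi (int j) k) + of_bool (j = j0) * c k"
proof -
  define v where "v j k = \<mu> j * pairing g0 (psi (int j) k)" for j k
  obtain M where M: "\<And>m x. x \<in> cell 0 m \<Longrightarrow> norm (g0 x) \<le> M m"
    using continuous_bounded_on_cell[OF g0] by metis
  have bd: "norm (level (int j) (v j) x) \<le> M (idx 0 x) * norm (\<mu> j)" for j x
  proof -
    have "level (int j) (v j) x = \<mu> j * level (int j) (\<lambda>k. pairing g0 (psi (int j) k)) x"
      by (simp add: level_def v_def)
    moreover have "norm (level (int j) (\<lambda>k. pairing g0 (psi (int j) k)) x) \<le> M (idx 0 x)"
      by (rule norm_level_coefficient[OF g0 M])
    ultimately show ?thesis
      by (simp add: norm_mult mult.commute mult_left_mono)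
  qed
  define h where "h x = (\<Sum>j. level (int j) (v j) x)" for x
  note h = sum_levels[OF \<mu> bd, folded h_def]
  \<comment> \<open>\<open>P\<close> is constant on unit cells, hence invisible to the scales
    \<open>j \<ge> 0\<close>; it turns the coefficients of \<open>s * g0\<close> against the
    \<open>phi0 k\<close> into the prescribed \<open>a k\<close>.\<close>
  define P where "P = (\<lambda>x. a (idx 0 x) - s * pairing g0 (phi0 (idx 0 x)))"
  have P: "continuous_on UNIV P" by (rule continuous_idx_invariant[of 0]) (simp add: P_def)
  have P_phi: "pairing P (phi0 k) = a k - s * pairing g0 (phi0 k)" for k
  proof -
    have "P x * phi0 k x = (a k - s * pairing g0 (phi0 k)) * indicator (cell 0 k) x" for x
      by (cases "idx 0 x = k") (auto simp: P_def phi0_eq)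
    then show ?thesis by (simp add: pairing_def integral_cell)
  qed
  have P_psi: "pairing P (psi (int j) k) = 0" for j k
    unfolding pairing_commute[of P]
    by (rule pairing_psi_invariant) (simp add: P_def idx_unit_add)
  \<comment> \<open>The summands have separate tasks: \<open>s * g0\<close> and \<open>h\<close>
    produce the factor \<open>s + \<mu> j\<close>, \<open>P\<close> adjusts the \<open>phi0\<close>
    coefficients, and the last one adds the free coefficients at scale \<open>j0\<close>.\<close>
  define f where "f x = (s * g0 x + h x) + (P x + level (int j0) c x)" for x
  have li: "locally_integrable g0" "locally_integrable h" "locally_integrable P"
    "locally_integrable (level (int j0) c)" "locally_integrable (\<lambda>x. s * g0 x)"
    "locally_integrable (\<lambda>x. s * g0 x + h x)" "locally_integrable (\<lambda>x. P x + level (int j0) c x)"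
    by (intro locally_integrable_continuous continuous_intros g0 h(1) P continuous_level)+
  have pf: "pairing f \<phi> = (s * pairing g0 \<phi> + pairing h \<phi>) + (pairing P \<phi> + pairing (level (int j0) c) \<phi>)"
    if "\<phi> \<in> step_functions" for \<phi>
    unfolding f_def by (simp add: pairing_add_left li that pairing_scale_left)
  show ?thesis
  proof
    show "continuous_on UNIV f"
      unfolding f_def by (intro continuous_intros g0 h(1) P continuous_level)
    show "pairing f (phi0 k) = a k" for k
      by (simp add: pf step_phi0 h(2) P_phi pairing_level_phi0)
    show "pairing f (psi (int j) k) = (s + \<mu> j) * pairing g0 (psi (int j) k) + of_bool (j = j0) * c k" for j k
      by (simp add: pf step_psi h(3) P_psi pairing_level_psi v_def distrib_right)
  qed
qed

text \<open>Here \<open>s\<close> is the limit of the multipliers: \<open>0\<close> if \<open>\<alpha> > 0\<close> and \<open>1 / \<beta>\<close> if \<open>\<alpha> < 0\<close>.\<close>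

lemma multiplier_decomposition:
  assumes "\<alpha> \<noteq> 0" "\<beta> \<noteq> 0"
  obtains s \<mu> where "summable (\<lambda>j. norm (\<mu> j))"
    "\<And>j. s + \<mu> j = 1 / (eigval \<alpha> (int j) + \<beta>)"
proof -
  define lm where "lm j = 1 / (eigval \<alpha> (int j) + \<beta>)" for j :: nat
  have ev: "eigval \<alpha> (int j) = complex_of_real (2 powr \<alpha>) ^ j" for j
    by (simp add: eigval_def powr_powr[symmetric] mult.commute[of _ \<alpha>] powr_realpow)
  show ?thesis
  proof (cases "\<alpha> > 0")
    case True
    define r where "r = complex_of_real (2 powr - \<alpha>)"
    have r: "norm r < 1" "r \<noteq> 0" using True by (auto simp: r_def powr_less_one)
    \<comment> \<open>This also holds where the denominator vanishes: both sides are then 0 by the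
      convention for division.\<close>
    have lm: "lm j / r ^ j = 1 / (1 + \<beta> * r ^ j)" for j
    proof -
      have "r ^ j * eigval \<alpha> (int j) = 1"
        unfolding ev r_def power_mult_distrib[symmetric] of_real_mult[symmetric] by (simp flip: powr_add)
      then show ?thesis unfolding lm_def by (simp add: field_simps)
    qed
    have "(\<lambda>j. 1 / (1 + \<beta> * r ^ j)) \<longlonglongrightarrow> 1 / (1 + \<beta> * 0)"
      by (intro tendsto_intros LIMSEQ_power_zero r(1)) simp
    then have "lm \<in> O(\<lambda>j. r ^ j)"
      by (intro bigoI_tendsto[where c = 1]) (use r(2) in \<open>auto simp: lm\<close>)
    then have "(\<lambda>j. norm (lm j)) \<in> O(\<lambda>j. norm (r ^ j))" by simp
    moreover have "summable (\<lambda>j. norm (norm (r ^ j)))" using r(1) by (simp add: norm_power summable_geometric)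
    ultimately have "summable (\<lambda>j. norm (lm j))" by (metis summable_comparison_test_bigo)
    then show ?thesis using that[of lm 0] by (simp add: lm_def)
  next
    case False
    define r where "r = complex_of_real (2 powr \<alpha>)"
    have r: "norm r < 1" "r \<noteq> 0" using False assms(1) by (auto simp: r_def powr_less_one)
    define \<mu> where "\<mu> j = lm j - 1 / \<beta>" for j
    have lim: "(\<lambda>j. r ^ j + \<beta>) \<longlonglongrightarrow> 0 + \<beta>"
      by (intro tendsto_intros LIMSEQ_power_zero r(1))
    then have "eventually (\<lambda>j. r ^ j + \<beta> \<noteq> 0) sequentially"
      using assms(2) by (intro tendsto_imp_eventually_ne) auto
    \<comment> \<open>Subtracting the limit 1/\<beta> leaves a fraction with numerator r^j, so the
      remainder decays geometrically. Vanishing denominators are confined to finitely many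
      \<open>j\<close> and do not affect summability.\<close>
    then have ev2: "eventually (\<lambda>j. - 1 / (\<beta> * (r ^ j + \<beta>)) = \<mu> j / r ^ j) sequentially"
    proof eventually_elim
      case (elim j)
      have "1 / (r ^ j + \<beta>) - 1 / \<beta> = - (r ^ j) / (\<beta> * (r ^ j + \<beta>))"
        using elim assms(2) by (simp add: diff_frac_eq mult.commute)
      then show ?case using r(2) unfolding \<mu>_def lm_def ev r_def[symmetric] by simp
    qed
    have "(\<lambda>j. - 1 / (\<beta> * (r ^ j + \<beta>))) \<longlonglongrightarrow> - 1 / (\<beta> * (0 + \<beta>))"
      by (intro tendsto_divide tendsto_mult tendsto_const lim) (use assms(2) in simp)
    then have "(\<lambda>j. \<mu> j / r ^ j) \<longlonglongrightarrow> - 1 / (\<beta> * (0 + \<beta>))"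
      using ev2 by (rule Lim_transform_eventually)
    then have "\<mu> \<in> O(\<lambda>j. r ^ j)"
      by (rule bigoI_tendsto) (use r(2) in auto)
    then have "(\<lambda>j. norm (\<mu> j)) \<in> O(\<lambda>j. norm (r ^ j))" by simp
    moreover have "summable (\<lambda>j. norm (norm (r ^ j)))" using r(1) by (simp add: norm_power summable_geometric)
    ultimately have "summable (\<lambda>j. norm (\<mu> j))" by (metis summable_comparison_test_bigo)
    then show ?thesis using that[of \<mu> "1 / \<beta>"] by (simp add: \<mu>_def lm_def)
  qed
qed

text \<open>The bridge between a function and the displayed formal series, used for both inclusions:
  its quasi-Haar representation, with scale \<open>j0\<close> split off and the common shift
  \<open>C\<close> of the \<open>phi0\<close> coefficients collected into a constant
  function.\<close>

lemma regular_test_functions_eq: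
  assumes f: "locally_integrable f" and j0: "0 \<le> j0"
    and "\<And>k. pairing f (phi0 k) = a k + C"
    and "\<And>j k. 0 \<le> j \<Longrightarrow> j \<noteq> j0 \<Longrightarrow> pairing f (psi j k) = q j k"
    and "\<And>k. pairing f (psi j0 k) = c k"
  shows "regular test_functions f = (\<lambda>\<phi>\<in>test_functions.
    phi_series a \<phi> + haar_series ({0..} - {j0}) q \<phi> + haar_series {j0} (\<lambda>_. c) \<phi> + pairing (\<lambda>_. C) \<phi>)"
  unfolding regular_def
proof (rule restrict_ext)
  fix \<phi> assume "\<phi> \<in> test_functions"
  then have \<phi>: "\<phi> \<in> step_functions" by (rule test_functions_step)
  have J: "{0..} = ({0..} - {j0}) \<union> {j0}" using j0 by auto
  have fin: "finite_spectrum (({0..} - {j0}) \<union> {j0}) \<phi>"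
    using quasi_haar_step[OF \<phi>] J unfolding quasi_haar_def by simp
  have "pairing f \<phi> = phi_series (\<lambda>k. a k + C) \<phi> + haar_series (({0..} - {j0}) \<union> {j0}) (\<lambda>j k. pairing f (psi j k)) \<phi>"
    using pairing_quasi_haar[OF f \<phi>] J assms(3) by simp
  also have "haar_series (({0..} - {j0}) \<union> {j0}) (\<lambda>j k. pairing f (psi j k)) \<phi> =
      haar_series ({0..} - {j0}) q \<phi> + haar_series {j0} (\<lambda>_. c) \<phi>"
    unfolding haar_series_split[OF fin Diff_disjoint[of "{j0}", unfolded Int_commute[of "{j0}"]]]
    by (intro arg_cong2[of _ _ _ _ plus] haar_series_cong) (auto simp: assms)
  finally show "pairing f \<phi> = phi_series a \<phi> + haar_series ({0..} - {j0}) q \<phi> +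
      haar_series {j0} (\<lambda>_. c) \<phi> + pairing (\<lambda>_. C) \<phi>"
    by (simp add: phi_series_shift[OF \<phi>])
qed

text \<open>Continuous solutions are compared as functionals on \<open>test_functions\<close>, where
  the constant \<open>C\<close> is visible, while the equation itself lives on
  \<open>haar_polynomials\<close>. Solvability of the coarse system is asserted separately so that
  the claim for every solution \<open>a\<close> is not vacuous. For \<alpha> = 0 every scale would
  be resonant and the quotients \<open>q\<close> would lose their meaning, hence the guard.\<close>

theorem theorem5:
  fixes \<alpha> :: real and j0 :: nat and \<beta> :: complex
    and g :: "(cantor \<Rightarrow> complex) \<Rightarrow> complex"
    and q :: "int \<Rightarrow> nat \<Rightarrow> complex"
  assumes \<beta>: "\<beta> = - complex_of_real (2 powr (real j0 * \<alpha>))"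
    and g: "g \<in> dual haar_polynomials"
    and q: "\<And>j k. q j k = g (psi j k) / (complex_of_real (2 powr (real_of_int j * \<alpha>)) + \<beta>)"
  shows
    "((\<exists>k. g (psi (int j0) k) \<noteq> 0) \<longrightarrow> solutions \<alpha> \<beta> g = {})
     \<and> (\<alpha> \<noteq> 0 \<and> (\<forall>k. g (psi (int j0) k) = 0) \<longrightarrow>
         solutions \<alpha> \<beta> g =
           {\<lambda>\<phi>\<in>haar_polynomials.
              haar_series (- {int j0}) q \<phi> + haar_series {int j0} (\<lambda>_. c) \<phi> | c. True}
         \<and> ((\<exists>g0. continuous_on UNIV g0 \<and> g = regular haar_polynomials g0) \<longrightarrow>
             (\<exists>a. coarse_system (\<lambda>j k. q (- int j) k) a)
             \<and> (\<forall>a. coarse_system (\<lambda>j k. q (- int j) k) a \<longrightarrow>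
                 {regular test_functions f | f.
                    continuous_on UNIV f \<and> regular haar_polynomials f \<in> solutions \<alpha> \<beta> g} =
                 {\<lambda>\<phi>\<in>test_functions.
                    phi_series a \<phi> + haar_series ({0..} - {int j0}) q \<phi>
                      + haar_series {int j0} (\<lambda>_. c) \<phi> + pairing (\<lambda>_. C) \<phi> | c C. True})))"
proof (intro conjI impI)
  have resonance: "eigval \<alpha> (int j0) + \<beta> = 0" by (simp add: eigval_def \<beta>)
  show "solutions \<alpha> \<beta> g = {}" if "\<exists>k. g (psi (int j0) k) \<noteq> 0"
  proof (rule equals0I)
    fix f assume "f \<in> solutions \<alpha> \<beta> g"
    then have "(eigval \<alpha> (int j0) + \<beta>) * f (psi (int j0) k) = g (psi (int j0) k)" for k
      unfolding solutions_iff[OF g] by blast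
    then show False using that by (simp add: resonance)
  qed
  assume "\<alpha> \<noteq> 0 \<and> (\<forall>k. g (psi (int j0) k) = 0)"
  then have \<alpha>: "\<alpha> \<noteq> 0" and g_j0: "\<And>k. g (psi (int j0) k) = 0" by auto
  have \<beta>0: "\<beta> \<noteq> 0" by (simp add: \<beta>)
  have q': "q j k = g (psi j k) / (eigval \<alpha> j + \<beta>)" for j k by (simp add: q eigval_def)
  have nonres: "eigval \<alpha> j + \<beta> \<noteq> 0" if "j \<noteq> int j0" for j
  proof
    assume "eigval \<alpha> j + \<beta> = 0"
    then have "eigval \<alpha> j = eigval \<alpha> (int j0)" using resonance by (metis add_right_cancel)
    then show False using that eigval_inj[OF \<alpha>] by blast
  qed
  have sol: "f \<in> solutions \<alpha> \<beta> g \<longleftrightarrow> f \<in> dual haar_polynomials \<and> (\<forall>j k. j \<noteq> int j0 \<longrightarrow> f (psi j k) = q j k)" for f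
  proof -
    have "(eigval \<alpha> j + \<beta>) * f (psi j k) = g (psi j k) \<longleftrightarrow> (j \<noteq> int j0 \<longrightarrow> f (psi j k) = q j k)" for j k
    proof (cases "j = int j0")
      case False
      then show ?thesis using nonres[of j] by (simp add: q' eq_divide_eq mult.commute)
    qed (simp only: resonance g_j0, simp)
    then show ?thesis unfolding solutions_iff[OF g] by blast
  qed
  \<comment> \<open>Both series are merged into one with modified coefficients, so that
    \<open>haar_series_dual\<close> and \<open>haar_series_psi\<close> apply directly.\<close>
  define R where "R c = (\<lambda>\<phi>\<in>haar_polynomials. haar_series UNIV (\<lambda>j. if j = int j0 then c else q j) \<phi>)" for c
  have R: "(\<lambda>\<phi>\<in>haar_polynomials. haar_series (- {int j0}) q \<phi> + haar_series {int j0} (\<lambda>_. c) \<phi>) = R c" for c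
    unfolding R_def
  proof (rule restrict_ext)
    fix \<phi> assume \<phi>: "\<phi> \<in> haar_polynomials"
    have "haar_series (- {int j0}) q \<phi> + haar_series {int j0} (\<lambda>_. c) \<phi> =
        haar_series (- {int j0}) (\<lambda>j. if j = int j0 then c else q j) \<phi> +
        haar_series {int j0} (\<lambda>j. if j = int j0 then c else q j) \<phi>"
      by (intro arg_cong2[of _ _ _ _ plus] haar_series_cong) auto
    also have "\<dots> = haar_series UNIV (\<lambda>j. if j = int j0 then c else q j) \<phi>"
    proof -
      have "- {int j0} \<union> {int j0} = UNIV" by auto
      then show ?thesis
        using haar_series_split[of "- {int j0}" "{int j0}" \<phi>] finite_spectrum_haar_polynomial[OF \<phi>]
        by simp
    qed
    finally show "haar_series (- {int j0}) q \<phi> + haar_series {int j0} (\<lambda>_. c) \<phi> =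
        haar_series UNIV (\<lambda>j. if j = int j0 then c else q j) \<phi>" .
  qed
  have R_dual: "R c \<in> dual haar_polynomials" for c unfolding R_def by (rule haar_series_dual)
  have R_psi: "R c (psi j k) = (if j = int j0 then c k else q j k)" for c j k
    by (simp add: R_def haar_polynomials_psi haar_series_psi)
  show "solutions \<alpha> \<beta> g = {\<lambda>\<phi>\<in>haar_polynomials. haar_series (- {int j0}) q \<phi> + haar_series {int j0} (\<lambda>_. c) \<phi> | c. True}"
    unfolding R
  proof (intro equalityI subsetI)
    fix f assume f: "f \<in> solutions \<alpha> \<beta> g"
    have "f = R (\<lambda>k. f (psi (int j0) k))"
      by (rule dual_eqI) (use f in \<open>auto simp: sol R_dual R_psi\<close>)
    then show "f \<in> {R c |c. True}" by blast
  next
    fix f assume "f \<in> {R c |c. True}"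
    then show "f \<in> solutions \<alpha> \<beta> g" by (auto simp: sol R_dual R_psi)
  qed
  show "\<exists>a. coarse_system (\<lambda>j k. q (- int j) k) a" by (rule coarse_system_solvable)
  assume "\<exists>g0. continuous_on UNIV g0 \<and> g = regular haar_polynomials g0"
  then obtain g0 where g0: "continuous_on UNIV g0" "g = regular haar_polynomials g0" by blast
  have g_psi: "g (psi j k) = pairing g0 (psi j k)" for j k
    by (simp add: g0(2) regular_def haar_polynomials_psi)
  have sol_cont: "regular haar_polynomials f \<in> solutions \<alpha> \<beta> g \<longleftrightarrow>
      (\<forall>j k. 0 \<le> j \<longrightarrow> j \<noteq> int j0 \<longrightarrow> pairing f (psi j k) = q j k) \<and>
      coarse_system (\<lambda>j k. q (- int j) k) (\<lambda>k. pairing f (phi0 k))"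
    if "continuous_on UNIV f" for f
  proof -
    have li: "locally_integrable f" using that by (rule locally_integrable_continuous)
    have "regular haar_polynomials f \<in> solutions \<alpha> \<beta> g \<longleftrightarrow> (\<forall>j k. j \<noteq> int j0 \<longrightarrow> pairing f (psi j k) = q j k)"
      unfolding sol using regular_dual[OF li] by (simp add: regular_def haar_polynomials_psi)
    also have "\<dots> \<longleftrightarrow> (\<forall>j k. 0 \<le> j \<longrightarrow> j \<noteq> int j0 \<longrightarrow> pairing f (psi j k) = q j k) \<and>
        (\<forall>i\<ge>1. \<forall>k. pairing f (psi (- int i) k) = q (- int i) k)"
    proof (intro iffI conjI allI impI)
      fix j k assume *: "(\<forall>j k. 0 \<le> j \<longrightarrow> j \<noteq> int j0 \<longrightarrow> pairing f (psi j k) = q j k) \<and>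
        (\<forall>i\<ge>1. \<forall>k. pairing f (psi (- int i) k) = q (- int i) k)" and j: "j \<noteq> int j0"
      show "pairing f (psi j k) = q j k"
      proof (cases "0 \<le> j")
        case False
        then show ?thesis using conjunct2[OF *, rule_format, of "nat (- j)" k] by simp
      qed (use * j in blast)
    qed auto
    finally show ?thesis unfolding pairing_phi0_coarse_system[OF li] .
  qed
  show "\<forall>a. coarse_system (\<lambda>j k. q (- int j) k) a \<longrightarrow>
         {regular test_functions f | f.
            continuous_on UNIV f \<and> regular haar_polynomials f \<in> solutions \<alpha> \<beta> g} =
         {\<lambda>\<phi>\<in>test_functions.
            phi_series a \<phi> + haar_series ({0..} - {int j0}) q \<phi>
              + haar_series {int j0} (\<lambda>_. c) \<phi> + pairing (\<lambda>_. C) \<phi> | c C. True}"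
    (is "\<forall>a. _ \<longrightarrow> ?L = ?R a")
  proof (intro allI impI equalityI subsetI)
    fix a F assume a: "coarse_system (\<lambda>j k. q (- int j) k) a" and "F \<in> ?L"
    then obtain f where f: "F = regular test_functions f" "continuous_on UNIV f"
      "regular haar_polynomials f \<in> solutions \<alpha> \<beta> g" by blast
    \<comment> \<open>The offset is read off at index 0; by \<open>coarse_system_unique\<close> it
      is the same at every index.\<close>
    define C where "C = pairing f (phi0 0) - a 0"
    have "pairing f (phi0 k) = a k + C" for k
      using coarse_system_unique[OF a conjunct2[OF f(3)[unfolded sol_cont[OF f(2)]]], of k]
      by (simp add: C_def algebra_simps)
    then have "F = (\<lambda>\<phi>\<in>test_functions.
        phi_series a \<phi> + haar_series ({0..} - {int j0}) q \<phi>
          + haar_series {int j0} (\<lambda>_ k. pairing f (psi (int j0) k)) \<phi> + pairing (\<lambda>_. C) \<phi>)"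
      unfolding f(1) using f(3)[unfolded sol_cont[OF f(2)]]
      by (intro regular_test_functions_eq locally_integrable_continuous f(2)) auto
    then show "F \<in> ?R a" by blast
  next
    fix a F assume a: "coarse_system (\<lambda>j k. q (- int j) k) a" and "F \<in> ?R a"
    then obtain c C where F: "F = (\<lambda>\<phi>\<in>test_functions.
        phi_series a \<phi> + haar_series ({0..} - {int j0}) q \<phi>
          + haar_series {int j0} (\<lambda>_. c) \<phi> + pairing (\<lambda>_. C) \<phi>)" by blast
    obtain s \<mu> where \<mu>: "summable (\<lambda>j. norm (\<mu> j))" "\<And>j. s + \<mu> j = 1 / (eigval \<alpha> (int j) + \<beta>)"
      using multiplier_decomposition[OF \<alpha> \<beta>0] by metis
    obtain f where f: "continuous_on UNIV f" "\<And>k. pairing f (phi0 k) = a k + C"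
      "\<And>j k. pairing f (psi (int j) k) = (s + \<mu> j) * pairing g0 (psi (int j) k) + of_bool (j = j0) * c k"
      using continuous_with_coefficients[OF g0(1) \<mu>(1), of "\<lambda>k. a k + C" s j0 c] by metis
    \<comment> \<open>At \<open>j0\<close> the multiplier is 1/0 = 0, so the contribution of
      \<open>g0\<close> disappears and \<open>c k\<close> remains.\<close>
    have f_psi: "pairing f (psi j k) = (if j = int j0 then c k else q j k)" if "0 \<le> j" for j k
      using f(3)[of "nat j" k] that
      by (auto simp: \<mu>(2) q' g_psi resonance nat_eq_iff2)
    \<comment> \<open>The two halves of a block have equally many entries, so a constant shift
      cancels in every row.\<close>
    have "coarse_system (\<lambda>j k. q (- int j) k) (\<lambda>k. a k + C)"
      using a by (simp add: coarse_system_iff block_diff_def block_sum_def sum.distrib)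
    then have "regular haar_polynomials f \<in> solutions \<alpha> \<beta> g"
      unfolding sol_cont[OF f(1)] by (simp add: f_psi f(2))
    moreover have "F = regular test_functions f"
      unfolding F
      by (rule regular_test_functions_eq[symmetric])
        (simp_all add: locally_integrable_continuous f(1,2) f_psi)
    ultimately show "F \<in> ?L" using f(1) by blast
  qed
qed

end
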